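(* Let $\rho,\sigma$ be quantum states of rank at most $r$ and let $0\le\varepsilon_1<\varepsilon_2$ be reals. Given independent copies of $\rho$ and $\sigma$, there is a quantum algorithm that, with probability at least $2/3$, distinguishes the case $\mathrm{H}(\rho,\sigma)\le\varepsilon_1$ from the case $\mathrm{H}(\rho,\sigma)\ge\varepsilon_2$, using $O\!\left(\frac{r^{3.5}}{(\varepsilon_2-\varepsilon_1)^{20}}\log^4\frac{r}{\varepsilon_2-\varepsilon_1}\right)$ samples of $\rho$ and $\sigma$.
   Context: The quantum Hellinger distance is $\mathrm{H}(\rho,\sigma)=\sqrt{\tfrac12\operatorname{tr}\big((\sqrt\rho-\sqrt\sigma)^2\big)}=\sqrt{1-\operatorname{tr}(\sqrt\rho\sqrt\sigma)}$. A quantum algorithm with sample access applies a fixed quantum channel to $\rho^{\otimes k}\otimes\sigma^{\otimes l}$ (and ancillas) and measures; its sample complexity is $k+l$. *)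

theory Defs
  imports "Jordan_Normal_Form.Schur_Decomposition" "Jordan_Normal_Form.DL_Rank"
begin

definition mtrace :: "complex mat \<Rightarrow> complex" where
  "mtrace A = (\<Sum>i<dim_row A. A $$ (i, i))"

definition hermitian :: "complex mat \<Rightarrow> bool" where
  "hermitian A \<longleftrightarrow> mat_adjoint A = A"

definition psd :: "nat \<Rightarrow> complex mat \<Rightarrow> bool" where
  "psd n A \<longleftrightarrow> A \<in> carrier_mat n n \<and> hermitian A \<and>
     (\<forall>v \<in> carrier_vec n. 0 \<le> Re ((A *\<^sub>v v) \<bullet>c v))"

definition density :: "nat \<Rightarrow> complex mat \<Rightarrow> bool" where
  "density n A \<longleftrightarrow> psd n A \<and> mtrace A = 1"

definition mrank :: "complex mat \<Rightarrow> nat" where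
  "mrank A = vec_space.rank (dim_row A) A"

definition msqrt :: "complex mat \<Rightarrow> complex mat" where
  "msqrt A = (THE B. psd (dim_row A) B \<and> B * B = A)"

definition hellinger :: "complex mat \<Rightarrow> complex mat \<Rightarrow> real" where
  "hellinger \<rho> \<sigma> = sqrt (Re (mtrace ((msqrt \<rho> - msqrt \<sigma>) * (msqrt \<rho> - msqrt \<sigma>))) / 2)"

definition kron :: "complex mat \<Rightarrow> complex mat \<Rightarrow> complex mat" where
  "kron A B = mat (dim_row A * dim_row B) (dim_col A * dim_col B)
     (\<lambda>(i, j). A $$ (i div dim_row B, j div dim_col B) * B $$ (i mod dim_row B, j mod dim_col B))"

fun tpow :: "complex mat \<Rightarrow> nat \<Rightarrow> complex mat" where
  "tpow A 0 = 1\<^sub>m 1"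
| "tpow A (Suc k) = kron A (tpow A k)"

(* quantum channel from n x n to m x m matrices, given by Kraus operators *)
definition is_channel :: "nat \<Rightarrow> nat \<Rightarrow> complex mat list \<Rightarrow> bool" where
  "is_channel n m Ks \<longleftrightarrow> (\<forall>K \<in> set Ks. K \<in> carrier_mat m n) \<and>
     foldr (\<lambda>K acc. mat_adjoint K * K + acc) Ks (0\<^sub>m n n) = 1\<^sub>m n"

definition apply_channel :: "nat \<Rightarrow> complex mat list \<Rightarrow> complex mat \<Rightarrow> complex mat" where
  "apply_channel m Ks X = foldr (\<lambda>K acc. K * X * mat_adjoint K + acc) Ks (0\<^sub>m m m)"

(* A sample-access algorithm on d-dimensional states using k copies of rho and l copies
   of sigma: ancilla state tau (dimension a), channel Ks from dimension d^(k+l)*a to m,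
   followed by a two-outcome measurement {E, I - E}; outcome E means "close". *)
definition valid_algorithm ::
  "nat \<Rightarrow> nat \<Rightarrow> nat \<Rightarrow> nat \<Rightarrow> complex mat \<Rightarrow> complex mat list \<Rightarrow> nat \<Rightarrow> complex mat \<Rightarrow> bool" where
  "valid_algorithm d k l a \<tau> Ks m E \<longleftrightarrow> density a \<tau> \<and> is_channel (d ^ (k + l) * a) m Ks \<and>
     psd m E \<and> psd m (1\<^sub>m m - E)"

definition prob_close ::
  "nat \<Rightarrow> nat \<Rightarrow> complex mat \<Rightarrow> complex mat list \<Rightarrow> nat \<Rightarrow> complex mat \<Rightarrow> complex mat \<Rightarrow> complex mat \<Rightarrow> real" where
  "prob_close k l \<tau> Ks m E \<rho> \<sigma> =
     Re (mtrace (E * apply_channel m Ks (kron (kron (tpow \<rho> k) (tpow \<sigma> l)) \<tau>)))"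

end

(*
  Let T = tr (sqrt rho sqrt sigma) = 1 - H^2. The two cases differ in T by at least
  eps = (eps2 - eps1)^2, so it suffices to estimate T to precision eps/4.

  Write S_j for the swap of a system register with the j-th copy of rho. Multiplying the operator
  c - i s S_j into an observable and tracing out the copy multiplies the system operator by exactly
  c - i s rho, at no loss in norm when c^2 + s^2 <= 1. Hence, for u(x) = (1 - h^2) - i h x, each
  tr (u(sigma)^m u(rho)^n rho) is the expectation of a contraction on n + 1 copies of rho and m copies
  of sigma, and so linear combinations of these are expectations of observables whose norm is
  bounded by the 1-norm of the coefficients.

  Since 1 - u(x) is approximately i h x, truncated binomial series of (1 - u)^(-1/2) and (1 - u^K)^(1/2)
  give x^(-1/2) and x^(1/2). With h = 1/K^2 the uniform errors (after multiplication by x in the first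
  case) are 6/K, the copies needed are 1 + 2 K^4 and the norm of the observable is at most 4 K^(3/2).
  The rank bound turns the uniform error into an error O(sqrt r / K) for T, so K of order sqrt r / eps
  suffices. Repeating O(K^3 / eps^2) times and applying Chebyshev's inequality costs
  O(K^7 / eps^2) = O(r^(7/2) / eps^9) copies in total.
*)
theory Submission
  imports Defs "Jordan_Normal_Form.Spectral_Radius" "HOL-Computational_Algebra.Formal_Power_Series"
begin

text \<open>The trace supplies one free factor rho, the system register itself. It tames the
  singularity of x^(-1/2) at 0, so an inverse root can be used for rho. Nothing of the kind is
  available for sigma, whose square root must be approximated uniformly down to x = 0; hence the two
  different series. The obstacle is the norm of the observable, whose square governs the number of
  repetitions. Using (1 - u)^(1/2), about (i h x)^(1/2), for sigma would need the prefactor h^(-1/2)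
  = K. Passing to u^K enlarges the argument to about i x / K, so that the prefactor is only K^(1/2).
  This is what gives the norm K^(3/2) instead of K^2, and r^(7/2) instead of r^4. The price is that
  1 - u^K is linear in x only up to an error of order x^2 / K^2, too large for the Hoelder
  continuity of the square root alone. The real part 1 - h^2 of u makes each step a contraction. It
  shifts 1 - u by h^2, which the square root turns into an error of order h, the same order as the
  truncation error at length 1/h^2.\<close>

section \<open>Approximating the square root by powers of near-unitary numbers\<close>

(* cbin n = (2n choose n) / 4^n and sqc n are the coefficients of (1 - u)^(-1/2) and (1 - u)^(1/2). *)
primrec cbin :: "nat \<Rightarrow> real" where
  "cbin 0 = 1"
| "cbin (Suc n) = cbin n * (2 * real n + 1) / (2 * real n + 2)"

definition sqc :: "nat \<Rightarrow> real" where
  "sqc n = (if n = 0 then 1 else cbin n - cbin (n - 1))"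

section \<open>Size, partial sums and convolution of the coefficients\<close>

lemma cbin_pos: "cbin n > 0"
  by (induction n) (auto intro!: divide_pos_pos mult_pos_pos)

lemma cbin_Suc_le: "cbin (Suc n) \<le> cbin n"
  using cbin_pos[of n] by (simp add: field_simps)

lemma cbin_le_1: "cbin n \<le> 1"
proof (induction n)
  case (Suc n)
  with cbin_Suc_le[of n] show ?case by linarith
qed simp

text \<open>Consecutive values have ratio (2n+1)(2n+3)/(2n+2)^2 <= 1, so the product never exceeds
  its value 1 at n = 0. This Wallis-type bound is the source of the decay n^(-1/2) that fixes the
  truncation lengths.\<close>

lemma cbin_sq_le: "(cbin n)\<^sup>2 * (2 * real n + 1) \<le> 1"
proof (induction n)
  case (Suc n)
  have "(2 * real n + 1) * (2 * real n + 3) \<le> (2 * real n + 2)\<^sup>2"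
    by (simp add: power2_eq_square algebra_simps)
  then have q: "(2 * real n + 1) * (2 * real n + 3) / (2 * real n + 2)\<^sup>2 \<le> 1"
    by (simp add: divide_le_eq)
  have "(cbin (Suc n))\<^sup>2 * (2 * real (Suc n) + 1)
      = ((cbin n)\<^sup>2 * (2 * real n + 1)) * ((2 * real n + 1) * (2 * real n + 3) / (2 * real n + 2)\<^sup>2)"
    by (simp add: power2_eq_square field_simps)
  also have "\<dots> \<le> 1 * 1"
    by (rule mult_mono[OF Suc q]) auto
  finally show ?case by simp
qed simp

lemma cbin_le: "cbin n \<le> 1 / sqrt (2 * real n + 1)"
proof -
  have "cbin n * sqrt (2 * real n + 1) \<le> 1"
    using cbin_sq_le[of n] cbin_pos[of n]
    by (rule_tac power2_le_imp_le) (auto simp: power_mult_distrib)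
  then show ?thesis by (simp add: field_simps)
qed

text \<open>Partial sums of the coefficients of (1 - u)^(-1/2) are the coefficients of (1 -
  u)^(-3/2), whence the closed form. Together with \<open>cbin_le\<close> it shows that the
  truncated inverse root has 1-norm of order sqrt n.\<close>

lemma sum_cbin: "(\<Sum>k\<le>n. cbin k) = (2 * real n + 1) * cbin n"
  by (induction n) (auto simp: field_simps)

lemma sum_cbin_le: "(\<Sum>k\<le>n. cbin k) \<le> sqrt (2 * real n + 1)"
proof -
  have "(2 * real n + 1) * cbin n \<le> (2 * real n + 1) * (1 / sqrt (2 * real n + 1))"
    by (intro mult_left_mono cbin_le) auto
  also have "\<dots> = sqrt (2 * real n + 1)"
    by (simp add: real_div_sqrt)
  finally show ?thesis by (simp add: sum_cbin)
qed

lemma abs_sqc_Suc: "\<bar>sqc (Suc n)\<bar> = cbin n - cbin (Suc n)"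
  using cbin_Suc_le[of n] by (simp add: sqc_def del: cbin.simps)

text \<open>After the constant term all coefficients of (1 - u)^(1/2) are negative, so their
  absolute values telescope. Lengthening this series therefore does not enlarge the
  observable.\<close>

lemma sum_abs_sqc_le: "(\<Sum>k\<le>n. \<bar>sqc k\<bar>) \<le> 2"
proof -
  have "(\<Sum>k\<le>n. \<bar>sqc k\<bar>) = 2 - cbin n"
    by (induction n) (auto simp: abs_sqc_Suc sqc_def[of 0] simp del: cbin.simps(2))
  then show ?thesis using cbin_pos[of n] by simp
qed

lemma sum_abs_sqc_tail: "(\<Sum>k=Suc m..m + j. \<bar>sqc k\<bar>) = cbin m - cbin (m + j)"
  by (induction j) (auto simp: abs_sqc_Suc simp del: cbin.simps(2))

text \<open>Ties the recursion to generalized binomial coefficients, to which the Vandermonde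
  identity applies.\<close>

lemma gbinomial_cbin: "(- 1 / 2 :: complex) gchoose n = (- 1) ^ n * of_real (cbin n)"
proof (induction n)
  case (Suc n)
  have "(- 1 / 2 :: complex) gchoose Suc n = ((- 1 / 2) gchoose n) * ((- 1 / 2 - of_nat n) / of_nat (Suc n))"
  proof -
    have nz: "(of_nat (Suc n) :: complex) \<noteq> 0" by (rule of_nat_neq_0)
    have "of_nat (Suc n) * ((- 1 / 2 :: complex) gchoose Suc n) = ((- 1 / 2) gchoose n) * (- 1 / 2 - of_nat n)"
      using gbinomial_mult_1[of "- 1 / 2 :: complex" n] by (simp add: algebra_simps)
    then have "(- 1 / 2 :: complex) gchoose Suc n = ((- 1 / 2) gchoose n) * (- 1 / 2 - of_nat n) / of_nat (Suc n)"
      using nz nonzero_eq_divide_eq[OF nz] by (metis mult.commute)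
    then show ?thesis by (simp only: times_divide_eq_right)
  qed
  also have "\<dots> = (- 1) ^ Suc n * of_real (cbin (Suc n))"
  proof -
    have "(1 :: complex) + of_nat n \<noteq> 0" using of_nat_neq_0[of n, where 'a=complex] by simp
    moreover from this have "(2 :: complex) + of_nat n * 2 \<noteq> 0"
      by (metis distrib_right mult_1 mult_eq_0_iff mult_2 one_add_one zero_neq_numeral)
    ultimately show ?thesis
      unfolding Suc by (simp add: field_simps)
  qed
  finally show ?case .
qed simp

text \<open>Vandermonde with both exponents -1/2: the square of the series of (1 - u)^(-1/2) is the
  geometric series. The signs (-1)^n on the two sides cancel.\<close>

lemma cbin_convolution: "(\<Sum>i\<le>n. (of_real (cbin i) * of_real (cbin (n - i)) :: complex)) = 1"
proof -
  have "(\<Sum>i=0..n. ((- 1 / 2 :: complex) gchoose i) * ((- 1 / 2) gchoose (n - i))) = (- 1) gchoose n"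
    using gbinomial_Vandermonde[of "- 1 / 2 :: complex" "- 1 / 2" n] by simp
  also have "(- 1 :: complex) gchoose n = (- 1) ^ n"
    using gbinomial_minus[of "1::complex" n] by (simp add: binomial_gbinomial[symmetric])
  finally have "(\<Sum>i=0..n. (- 1) ^ i * of_real (cbin i) * ((- 1) ^ (n - i) * of_real (cbin (n - i))) :: complex) = (- 1) ^ n"
    by (simp only: gbinomial_cbin)
  moreover have "(- 1) ^ i * of_real (cbin i) * ((- 1) ^ (n - i) * of_real (cbin (n - i)))
      = ((- 1) ^ n * (of_real (cbin i) * of_real (cbin (n - i))) :: complex)" if "i \<le> n" for i
    using power_add[of "- 1 :: complex" i "n - i"] that by simp
  ultimately have "(- 1) ^ n * (\<Sum>i=0..n. (of_real (cbin i) * of_real (cbin (n - i)) :: complex)) = (- 1) ^ n"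
    by (simp add: sum_distrib_left)
  then show ?thesis by (simp add: atLeast0AtMost)
qed


text \<open>The product telescopes because \<open>sqc\<close> consists of the differences of
  \<open>cbin\<close>; one boundary term remains. The identity is exact at every truncation, so it
  converts the inverse root into the root both for finite sums and in the limit.\<close>

lemma sqc_partial_sum:
  fixes u :: complex
  shows "(1 - u) * (\<Sum>n\<le>N. of_real (cbin n) * u ^ n)
    = (\<Sum>n\<le>N. of_real (sqc n) * u ^ n) - of_real (cbin N) * u ^ Suc N"
proof (induction N)
  case (Suc N)
  have "of_real (cbin (Suc N)) = (of_real (sqc (Suc N)) + of_real (cbin N) :: complex)"
    by (simp add: sqc_def del: cbin.simps)
  then show ?case
    using Suc by (simp add: algebra_simps del: cbin.simps)
qed (simp add: sqc_def algebra_simps)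

text \<open>\<open>S\<close> is (1 - u) times the sum \<open>B\<close> of the inverse root series,
  and B^2 = 1/(1 - u) by Cauchy product and \<open>cbin_convolution\<close>. The tail is dominated
  by the telescoping sum of |sqc|, hence uniformly in \<open>u\<close>. Its case N = 0, |S - 1| <=
  1, selects the branch with nonnegative real part.\<close>

lemma sqrt_series:
  fixes u :: complex
  assumes u: "norm u < 1"
  obtains S where "S\<^sup>2 = 1 - u" "Re S \<ge> 0"
    "\<And>N. norm (S - (\<Sum>n\<le>N. of_real (sqc n) * u ^ n)) \<le> cbin N"
proof -
  define b where "b n = of_real (cbin n) * u ^ n" for n
  define A where "A N = (\<Sum>n\<le>N. of_real (sqc n) * u ^ n)" for N
  have nb: "norm (b n) \<le> norm u ^ n" for n
    using mult_right_mono[OF cbin_le_1[of n], of "norm u ^ n"] cbin_pos[of n]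
    by (simp add: b_def norm_mult norm_power)
  have sn: "summable (\<lambda>n. norm (b n))"
    by (rule summable_comparison_test'[where g = "\<lambda>n. norm u ^ n" and N = 0])
       (use u nb in \<open>auto intro: summable_geometric\<close>)
  define B where "B = suminf b"
  have "B * B = (\<Sum>k. \<Sum>i\<le>k. b i * b (k - i))"
    unfolding B_def by (rule Cauchy_product[OF sn sn])
  also have "(\<lambda>k. \<Sum>i\<le>k. b i * b (k - i)) = (\<lambda>k. u ^ k)"
  proof
    fix k
    have "(\<Sum>i\<le>k. b i * b (k - i)) = (\<Sum>i\<le>k. u ^ k * (of_real (cbin i) * of_real (cbin (k - i))))"
    proof (rule sum.cong[OF refl])
      fix i assume "i \<in> {..k}"
      then have "u ^ k = u ^ i * u ^ (k - i)" by (simp flip: power_add)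
      then show "b i * b (k - i) = u ^ k * (of_real (cbin i) * of_real (cbin (k - i)))"
        by (simp add: b_def)
    qed
    also have "\<dots> = u ^ k"
      by (simp only: sum_distrib_left[symmetric] cbin_convolution) simp
    finally show "(\<Sum>i\<le>k. b i * b (k - i)) = u ^ k" .
  qed
  also have "(\<Sum>k. u ^ k) = 1 / (1 - u)"
    using suminf_geometric[OF u] .
  finally have BB: "B * B = 1 / (1 - u)" .
  define S where "S = (1 - u) * B"
  have u1: "1 - u \<noteq> 0" using u by auto
  have "S\<^sup>2 = (1 - u)\<^sup>2 * (B * B)" by (simp add: S_def power2_eq_square)
  also have "\<dots> = 1 - u" using u1 by (simp add: BB power2_eq_square)
  finally have S2: "S\<^sup>2 = 1 - u" .
  have "(\<lambda>N. \<Sum>n<Suc N. b n) \<longlonglongrightarrow> B"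
    unfolding B_def using summable_LIMSEQ[OF summable_norm_cancel[OF sn]] by (rule LIMSEQ_Suc)
  then have "(\<lambda>N. \<Sum>n\<le>N. b n) \<longlonglongrightarrow> B" by (simp only: lessThan_Suc_atMost)
  then have l1: "(\<lambda>N. (1 - u) * (\<Sum>n\<le>N. b n)) \<longlonglongrightarrow> S"
    unfolding S_def by (intro tendsto_intros)
  have "(\<lambda>N. u * b N) \<longlonglongrightarrow> u * 0"
    by (intro tendsto_intros summable_LIMSEQ_zero summable_norm_cancel[OF sn])
  then have "(\<lambda>N. (1 - u) * (\<Sum>n\<le>N. b n) + u * b N) \<longlonglongrightarrow> S + u * 0"
    by (rule tendsto_add[OF l1])
  moreover have "(1 - u) * (\<Sum>n\<le>N. b n) + u * b N = A N" for N
    using sqc_partial_sum[of u N] by (simp add: b_def A_def)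
  ultimately have lA: "A \<longlonglongrightarrow> S" by simp
  have tail: "norm (S - A N) \<le> cbin N" for N
  proof (rule tendsto_upperbound)
    show "(\<lambda>M. norm (A M - A N)) \<longlonglongrightarrow> norm (S - A N)"
      by (intro tendsto_intros lA)
    show "\<forall>\<^sub>F M in sequentially. norm (A M - A N) \<le> cbin N"
      unfolding eventually_sequentially
    proof (intro exI allI impI)
      fix M assume "N \<le> M"
      then obtain j where j: "M = N + j" using le_Suc_ex by blast
      have "A M = A N + (\<Sum>n=Suc N..N + j. of_real (sqc n) * u ^ n)"
        unfolding A_def j using sum_up_index_split[of "\<lambda>n. of_real (sqc n) * u ^ n" N j] by simp
      then have "norm (A M - A N) \<le> (\<Sum>n=Suc N..N + j. norm (of_real (sqc n) * u ^ n))"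
        by (simp add: sum_norm_le)
      also have "\<dots> \<le> (\<Sum>n=Suc N..N + j. \<bar>sqc n\<bar>)"
        using u by (intro sum_mono) (auto simp: norm_mult norm_power intro!: mult_left_le power_le_one)
      also have "\<dots> \<le> cbin N"
        using cbin_pos[of "N + j"] by (simp add: sum_abs_sqc_tail)
      finally show "norm (A M - A N) \<le> cbin N" .
    qed
  qed simp
  have "norm (S - 1) \<le> 1" using tail[of 0] by (simp add: A_def sqc_def)
  then have "Re S \<ge> 0" using abs_Re_le_cmod[of "S - 1"] by simp
  with S2 tail show ?thesis using that unfolding A_def by blast
qed

text \<open>The two conditions place \<open>s\<close> in the sector |arg s| <= pi/4, where the
  cosine is at least 1/sqrt 2.\<close>

lemma norm_le_Re_if_sq:
  fixes s :: complex
  assumes "Re s \<ge> 0" "Re (s\<^sup>2) \<ge> 0"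
  shows "norm s \<le> sqrt 2 * Re s"
proof -
  have "(Im s)\<^sup>2 \<le> (Re s)\<^sup>2" using assms(2) by (simp add: power2_eq_square)
  then have "norm s \<le> sqrt (2 * (Re s)\<^sup>2)" by (simp add: norm_complex_def)
  then show ?thesis using assms by (simp add: real_sqrt_mult)
qed

text \<open>In the sector |arg| <= pi/4 there is no cancellation in s + t, so in s^2 - t^2 = (s -
  t)(s + t) the second factor is comparable to |s| + |t|. The first bound is Hoelder continuity of
  exponent 1/2 of the square root, the second its Lipschitz continuity away from 0.\<close>

lemma sqrt_diff_bounds:
  fixes s t :: complex
  assumes "Re s \<ge> 0" "Re (s\<^sup>2) \<ge> 0" "Re t \<ge> 0" "Re (t\<^sup>2) \<ge> 0"
  shows "(norm (s - t))\<^sup>2 \<le> sqrt 2 * norm (s\<^sup>2 - t\<^sup>2)"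
    and "norm (s - t) * norm t \<le> sqrt 2 * norm (s\<^sup>2 - t\<^sup>2)"
proof -
  have "norm s + norm t \<le> sqrt 2 * Re (s + t)"
    using norm_le_Re_if_sq[of s] norm_le_Re_if_sq[of t] assms by (simp add: algebra_simps)
  also have "\<dots> \<le> sqrt 2 * norm (s + t)" by (intro mult_left_mono complex_Re_le_cmod) auto
  finally have *: "norm s + norm t \<le> sqrt 2 * norm (s + t)" .
  have "s\<^sup>2 - t\<^sup>2 = (s - t) * (s + t)" by (simp add: power2_eq_square algebra_simps)
  then have e: "sqrt 2 * norm (s\<^sup>2 - t\<^sup>2) = norm (s - t) * (sqrt 2 * norm (s + t))"
    by (simp add: norm_mult)
  have "norm (s - t) \<le> sqrt 2 * norm (s + t)" using * norm_triangle_ineq4[of s t] by linarith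
  then show "(norm (s - t))\<^sup>2 \<le> sqrt 2 * norm (s\<^sup>2 - t\<^sup>2)"
    unfolding e power2_eq_square[of "norm (s - t)"] by (rule mult_left_mono) simp
  have "norm t \<le> sqrt 2 * norm (s + t)" using * norm_ge_zero[of s] by linarith
  then show "norm (s - t) * norm t \<le> sqrt 2 * norm (s\<^sup>2 - t\<^sup>2)"
    unfolding e by (rule mult_left_mono) simp
qed

text \<open>First-order expansion of u^m at 1, uniform on the closed disc. Each increment is u^m (1
  - u), and the first bound controls its deviation from 1 - u in the second.\<close>

lemma one_minus_power_bounds:
  fixes u :: complex
  assumes "norm u \<le> 1"
  shows "norm (1 - u ^ m) \<le> real m * norm (1 - u)"
    and "norm (1 - u ^ m - of_nat m * (1 - u)) \<le> (real m)\<^sup>2 / 2 * (norm (1 - u))\<^sup>2"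
proof -
  have 1: "norm (1 - u ^ m) \<le> real m * norm (1 - u)" for m
  proof (induction m)
    case (Suc m)
    have "1 - u ^ Suc m = (1 - u ^ m) + u ^ m * (1 - u)" by (simp add: algebra_simps)
    then have "norm (1 - u ^ Suc m) \<le> norm (1 - u ^ m) + norm u ^ m * norm (1 - u)"
      by (metis norm_triangle_ineq norm_mult norm_power)
    also have "\<dots> \<le> real m * norm (1 - u) + 1 * norm (1 - u)"
      using assms by (intro add_mono Suc mult_right_mono power_le_one) auto
    finally show ?case by (simp add: algebra_simps)
  qed simp
  show "norm (1 - u ^ m) \<le> real m * norm (1 - u)" by (rule 1)
  show "norm (1 - u ^ m - of_nat m * (1 - u)) \<le> (real m)\<^sup>2 / 2 * (norm (1 - u))\<^sup>2"
  proof (induction m)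
    case (Suc m)
    have "1 - u ^ Suc m - of_nat (Suc m) * (1 - u)
        = (1 - u ^ m - of_nat m * (1 - u)) - (1 - u ^ m) * (1 - u)" by (simp add: algebra_simps)
    then have "norm (1 - u ^ Suc m - of_nat (Suc m) * (1 - u))
        \<le> norm (1 - u ^ m - of_nat m * (1 - u)) + norm (1 - u ^ m) * norm (1 - u)"
      by (metis norm_triangle_ineq4 norm_mult)
    also have "\<dots> \<le> (real m)\<^sup>2 / 2 * (norm (1 - u))\<^sup>2 + (real m * norm (1 - u)) * norm (1 - u)"
      by (intro add_mono Suc mult_right_mono 1) auto
    also have "\<dots> \<le> (real (Suc m))\<^sup>2 / 2 * (norm (1 - u))\<^sup>2"
      by (simp add: power2_eq_square field_simps)
    finally show ?case .
  qed simp
qed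

text \<open>The square root of i in the right half-plane, that is, the phase of (i h
  x)^(1/2).\<close>

definition rot :: complex where "rot = cis (pi / 4)"

lemma rot_facts: "rot\<^sup>2 = \<i>" "cnj rot * rot = 1" "cnj rot * \<i> = rot" "norm rot = 1" "Re rot \<ge> 0"
proof -
  show 1: "rot\<^sup>2 = \<i>" by (simp add: rot_def power2_eq_square cis_mult)
  show 2: "cnj rot * rot = 1" by (simp add: rot_def cis_cnj cis_mult)
  have "cnj rot * \<i> = (cnj rot * rot) * rot" by (simp add: 1[symmetric] power2_eq_square)
  then show "cnj rot * \<i> = rot" by (simp add: 2)
  show "norm rot = 1" by (simp add: rot_def)
  show "Re rot \<ge> 0" by (simp add: rot_def cos_45)
qed

text \<open>The eigenvalue of the step operator c - i s rho, with c = 1 - h^2 and s = h, belonging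
  to an eigenvalue \<open>x\<close> of the state.\<close>

definition stepv :: "real \<Rightarrow> real \<Rightarrow> complex" where
  "stepv h x = Complex (1 - h\<^sup>2) (- (h * x))"

lemma norm_stepv_less_1:
  assumes "0 < h" "h < 1" "0 \<le> x" "x \<le> 1"
  shows "norm (stepv h x) < 1"
proof -
  have hh: "h * h < 1" using assms mult_strict_mono[of h 1 h 1] by simp
  have "(1 - h\<^sup>2)\<^sup>2 + (h * x)\<^sup>2 = 1 - 2 * (h * h) + (h * h) * (h * h) + (h * h) * (x * x)"
    by (simp add: power2_eq_square algebra_simps)
  moreover have "(h * h) * (x * x) \<le> (h * h) * 1" "(h * h) * (h * h) < (h * h) * 1"
    using assms hh by (auto intro!: mult_left_mono mult_le_one simp del: mult_1_right)
  ultimately have "(1 - h\<^sup>2)\<^sup>2 + (h * x)\<^sup>2 < 1" by linarith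
  then show ?thesis by (simp add: stepv_def norm_complex_def)
qed

text \<open>Multiplying the truncated sum \<open>P\<close> by i h x = (1 - u) - h^2 turns it, by
  \<open>sqc_partial_sum\<close>, into the truncated root series \<open>A\<close> and small terms;
  \<open>A\<close> is close to S = (1 - u)^(1/2), and S to t = (i h x)^(1/2). The errors are h
  (series tail), 2h (S against t), h (boundary term) and 2h (the term h^2 P); their sum 6h times the
  prefactor K is 6/K. The length K^4 = 1/h^2 is chosen so that \<open>cbin N\<close> is at most
  h.\<close>

lemma inverse_sqrt_approx:
  fixes K :: nat and x :: real
  assumes K: "K \<ge> 2" and x: "0 \<le> x" "x \<le> 1"
  defines "h \<equiv> 1 / (real K)\<^sup>2"
  shows "norm (of_real x * (rot * of_real (1 / K) * (\<Sum>n\<le>K ^ 4. of_real (cbin n) * stepv h x ^ n))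
     - of_real (sqrt x)) \<le> 6 / K"
proof -
  define u where "u = stepv h x"
  define N where "N = K ^ 4"
  define P where "P = (\<Sum>n\<le>N. of_real (cbin n) * u ^ n)"
  have K0: "real K > 0" using K by simp
  have "(1::real) < K\<^sup>2" using K by (simp add: one_less_power)
  then have h: "0 < h" "h < 1" using K0 by (auto simp: h_def divide_less_eq)
  have nu: "norm u < 1" unfolding u_def by (rule norm_stepv_less_1[OF h x])
  obtain S where S: "S\<^sup>2 = 1 - u" "Re S \<ge> 0"
    "\<And>N. norm (S - (\<Sum>n\<le>N. of_real (sqc n) * u ^ n)) \<le> cbin N"
    using sqrt_series[OF nu] by blast
  define t where "t = rot * of_real (sqrt (h * x))"
  have t2: "t\<^sup>2 = \<i> * of_real (h * x)"
    using h x by (simp add: t_def power_mult_distrib rot_facts flip: of_real_power)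
  have u1: "1 - u = of_real (h\<^sup>2) + \<i> * of_real (h * x)"
    by (simp add: u_def stepv_def complex_eq_iff)
  \<comment> \<open>The squares differ by exactly h^2, so the Hoelder bound alone gives |S - t| of
    order h.\<close>
  have "(norm (S - t))\<^sup>2 \<le> sqrt 2 * norm (S\<^sup>2 - t\<^sup>2)"
  proof (rule sqrt_diff_bounds(1)[OF S(2)])
    show "Re (S\<^sup>2) \<ge> 0" using h by (simp add: S(1) u1)
    show "Re t \<ge> 0" using h x rot_facts(5) by (simp add: t_def)
    show "Re (t\<^sup>2) \<ge> 0" by (simp add: t2)
  qed
  also have "S\<^sup>2 - t\<^sup>2 = of_real (h\<^sup>2)" by (simp add: S(1) t2 u1)
  also have "sqrt 2 * norm (of_real (h\<^sup>2) :: complex) \<le> 4 * h\<^sup>2"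
    using sqrt2_less_2 by (simp add: mult_right_mono flip: of_real_power)
  finally have "(norm (S - t))\<^sup>2 \<le> (2 * h)\<^sup>2" by (simp add: power_mult_distrib)
  then have St: "norm (S - t) \<le> 2 * h" by (rule power2_le_imp_le) (use h in simp)
  have N2: "2 * real N + 1 \<le> (2 / h)\<^sup>2" "(1 / h)\<^sup>2 \<le> 2 * real N + 1"
  proof -
    have "(1 / h)\<^sup>2 = real N" using K0 by (simp add: h_def N_def flip: power_mult)
    moreover have "real N \<ge> 1" using K by (simp add: N_def)
    ultimately show "2 * real N + 1 \<le> (2 / h)\<^sup>2" "(1 / h)\<^sup>2 \<le> 2 * real N + 1"
      by (auto simp: power_divide)
  qed
  have "norm P \<le> (\<Sum>n\<le>N. norm (of_real (cbin n) * u ^ n))" unfolding P_def by (rule norm_sum)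
  also have "\<dots> \<le> (\<Sum>n\<le>N. cbin n)"
    using nu cbin_pos
    by (intro sum_mono) (auto simp: norm_mult norm_power less_imp_le intro!: mult_left_le power_le_one)
  also have "\<dots> \<le> sqrt (2 * real N + 1)" by (rule sum_cbin_le)
  also have "\<dots> \<le> 2 / h" using N2(1) h by (intro real_le_lsqrt) auto
  finally have P: "norm P \<le> 2 / h" .
  have "1 / h \<le> sqrt (2 * real N + 1)" using N2(2) by (rule real_le_rsqrt)
  then have "1 / sqrt (2 * real N + 1) \<le> h" using h
    by (simp add: field_simps)
  then have c: "cbin N \<le> h" using cbin_le[of N] by linarith
  have e1: "norm (of_real (cbin N) * u ^ Suc N) \<le> h"
  proof -
    have "norm (of_real (cbin N) * u ^ Suc N) \<le> cbin N"
      using nu cbin_pos[of N] by (simp add: norm_mult norm_power mult_left_le power_le_one mult_le_one)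
    with c show ?thesis by linarith
  qed
  have e2: "norm (of_real (h\<^sup>2) * P) \<le> 2 * h"
  proof -
    have "norm (of_real (h\<^sup>2) * P) = h\<^sup>2 * norm P" by (simp add: norm_mult flip: of_real_power)
    also have "\<dots> \<le> h\<^sup>2 * (2 / h)" by (rule mult_left_mono[OF P]) simp
    finally show ?thesis using h by (simp add: power2_eq_square)
  qed
  define A where "A = (\<Sum>n\<le>N. of_real (sqc n) * u ^ n)"
  have hP: "\<i> * of_real (h * x) * P = A - of_real (cbin N) * u ^ Suc N - of_real (h\<^sup>2) * P"
  proof -
    have "\<i> * of_real (h * x) * P = (1 - u) * P - of_real (h\<^sup>2) * P" by (simp add: u1 algebra_simps)
    also have "(1 - u) * P = A - of_real (cbin N) * u ^ Suc N"
      unfolding P_def A_def by (rule sqc_partial_sum)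
    finally show ?thesis .
  qed
  have Kh: "of_real (real K) * of_real (real K) * of_real h = (1 :: complex)"
  proof -
    have "real K * real K * h = 1" using K0 by (simp add: h_def power2_eq_square)
    then show ?thesis by (metis of_real_1 of_real_mult)
  qed
  \<comment> \<open>Uses \<open>cnj rot * \<i> = rot\<close> and K h = 1/K.\<close>
  have xf: "of_real x * (rot * of_real (1 / K) * P) = of_real (real K) * cnj rot * (\<i> * of_real (h * x) * P)"
  proof -
    have "of_real (real K) * cnj rot * (\<i> * of_real (h * x) * P)
        = (cnj rot * \<i>) * (of_real (real K) * of_real h) * of_real x * P" by simp
    also have "of_real (real K) * of_real h = (of_real (1 / K) :: complex)"
      using Kh K0 by (simp add: field_simps)
    finally show ?thesis by (simp add: rot_facts)
  qed
  have sx: "of_real (sqrt x) = of_real (real K) * cnj rot * t"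
  proof -
    have "sqrt (h * x) = sqrt x / K" using K0 by (simp add: h_def real_sqrt_mult real_sqrt_divide)
    then have "of_real (real K) * cnj rot * t = (cnj rot * rot) * of_real (real K * (sqrt x / K))"
      by (simp add: t_def)
    then show ?thesis using K0 by (simp add: rot_facts)
  qed
  have "of_real x * (rot * of_real (1 / K) * P) - of_real (sqrt x)
      = of_real (real K) * cnj rot * ((A - S) + (S - t) - of_real (cbin N) * u ^ Suc N - of_real (h\<^sup>2) * P)"
    unfolding xf hP sx by (simp add: algebra_simps)
  then have "norm (of_real x * (rot * of_real (1 / K) * P) - of_real (sqrt x))
      = real K * norm ((A - S) + (S - t) - of_real (cbin N) * u ^ Suc N - of_real (h\<^sup>2) * P)"
    by (simp add: norm_mult rot_facts del: diff_add_cancel add_diff_cancel)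
  also have "\<dots> \<le> real K * (h + 2 * h + h + 2 * h)"
  proof (rule mult_left_mono)
    have "norm (A - S) \<le> h" using S(3)[of N] c by (simp add: A_def norm_minus_commute)
    then show "norm ((A - S) + (S - t) - of_real (cbin N) * u ^ Suc N - of_real (h\<^sup>2) * P)
        \<le> h + 2 * h + h + 2 * h"
      using St e1 e2 norm_triangle_ineq[of "A - S" "S - t"]
        norm_triangle_ineq4[of "(A - S) + (S - t)" "of_real (cbin N) * u ^ Suc N"]
        norm_triangle_ineq4[of "(A - S) + (S - t) - of_real (cbin N) * u ^ Suc N" "of_real (h\<^sup>2) * P"]
      by linarith
  qed (use K0 in simp)
  also have "\<dots> = 6 / K" using K0 by (simp add: h_def power2_eq_square)
  finally show ?thesis unfolding P_def u_def N_def .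
qed

text \<open>With k = 1/K, 1 - u^K is close to K (1 - u) and thus to i x k, so the target is t = (i x
  k)^(1/2) and the prefactor sqrt K. As \<open>cbin N\<close> is of order N^(-1/2), the length K^3
  leaves a truncation error sqrt K * K^(-3/2) = 1/K. The linearization error must satisfy |S - t|^2
  <= 9 k^3, which after the prefactor is 3/K.\<close>

lemma sqrt_approx:
  fixes K :: nat and x :: real
  assumes K: "K \<ge> 2" and x: "0 \<le> x" "x \<le> 1"
  defines "h \<equiv> 1 / (real K)\<^sup>2"
  shows "norm (cnj rot * of_real (sqrt K) * (\<Sum>m\<le>K ^ 3. of_real (sqc m) * (stepv h x ^ K) ^ m)
     - of_real (sqrt x)) \<le> 6 / K"
proof -
  define u where "u = stepv h x"
  define v where "v = u ^ K"
  define N where "N = K ^ 3"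
  define k where "k = 1 / real K"
  have K0: "real K > 0" using K by simp
  have k: "0 < k" "k \<le> 1" using K by (auto simp: k_def)
  have hk: "h = k\<^sup>2" by (simp add: h_def k_def power_divide)
  have "(1::real) < K\<^sup>2" using K by (simp add: one_less_power)
  then have h: "0 < h" "h < 1" using K0 by (auto simp: h_def divide_less_eq)
  have nu: "norm u < 1" unfolding u_def by (rule norm_stepv_less_1[OF h x])
  have nv: "norm v < 1" using nu K by (simp add: v_def norm_power power_less_one_iff)
  obtain S where S: "S\<^sup>2 = 1 - v" "Re S \<ge> 0"
    "\<And>N. norm (S - (\<Sum>n\<le>N. of_real (sqc n) * v ^ n)) \<le> cbin N"
    using sqrt_series[OF nv] by blast
  define t where "t = rot * of_real (sqrt (x * k))"
  have t2: "t\<^sup>2 = \<i> * of_real (x * k)"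
    using k x by (simp add: t_def power_mult_distrib rot_facts flip: of_real_power)
  have u1: "1 - u = of_real (h\<^sup>2) + \<i> * of_real (h * x)"
    by (simp add: u_def stepv_def complex_eq_iff)
  have Kk: "real K * k = 1" using K0 by (simp add: k_def)
  \<comment> \<open>K h x = x k is the main term, and K h^2 = k^3 is what the shift by h^2
    contributes.\<close>
  have "of_nat K * (1 - u) - t\<^sup>2 = of_real (k ^ 3)"
  proof -
    have "real K * h\<^sup>2 = k ^ 3" using Kk by (simp add: hk power2_eq_square power3_eq_cube)
    moreover have "real K * (h * x) = x * k" using Kk by (simp add: hk power2_eq_square)
    ultimately show ?thesis by (simp add: t2 u1 complex_eq_iff del: of_real_power of_real_mult)
  qed
  then have "S\<^sup>2 - t\<^sup>2 = (1 - u ^ K - of_nat K * (1 - u)) + of_real (k ^ 3)"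
    by (simp add: S(1) v_def algebra_simps)
  then have "norm (S\<^sup>2 - t\<^sup>2) \<le> norm (1 - u ^ K - of_nat K * (1 - u)) + norm (of_real (k ^ 3) :: complex)"
    by (metis norm_triangle_ineq)
  also have "norm (of_real (k ^ 3) :: complex) = k ^ 3" using k by (simp flip: of_real_power)
  also have "norm (1 - u ^ K - of_nat K * (1 - u)) \<le> (real K)\<^sup>2 / 2 * (norm (1 - u))\<^sup>2"
    by (rule one_minus_power_bounds(2)) (use nu in simp)
  also have "(norm (1 - u))\<^sup>2 = k ^ 8 + k ^ 4 * x\<^sup>2"
    by (simp add: u1 cmod_power2 hk power_mult_distrib flip: power_mult)
  also have "(real K)\<^sup>2 / 2 * (k ^ 8 + k ^ 4 * x\<^sup>2) = k ^ 6 / 2 + k\<^sup>2 * x\<^sup>2 / 2"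
  proof -
    have "(real K)\<^sup>2 * k\<^sup>2 = 1" using Kk by (simp flip: power_mult_distrib)
    moreover have "(real K)\<^sup>2 / 2 * (k ^ 8 + k ^ 4 * x\<^sup>2) = ((real K)\<^sup>2 * k\<^sup>2) * (k ^ 6 / 2 + k\<^sup>2 * x\<^sup>2 / 2)"
      by (simp add: algebra_simps flip: power_add)
    ultimately show ?thesis by simp
  qed
  finally have d0: "norm (S\<^sup>2 - t\<^sup>2) \<le> 3 / 2 * k ^ 3 + k\<^sup>2 * x\<^sup>2 / 2"
    using power_decreasing[of 3 6 k] k by simp
  have db: "(norm (S - t))\<^sup>2 \<le> sqrt 2 * norm (S\<^sup>2 - t\<^sup>2)" "norm (S - t) * norm t \<le> sqrt 2 * norm (S\<^sup>2 - t\<^sup>2)"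
  proof -
    have "Re v \<le> 1" using nv complex_Re_le_cmod[of v] by linarith
    then have a: "Re (S\<^sup>2) \<ge> 0" by (simp add: S(1))
    have b: "Re t \<ge> 0" using k x rot_facts(5) by (simp add: t_def)
    have c: "Re (t\<^sup>2) \<ge> 0" by (simp add: t2)
    show "(norm (S - t))\<^sup>2 \<le> sqrt 2 * norm (S\<^sup>2 - t\<^sup>2)" "norm (S - t) * norm t \<le> sqrt 2 * norm (S\<^sup>2 - t\<^sup>2)"
      using sqrt_diff_bounds[OF S(2) a b c] .
  qed
  (* The error of S^2 is a constant term of order k^3, handled by the Hoelder bound for the square root,
     plus a term of order k^2 x^2, handled by the Lipschitz bound away from 0. *)
  have s2: "sqrt 2 \<le> 3 / 2" by (rule real_le_lsqrt) (auto simp: power2_eq_square)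
  have St: "(norm (S - t))\<^sup>2 \<le> 9 * k ^ 3"
  proof (cases "k\<^sup>2 * x\<^sup>2 / 2 \<le> 3 / 2 * k ^ 3")
    case True
    then have "norm (S\<^sup>2 - t\<^sup>2) \<le> 3 * k ^ 3" using d0 by simp
    then have "sqrt 2 * norm (S\<^sup>2 - t\<^sup>2) \<le> 3 / 2 * (3 * k ^ 3)" using s2 by (intro mult_mono) auto
    moreover have "k ^ 3 \<ge> 0" using k by simp
    ultimately show ?thesis using db(1) by linarith
  next
    case False
    have x0: "x > 0"
    proof (rule ccontr)
      assume "\<not> x > 0"
      then show False using False k x by simp
    qed
    have "norm (S\<^sup>2 - t\<^sup>2) \<le> k\<^sup>2 * x\<^sup>2" using d0 False by simp
    then have "sqrt 2 * norm (S\<^sup>2 - t\<^sup>2) \<le> 3 / 2 * (k\<^sup>2 * x\<^sup>2)" using s2 by (intro mult_mono) auto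
    then have "norm (S - t) * norm t \<le> 3 / 2 * (k\<^sup>2 * x\<^sup>2)" using db(2) by linarith
    \<comment> \<open>Squaring exposes |t|^2 = x k, which cancels against one factor x k of k^4 x^4;
      the rest has order k^3 since x <= 1.\<close>
    then have "(norm (S - t) * norm t)\<^sup>2 \<le> (3 / 2 * (k\<^sup>2 * x\<^sup>2))\<^sup>2" by (intro power_mono) auto
    moreover have "(norm t)\<^sup>2 = x * k" using x k by (simp add: t_def norm_mult rot_facts)
    moreover have "(3 / 2 * (k\<^sup>2 * x\<^sup>2))\<^sup>2 = (9 / 4 * (x ^ 3 * k ^ 3)) * (x * k)"
      by (simp add: power2_eq_square power3_eq_cube)
    ultimately have "(norm (S - t))\<^sup>2 * (x * k) \<le> (9 / 4 * (x ^ 3 * k ^ 3)) * (x * k)"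
      by (simp only: power_mult_distrib)
    then have "(norm (S - t))\<^sup>2 \<le> 9 / 4 * (x ^ 3 * k ^ 3)"
      using x0 k by (simp add: mult_le_cancel_right)
    also have "\<dots> \<le> 9 / 4 * (1 * k ^ 3)"
      using x k by (intro mult_left_mono mult_right_mono power_le_one) auto
    also have "\<dots> \<le> 9 * k ^ 3" using k by simp
    finally show ?thesis .
  qed
  have "(sqrt K * norm (S - t))\<^sup>2 \<le> real K * (9 * k ^ 3)"
    using St by (simp add: power_mult_distrib mult_left_mono)
  also have "\<dots> = (3 * k)\<^sup>2" using Kk by (simp add: power2_eq_square power3_eq_cube)
  finally have e1: "sqrt K * norm (S - t) \<le> 3 * k" by (rule power2_le_imp_le) (use k in simp)
  have e2: "sqrt K * cbin N \<le> k"
  proof -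
    have "(sqrt K * cbin N)\<^sup>2 * (2 * real N + 1) \<le> real K"
      using cbin_sq_le[of N] K0 mult_left_mono[of "(cbin N)\<^sup>2 * (2 * real N + 1)" 1 "real K"]
      by (simp add: power_mult_distrib mult.assoc)
    also have "real K \<le> k\<^sup>2 * (2 * real N + 1)"
    proof -
      have "k\<^sup>2 * real N = real K" using K0 by (simp add: k_def N_def power_divide power2_eq_square power3_eq_cube)
      moreover have "k\<^sup>2 * (2 * real N + 1) = 2 * (k\<^sup>2 * real N) + k\<^sup>2" by (simp add: algebra_simps)
      ultimately show ?thesis using K0 zero_le_power2[of k] by linarith
    qed
    finally have "(sqrt K * cbin N)\<^sup>2 \<le> k\<^sup>2" by (simp add: mult_le_cancel_right)
    then show ?thesis by (rule power2_le_imp_le) (use k in simp)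
  qed
  define A where "A = (\<Sum>n\<le>N. of_real (sqc n) * v ^ n)"
  have sx: "of_real (sqrt x) = cnj rot * of_real (sqrt K) * t"
  proof -
    have "sqrt K * sqrt (x * k) = sqrt x"
      using Kk by (simp add: mult.commute mult.left_commute flip: real_sqrt_mult)
    moreover have "cnj rot * of_real (sqrt K) * t = (cnj rot * rot) * of_real (sqrt K * sqrt (x * k))"
      by (simp add: t_def)
    ultimately show ?thesis by (simp add: rot_facts)
  qed
  have "cnj rot * of_real (sqrt K) * A - of_real (sqrt x) = cnj rot * of_real (sqrt K) * ((A - S) + (S - t))"
    unfolding sx by (simp add: algebra_simps)
  then have "norm (cnj rot * of_real (sqrt K) * A - of_real (sqrt x)) = sqrt K * norm ((A - S) + (S - t))"
    by (simp only: norm_mult complex_mod_cnj rot_facts) simp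
  also have "\<dots> \<le> sqrt K * (cbin N + norm (S - t))"
    using S(3)[of N] by (intro mult_left_mono order_trans[OF norm_triangle_ineq] add_mono)
      (auto simp: A_def norm_minus_commute)
  also have "\<dots> \<le> k + 3 * k" using e1 e2 by (simp add: algebra_simps)
  also have "\<dots> \<le> 6 / K" using K0 by (simp add: k_def divide_right_mono)
  finally show ?thesis unfolding A_def v_def u_def N_def .
qed

section \<open>Adjoints, traces and the spectral theorem\<close>

lemma index_mult_mat_sum:
  assumes "A \<in> carrier_mat n k" "B \<in> carrier_mat k m" "i < n" "j < m"
  shows "(A * B) $$ (i, j) = (\<Sum>l<k. A $$ (i, l) * B $$ (l, j))"
  using assms by (auto simp: scalar_prod_def atLeast0LessThan intro!: sum.cong)

lemma mat_adjoint_dim [simp]: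
  "dim_row (mat_adjoint A) = dim_col A" "dim_col (mat_adjoint A) = dim_row A"
  by (auto simp: mat_adjoint_def mat_of_rows_def)

lemma mat_adjoint_index [simp]:
  fixes A :: "complex mat"
  assumes "i < dim_col A" "j < dim_row A"
  shows "mat_adjoint A $$ (i, j) = cnj (A $$ (j, i))"
  using assms by (auto simp: mat_adjoint_def mat_of_rows_def)

lemma mat_adjoint_carrier [simp, intro]:
  "A \<in> carrier_mat n m \<Longrightarrow> mat_adjoint A \<in> carrier_mat m n"
  by auto

lemma mat_adjoint_adjoint [simp]:
  fixes A :: "complex mat"
  shows "mat_adjoint (mat_adjoint A) = A"
  by (rule eq_matI) auto

lemma mat_adjoint_mult:
  fixes A :: "complex mat"
  assumes "A \<in> carrier_mat n k" "B \<in> carrier_mat k m"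
  shows "mat_adjoint (A * B) = mat_adjoint B * mat_adjoint A"
proof (rule eq_matI)
  fix i j assume "i < dim_row (mat_adjoint B * mat_adjoint A)" "j < dim_col (mat_adjoint B * mat_adjoint A)"
  then have ij: "i < m" "j < n" using assms by auto
  have "mat_adjoint (A * B) $$ (i, j) = cnj ((A * B) $$ (j, i))" using assms ij by simp
  also have "\<dots> = (\<Sum>l<k. cnj (A $$ (j, l)) * cnj (B $$ (l, i)))"
    using index_mult_mat_sum[OF assms ij(2,1)] by simp
  also have "\<dots> = (\<Sum>l<k. mat_adjoint B $$ (i, l) * mat_adjoint A $$ (l, j))"
    using assms ij by (intro sum.cong) auto
  also have "\<dots> = (mat_adjoint B * mat_adjoint A) $$ (i, j)"
    by (rule index_mult_mat_sum[symmetric]) (use assms ij in auto)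
  finally show "mat_adjoint (A * B) $$ (i, j) = (mat_adjoint B * mat_adjoint A) $$ (i, j)" .
qed (use assms in auto)

lemma mat_adjoint_add:
  fixes A :: "complex mat"
  assumes "A \<in> carrier_mat n m" "B \<in> carrier_mat n m"
  shows "mat_adjoint (A + B) = mat_adjoint A + mat_adjoint B"
  by (rule eq_matI) (use assms in auto)

lemma mat_adjoint_minus:
  fixes A :: "complex mat"
  assumes "A \<in> carrier_mat n m" "B \<in> carrier_mat n m"
  shows "mat_adjoint (A - B) = mat_adjoint A - mat_adjoint B"
  by (rule eq_matI) (use assms in auto)

lemma mat_adjoint_smult:
  fixes A :: "complex mat"
  shows "mat_adjoint (c \<cdot>\<^sub>m A) = cnj c \<cdot>\<^sub>m mat_adjoint A"
  by (rule eq_matI) auto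

lemma mat_adjoint_one [simp]: "mat_adjoint (1\<^sub>m n :: complex mat) = 1\<^sub>m n"
  by (rule eq_matI) auto

text \<open>This and the following rules replace membership in \<open>carrier_mat\<close> by
  equations between dimensions, so that the simplifier can rearrange long products without being
  given the intermediate dimensions.\<close>

lemma mult_assoc_dim:
  fixes A :: "complex mat"
  shows "dim_col A = dim_row B \<Longrightarrow> dim_col B = dim_row C \<Longrightarrow> (A * B) * C = A * (B * C)"
  by (rule assoc_mult_mat[of A "dim_row A" "dim_col A" B "dim_col B" C "dim_col C"]) auto

lemma mult_one_dim:
  fixes A :: "complex mat"
  shows "dim_row A = n \<Longrightarrow> 1\<^sub>m n * A = A" "dim_col A = n \<Longrightarrow> A * 1\<^sub>m n = A"
  by auto

lemma adjoint_mult_dim: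
  fixes A :: "complex mat"
  shows "dim_col A = dim_row B \<Longrightarrow> mat_adjoint (A * B) = mat_adjoint B * mat_adjoint A"
  by (rule mat_adjoint_mult[of A "dim_row A" "dim_col A" B "dim_col B"]) auto

lemma add_mult_dim:
  fixes A :: "complex mat"
  shows "dim_row A = dim_row B \<Longrightarrow> dim_col A = dim_col B \<Longrightarrow> dim_col B = dim_row C \<Longrightarrow>
    (A + B) * C = A * C + B * C"
  by (rule add_mult_distrib_mat[of A "dim_row A" "dim_col A" B C "dim_col C"]) auto

lemma mult_add_dim:
  fixes A :: "complex mat"
  shows "dim_col A = dim_row B \<Longrightarrow> dim_row B = dim_row C \<Longrightarrow> dim_col B = dim_col C \<Longrightarrow>
    A * (B + C) = A * B + A * C"
  by (rule mult_add_distrib_mat[of A "dim_row A" "dim_col A" B "dim_col B" C]) auto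

lemma smult_mult_dim:
  fixes A :: "complex mat"
  shows "dim_col A = dim_row B \<Longrightarrow> (c \<cdot>\<^sub>m A) * B = c \<cdot>\<^sub>m (A * B)"
  by (rule mult_smult_assoc_mat[of A "dim_row A" "dim_col A" B "dim_col B"]) auto

lemma mult_smult_dim:
  fixes A :: "complex mat"
  shows "dim_col A = dim_row B \<Longrightarrow> A * (c \<cdot>\<^sub>m B) = c \<cdot>\<^sub>m (A * B)"
  by (rule mult_smult_distrib[of A "dim_row A" "dim_col A" B "dim_col B"]) auto

lemma smult_smult_mat:
  fixes A :: "complex mat"
  shows "c \<cdot>\<^sub>m (d \<cdot>\<^sub>m A) = (c * d) \<cdot>\<^sub>m A"
  by (rule eq_matI) auto

text \<open>Removes an inverse pair from the inside of a product that \<open>mult_assoc_dim\<close>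
  has bracketed to the right.\<close>

lemma mult_cancel_left_dim:
  fixes A :: "complex mat"
  assumes "A * B = 1\<^sub>m n" "dim_col A = dim_row B" "dim_row A = n" "dim_col B = n" "dim_row C = n"
  shows "A * (B * C) = C"
  using assms by (simp flip: mult_assoc_dim add: mult_one_dim)

lemma cscalar_prod_sum:
  fixes v w :: "complex vec"
  assumes "w \<in> carrier_vec n"
  shows "v \<bullet>c w = (\<Sum>i<n. v $ i * cnj (w $ i))"
  using assms by (auto simp: scalar_prod_def atLeast0LessThan intro!: sum.cong)

lemma cscalar_prod_self:
  fixes v :: "complex vec"
  assumes "v \<in> carrier_vec n"
  shows "v \<bullet>c v = of_real (\<Sum>i<n. (norm (v $ i))\<^sup>2)"
  using assms by (simp add: cscalar_prod_sum[OF assms] complex_mult_cnj cmod_power2)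

lemma mult_mat_vec_sum:
  assumes "A \<in> carrier_mat n m" "v \<in> carrier_vec m" "i < n"
  shows "(A *\<^sub>v v) $ i = (\<Sum>j<m. A $$ (i, j) * v $ j)"
  using assms by (auto simp: scalar_prod_def atLeast0LessThan intro!: sum.cong)

lemma cscalar_prod_adjoint:
  fixes A :: "complex mat"
  assumes A: "A \<in> carrier_mat n m" and v: "v \<in> carrier_vec m" and w: "w \<in> carrier_vec n"
  shows "(A *\<^sub>v v) \<bullet>c w = v \<bullet>c (mat_adjoint A *\<^sub>v w)"
proof -
  have "(A *\<^sub>v v) \<bullet>c w = (\<Sum>i<n. \<Sum>j<m. A $$ (i, j) * v $ j * cnj (w $ i))"
    unfolding cscalar_prod_sum[OF w]
    by (rule sum.cong[OF refl], subst mult_mat_vec_sum[OF A v]) (auto simp: sum_distrib_right)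
  also have "\<dots> = (\<Sum>j<m. \<Sum>i<n. A $$ (i, j) * v $ j * cnj (w $ i))" by (rule sum.swap)
  also have "\<dots> = v \<bullet>c (mat_adjoint A *\<^sub>v w)"
  proof -
    have Aw: "mat_adjoint A *\<^sub>v w \<in> carrier_vec m"
      by (rule mult_mat_vec_carrier[OF mat_adjoint_carrier[OF A] w])
    show ?thesis unfolding cscalar_prod_sum[OF Aw]
    proof (rule sum.cong[OF refl])
      fix j assume "j \<in> {..<m}"
      then have "(mat_adjoint A *\<^sub>v w) $ j = (\<Sum>i<n. cnj (A $$ (i, j)) * w $ i)"
        using A by (subst mult_mat_vec_sum[OF mat_adjoint_carrier[OF A] w]) (auto intro!: sum.cong)
      then show "(\<Sum>i<n. A $$ (i, j) * v $ j * cnj (w $ i)) = v $ j * cnj ((mat_adjoint A *\<^sub>v w) $ j)"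
        by (simp add: sum_distrib_left mult_ac)
    qed
  qed
  finally show ?thesis .
qed

lemma mtrace_mult_sum:
  assumes "A \<in> carrier_mat n m" "B \<in> carrier_mat m n"
  shows "mtrace (A * B) = (\<Sum>i<n. \<Sum>j<m. A $$ (i, j) * B $$ (j, i))"
proof -
  have "dim_row (A * B) = n" using assms by simp
  then show ?thesis unfolding mtrace_def
    by (simp only:) (rule sum.cong[OF refl], rule index_mult_mat_sum[OF assms], auto)
qed

lemma mtrace_mult_comm:
  assumes "A \<in> carrier_mat n m" "B \<in> carrier_mat m n"
  shows "mtrace (A * B) = mtrace (B * A)"
  unfolding mtrace_mult_sum[OF assms] mtrace_mult_sum[OF assms(2,1)]
  by (subst sum.swap) (simp add: mult.commute)

lemma mtrace_add:
  assumes "A \<in> carrier_mat n n" "B \<in> carrier_mat n n"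
  shows "mtrace (A + B) = mtrace A + mtrace B"
  using assms by (simp add: mtrace_def sum.distrib)

lemma mtrace_minus:
  assumes "A \<in> carrier_mat n n" "B \<in> carrier_mat n n"
  shows "mtrace (A - B) = mtrace A - mtrace B"
  using assms by (simp add: mtrace_def sum_subtractf)

lemma mtrace_smult:
  assumes "A \<in> carrier_mat n n"
  shows "mtrace (c \<cdot>\<^sub>m A) = c * mtrace A"
  using assms by (simp add: mtrace_def sum_distrib_left)

lemma mtrace_adjoint:
  assumes "A \<in> carrier_mat n n"
  shows "mtrace (mat_adjoint A) = cnj (mtrace A)"
  using assms by (simp add: mtrace_def)

section \<open>Diagonal and unitary matrices, diagonalization\<close>

definition diagm :: "nat \<Rightarrow> (nat \<Rightarrow> complex) \<Rightarrow> complex mat" where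
  "diagm n F = mat n n (\<lambda>(i, j). if i = j then F i else 0)"

lemma diagm_carrier [simp, intro]: "diagm n F \<in> carrier_mat n n"
  and diagm_index [simp]: "i < n \<Longrightarrow> j < n \<Longrightarrow> diagm n F $$ (i, j) = (if i = j then F i else 0)"
  and diagm_dim [simp]: "dim_row (diagm n F) = n" "dim_col (diagm n F) = n"
  by (auto simp: diagm_def)

lemma mult_diagm_index:
  assumes "A \<in> carrier_mat k n" "i < k" "j < n"
  shows "(A * diagm n F) $$ (i, j) = A $$ (i, j) * F j"
proof -
  have "(A * diagm n F) $$ (i, j) = (\<Sum>l<n. A $$ (i, l) * (if l = j then F l else 0))"
    using assms by (subst index_mult_mat_sum[OF assms(1) diagm_carrier]) (auto intro!: sum.cong)
  also have "\<dots> = (\<Sum>l<n. if l = j then A $$ (i, l) * F l else 0)" by (intro sum.cong) auto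
  finally show ?thesis using assms(3) by (simp add: sum.delta)
qed

definition unitary :: "nat \<Rightarrow> complex mat \<Rightarrow> bool" where
  "unitary n U \<longleftrightarrow> U \<in> carrier_mat n n \<and> mat_adjoint U * U = 1\<^sub>m n"

lemma unitaryD:
  assumes "unitary n U"
  shows "U \<in> carrier_mat n n" "mat_adjoint U * U = 1\<^sub>m n" "U * mat_adjoint U = 1\<^sub>m n"
proof -
  show U: "U \<in> carrier_mat n n" and a: "mat_adjoint U * U = 1\<^sub>m n"
    using assms by (auto simp: unitary_def)
  show "U * mat_adjoint U = 1\<^sub>m n"
    by (rule mat_mult_left_right_inverse[OF mat_adjoint_carrier[OF U] U a])
qed

lemma unitary_dim:
  assumes "unitary n U"
  shows "dim_row U = n" "dim_col U = n"
  using unitaryD(1)[OF assms] by auto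

lemma unitary_mult:
  assumes "unitary n U" "unitary n V"
  shows "unitary n (U * V)"
  unfolding unitary_def
  using unitary_dim[OF assms(1)] unitary_dim[OF assms(2)] unitaryD(2)[OF assms(2)]
  by (auto simp: adjoint_mult_dim mult_assoc_dim mult_cancel_left_dim[OF unitaryD(2)[OF assms(1)]])

text \<open>Completes \<open>v\<close> to a basis and applies Gram-Schmidt, which keeps the first
  vector; the orthogonal vectors are then divided by their lengths \<open>r j\<close>. This provides
  the deflation step of the spectral theorem.\<close>

lemma exists_unitary_first_col:
  fixes v :: "complex vec"
  assumes v: "v \<in> carrier_vec n" and v0: "v \<noteq> 0\<^sub>v n"
  obtains U c where "unitary n U" "col U 0 = c \<cdot>\<^sub>v v"
proof -
  interpret cof_vec_space n "TYPE(complex)" .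
  have n: "n \<noteq> 0" using v v0 by (metis carrier_vecD vec_of_dim_0)
  define b where "b = basis_completion v"
  from basis_completion[OF v v0, folded b_def]
  have b: "distinct b" "\<not> lin_dep (set b)" "set b \<subseteq> carrier_vec n" "hd b = v" "length b = n" by auto
  define ws where "ws = gram_schmidt n b"
  from gram_schmidt_result[OF b(3,1,2) refl, folded ws_def]
  have ws: "set ws \<subseteq> carrier_vec n" "corthogonal ws" "length ws = n" by (auto simp: b)
  obtain vs where "b = v # vs" using b n by (cases b) auto
  then have hd: "hd ws = v" using gram_schmidt_hd[OF v, of vs] by (simp add: ws_def)
  have w0: "ws ! 0 = v" using hd ws n by (cases ws) auto
  have wc: "ws ! j \<in> carrier_vec n" if "j < n" for j using ws that by auto
  define r where "r j = sqrt (\<Sum>i<n. (norm (ws ! j $ i))\<^sup>2)" for j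
  have r2: "ws ! j \<bullet>c ws ! j = of_real ((r j)\<^sup>2)" if "j < n" for j
    by (simp add: cscalar_prod_self[OF wc[OF that]] r_def sum_nonneg)
  have r0: "r j \<noteq> 0" if "j < n" for j
    using corthogonalD[OF ws(2), of j j] r2[OF that] that ws by auto
  define U where "U = mat n n (\<lambda>(i, j). ws ! j $ i / of_real (r j))"
  have U: "U \<in> carrier_mat n n" by (simp add: U_def)
  have "mat_adjoint U * U = 1\<^sub>m n"
  proof (rule eq_matI)
    fix i j assume "i < dim_row (1\<^sub>m n :: complex mat)" "j < dim_col (1\<^sub>m n :: complex mat)"
    then have ij: "i < n" "j < n" by auto
    have "(mat_adjoint U * U) $$ (i, j) = (\<Sum>l<n. cnj (ws ! i $ l / of_real (r i)) * (ws ! j $ l / of_real (r j)))"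
      using ij U by (subst index_mult_mat_sum[OF mat_adjoint_carrier[OF U] U ij]) (auto simp: U_def intro!: sum.cong)
    also have "\<dots> = (ws ! j \<bullet>c ws ! i) / (of_real (r i) * of_real (r j))"
      by (simp add: cscalar_prod_sum[OF wc[OF ij(1)]] sum_divide_distrib mult_ac)
    also have "\<dots> = (1\<^sub>m n :: complex mat) $$ (i, j)"
      using corthogonalD[OF ws(2), of j i] ij ws r2[OF ij(1)] r0[OF ij(1)]
      by (cases "i = j") (auto simp: power2_eq_square)
    finally show "(mat_adjoint U * U) $$ (i, j) = (1\<^sub>m n :: complex mat) $$ (i, j)" .
  qed (use U in auto)
  then have "unitary n U" using U by (simp add: unitary_def)
  moreover have "col U 0 = (1 / of_real (r 0)) \<cdot>\<^sub>v v"
    by (rule eq_vecI) (use n v w0 in \<open>auto simp: U_def\<close>)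
  ultimately show ?thesis using that by blast
qed

lemma hermitian_index:
  assumes "hermitian A" "A \<in> carrier_mat n n" "i < n" "j < n"
  shows "A $$ (i, j) = cnj (A $$ (j, i))"
  using assms mat_adjoint_index[of i A j] by (simp add: hermitian_def)

text \<open>Induction by deflation. Conjugation by a unitary whose first column is an eigenvector
  clears the first column off the diagonal; hermiticity then clears the first row, and the induction
  hypothesis diagonalizes the remaining block.\<close>

lemma spectral_eigenbasis:
  assumes "A \<in> carrier_mat n n" "hermitian A"
  shows "\<exists>U D. unitary n U \<and> A * U = U * diagm n (\<lambda>i. of_real (D i))"
  using assms
proof (induction n arbitrary: A)
  case 0
  then show ?case
    by (intro exI[of _ "1\<^sub>m 0"] exI[of _ "\<lambda>_. 0"]) (auto simp: unitary_def)
next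
  case (Suc n A)
  note A = Suc.prems(1)
  obtain e where "e \<in> spectrum A" using spectrum_non_empty[OF A] by auto
  then obtain v where v: "v \<in> carrier_vec (Suc n)" "v \<noteq> 0\<^sub>v (Suc n)" "A *\<^sub>v v = e \<cdot>\<^sub>v v"
    using A by (auto simp: spectrum_def eigenvalue_def eigenvector_def)
  obtain W c where W: "unitary (Suc n) W" "col W 0 = c \<cdot>\<^sub>v v"
    using exists_unitary_first_col[OF v(1,2)] by blast
  note Wd = unitaryD[OF W(1)]
  define B where "B = mat_adjoint W * A * W"
  have dA: "dim_row A = Suc n" "dim_col A = Suc n" using A by auto
  note dW = unitary_dim[OF W(1)]
  have B: "B \<in> carrier_mat (Suc n) (Suc n)" by (rule carrier_matI) (auto simp: B_def dW)
  have hB: "hermitian B"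
    using Suc.prems(2) by (simp add: hermitian_def B_def adjoint_mult_dim mult_assoc_dim dW dA)
  have AW: "A * W = W * B"
    by (simp add: B_def mult_assoc_dim dW dA mult_cancel_left_dim[OF Wd(3)])
  have B0: "B $$ (i, 0) = (if i = 0 then e else 0)" if "i < Suc n" for i
  proof -
    have "A *\<^sub>v col W 0 = e \<cdot>\<^sub>v col W 0"
      using A v by (simp add: W(2) mult_mat_vec smult_smult_assoc mult.commute)
    then have "col (A * W) 0 = e \<cdot>\<^sub>v col W 0" using col_mult2[OF A Wd(1) zero_less_Suc] by (rule trans[rotated])
    then have *: "(A * W) $$ (l, 0) = e * W $$ (l, 0)" if "l < Suc n" for l
    proof -
      have "(A * W) $$ (l, 0) = col (A * W) 0 $ l" using that A Wd(1) by simp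
      also have "\<dots> = (e \<cdot>\<^sub>v col W 0) $ l" by (simp only: \<open>col (A * W) 0 = e \<cdot>\<^sub>v col W 0\<close>)
      also have "\<dots> = e * W $$ (l, 0)" using that Wd(1) by simp
      finally show ?thesis .
    qed
    have "B $$ (i, 0) = (\<Sum>l<Suc n. mat_adjoint W $$ (i, l) * (A * W) $$ (l, 0))"
      using that A Wd
      by (subst index_mult_mat_sum[of _ "Suc n" "Suc n" _ "Suc n", symmetric])
         (auto simp: B_def mult_assoc_dim dW dA)
    also have "\<dots> = e * (\<Sum>l<Suc n. mat_adjoint W $$ (i, l) * W $$ (l, 0))"
      by (simp add: sum_distrib_left * mult_ac del: sum.lessThan_Suc)
    also have "(\<Sum>l<Suc n. mat_adjoint W $$ (i, l) * W $$ (l, 0)) = (mat_adjoint W * W) $$ (i, 0)"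
      using that Wd by (subst index_mult_mat_sum[of _ "Suc n" "Suc n" _ "Suc n"]) auto
    finally show ?thesis using that Wd(2) by simp
  qed
  define B3 where "B3 = mat n n (\<lambda>(i, j). B $$ (Suc i, Suc j))"
  have B3: "B3 \<in> carrier_mat n n" by (simp add: B3_def)
  have "hermitian B3" unfolding hermitian_def
  proof (rule eq_matI)
    fix i j assume "i < dim_row B3" "j < dim_col B3"
    then show "mat_adjoint B3 $$ (i, j) = B3 $$ (i, j)"
      using hermitian_index[OF hB B, of "Suc i" "Suc j"] by (simp add: B3_def)
  qed (auto simp: B3_def)
  from Suc.IH[OF B3 this] obtain V D where V: "unitary n V"
    and VD: "B3 * V = V * diagm n (\<lambda>i. of_real (D i))" by blast
  note Vd = unitaryD[OF V]
  \<comment> \<open>The eigenvalue is a diagonal entry of the hermitian \<open>B\<close>, hence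
    real.\<close>
  obtain er where eR: "e = of_real er"
  proof -
    have "e = cnj e" using hermitian_index[OF hB B, of 0 0] B0[of 0] by simp
    then have "e = of_real (Re e)" by (simp add: complex_eq_iff)
    with that show thesis by blast
  qed
  let ?e = "mat 1 1 (\<lambda>_. e) :: complex mat"
  let ?Z1 = "0\<^sub>m 1 n :: complex mat" and ?Z2 = "0\<^sub>m n 1 :: complex mat"
  define Vb where "Vb = four_block_mat (1\<^sub>m 1) ?Z1 ?Z2 V"
  define D' where "D' i = (if i = 0 then er else D (i - 1))" for i
  have Bb: "B = four_block_mat ?e ?Z1 ?Z2 B3"
  proof (rule eq_matI)
    fix i j assume "i < dim_row (four_block_mat ?e ?Z1 ?Z2 B3)" "j < dim_col (four_block_mat ?e ?Z1 ?Z2 B3)"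
    then have ij: "i < Suc n" "j < Suc n" using B3 by auto
    have "B $$ (0, j) = (if j = 0 then e else 0)"
      using B0[OF ij(2)] hermitian_index[OF hB B, of 0 j] ij eR by auto
    then show "B $$ (i, j) = four_block_mat ?e ?Z1 ?Z2 B3 $$ (i, j)"
      using ij B0[OF ij(1)] B3 by (auto simp: B3_def)
  qed (use B B3 in auto)
  have Db: "diagm (Suc n) (\<lambda>i. of_real (D' i)) = four_block_mat ?e ?Z1 ?Z2 (diagm n (\<lambda>i. of_real (D i)))"
    by (rule eq_matI) (use eR in \<open>auto simp: D'_def\<close>)
  have Vbc: "Vb \<in> carrier_mat (Suc n) (Suc n)"
    using Vd unfolding Vb_def by auto
  have BV: "B * Vb = Vb * diagm (Suc n) (\<lambda>i. of_real (D' i))"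
    unfolding Bb Vb_def Db
    using mult_four_block_mat[of ?e 1 1 ?Z1 n ?Z2 n B3 "1\<^sub>m 1" 1 ?Z1 n ?Z2 V]
      mult_four_block_mat[of "1\<^sub>m 1" 1 1 ?Z1 n ?Z2 n V ?e 1 ?Z1 n ?Z2 "diagm n (\<lambda>i. of_real (D i))"]
      B3 Vd VD by simp
  have adVb: "mat_adjoint Vb = four_block_mat (1\<^sub>m 1) ?Z1 ?Z2 (mat_adjoint V)"
    by (rule eq_matI) (use Vd in \<open>auto simp: Vb_def\<close>)
  have "mat_adjoint Vb * Vb = 1\<^sub>m (Suc n)"
    unfolding adVb unfolding Vb_def
    using mult_four_block_mat[of "1\<^sub>m 1" 1 1 ?Z1 n ?Z2 n "mat_adjoint V" "1\<^sub>m 1" 1 ?Z1 n ?Z2 V] Vd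
    by simp
  then have Vbu: "unitary (Suc n) Vb" using Vbc by (simp add: unitary_def)
  have "A * (W * Vb) = (W * Vb) * diagm (Suc n) (\<lambda>i. of_real (D' i))"
  proof -
    have dV: "dim_row Vb = Suc n" "dim_col Vb = Suc n" "dim_row B = Suc n" "dim_col B = Suc n"
      using Vbc B by auto
    have "A * (W * Vb) = (A * W) * Vb" by (simp add: mult_assoc_dim dA dW dV)
    also have "\<dots> = W * (B * Vb)" by (simp add: AW mult_assoc_dim dW dV)
    finally show ?thesis by (simp add: BV mult_assoc_dim dW dV)
  qed
  with unitary_mult[OF W(1) Vbu] show ?case by blast
qed

section \<open>Functional calculus, square roots and the Hellinger distance\<close>

declare index_mult_mat(1) [simp del]

lemma diagm_mult: "diagm n F * diagm n G = diagm n (\<lambda>i. F i * G i)"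
  by (rule eq_matI) (auto simp: mult_diagm_index[of _ n n])

lemma diagm_adjoint: "mat_adjoint (diagm n F) = diagm n (\<lambda>i. cnj (F i))"
  by (rule eq_matI) auto

lemma diagm_one: "diagm n (\<lambda>_. 1) = 1\<^sub>m n"
  by (rule eq_matI) auto

lemma diagm_mult_index:
  assumes "A \<in> carrier_mat n k" "i < n" "j < k"
  shows "(diagm n F * A) $$ (i, j) = F i * A $$ (i, j)"
proof -
  have "(diagm n F * A) $$ (i, j) = (\<Sum>l<n. (if i = l then F i else 0) * A $$ (l, j))"
    using assms by (subst index_mult_mat_sum[OF diagm_carrier assms(1)]) (auto intro!: sum.cong)
  also have "\<dots> = (\<Sum>l<n. if i = l then F l * A $$ (l, j) else 0)" by (intro sum.cong) auto
  finally show ?thesis using assms(2) by (simp add: sum.delta)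
qed

text \<open>Functional calculus in a fixed eigenbasis. The values are indexed by eigenvectors, not
  by eigenvalues, so that products, sums and powers are computed pointwise without any question of
  well-definedness.\<close>

definition fcalc :: "complex mat \<Rightarrow> (nat \<Rightarrow> complex) \<Rightarrow> complex mat" where
  "fcalc U F = U * diagm (dim_row U) F * mat_adjoint U"

lemma fcalc_dim [simp]: "dim_row (fcalc U F) = dim_row U" "dim_col (fcalc U F) = dim_row U"
  by (auto simp: fcalc_def)

lemma fcalc_carrier [simp, intro]: "unitary n U \<Longrightarrow> fcalc U F \<in> carrier_mat n n"
  by (rule carrier_matI) (simp_all add: unitary_dim)

lemma fcalc_mult:
  assumes "unitary n U"
  shows "fcalc U F * fcalc U G = fcalc U (\<lambda>i. F i * G i)"
proof -
  have "fcalc U F * fcalc U G = U * (diagm n F * diagm n G) * mat_adjoint U"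
    by (simp add: fcalc_def unitary_dim[OF assms] mult_assoc_dim mult_cancel_left_dim[OF unitaryD(2)[OF assms]])
  then show ?thesis by (simp add: fcalc_def diagm_mult unitary_dim[OF assms])
qed

lemma fcalc_index:
  assumes "unitary n U" "i < n" "j < n"
  shows "fcalc U F $$ (i, j) = (\<Sum>k<n. U $$ (i, k) * F k * cnj (U $$ (j, k)))"
proof -
  note U = unitaryD(1)[OF assms(1)]
  have c: "U * diagm n F \<in> carrier_mat n n" using mult_carrier_mat[OF U diagm_carrier] .
  have "fcalc U F $$ (i, j) = (\<Sum>k<n. (U * diagm n F) $$ (i, k) * mat_adjoint U $$ (k, j))"
    unfolding fcalc_def unitary_dim[OF assms(1)]
    by (rule index_mult_mat_sum[OF c mat_adjoint_carrier[OF U] assms(2,3)])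
  also have "\<dots> = (\<Sum>k<n. U $$ (i, k) * F k * cnj (U $$ (j, k)))"
    using assms(2,3) unitary_dim[OF assms(1)] by (intro sum.cong) (auto simp: mult_diagm_index[OF U])
  finally show ?thesis .
qed

lemma fcalc_add:
  assumes "unitary n U"
  shows "fcalc U F + fcalc U G = fcalc U (\<lambda>i. F i + G i)"
  by (rule eq_matI)
     (auto simp: fcalc_index[OF assms] unitary_dim[OF assms] sum.distrib algebra_simps)

lemma fcalc_smult:
  assumes "unitary n U"
  shows "c \<cdot>\<^sub>m fcalc U F = fcalc U (\<lambda>i. c * F i)"
  by (rule eq_matI)
     (auto simp: fcalc_index[OF assms] unitary_dim[OF assms] sum_distrib_left mult_ac)

lemma fcalc_one:
  assumes "unitary n U"
  shows "1\<^sub>m n = fcalc U (\<lambda>_. 1)"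
  by (simp add: fcalc_def diagm_one unitary_dim[OF assms] mult_one_dim unitaryD(3)[OF assms])

lemma fcalc_cong:
  assumes "\<And>i. i < dim_row U \<Longrightarrow> F i = G i"
  shows "fcalc U F = fcalc U G"
proof -
  have "diagm (dim_row U) F = diagm (dim_row U) G" by (rule eq_matI) (auto simp: assms)
  then show ?thesis by (simp add: fcalc_def)
qed

text \<open>The squared modulus of the inner product of the i-th column of \<open>U\<close> with the
  j-th column of \<open>V\<close>. For two eigenbases these transition weights are all that a trace
  of a product sees of the noncommutativity.\<close>

definition overlap :: "complex mat \<Rightarrow> complex mat \<Rightarrow> nat \<Rightarrow> nat \<Rightarrow> real" where
  "overlap U V i j = (norm ((mat_adjoint U * V) $$ (i, j)))\<^sup>2"

lemma overlap_nonneg: "overlap U V i j \<ge> 0"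
  by (simp add: overlap_def)

lemma unitary_adjoint:
  assumes "unitary n U"
  shows "unitary n (mat_adjoint U)"
  unfolding unitary_def mat_adjoint_adjoint
  by (intro conjI mat_adjoint_carrier unitaryD[OF assms])

lemma unitary_col_norm:
  assumes "unitary n W" "j < n"
  shows "(\<Sum>i<n. (norm (W $$ (i, j)))\<^sup>2) = 1"
proof -
  note W = unitaryD(1)[OF assms(1)]
  have "(mat_adjoint W * W) $$ (j, j) = (\<Sum>i<n. mat_adjoint W $$ (j, i) * W $$ (i, j))"
    by (rule index_mult_mat_sum[OF mat_adjoint_carrier[OF W] W assms(2,2)])
  also have "\<dots> = (\<Sum>i<n. of_real ((norm (W $$ (i, j)))\<^sup>2))"
    using assms(2) unitary_dim[OF assms(1)]
    by (intro sum.cong) (auto simp: complex_norm_square mult.commute simp del: of_real_power)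
  finally have "of_real (\<Sum>i<n. (norm (W $$ (i, j)))\<^sup>2) = (1 :: complex)"
    using assms by (simp add: unitaryD(2))
  then show ?thesis using of_real_eq_1_iff by blast
qed

text \<open>\<open>mat_adjoint U * V\<close> is unitary, so its columns have norm 1, and its rows
  too, being conjugated columns of the adjoint. The overlaps form a doubly stochastic
  matrix.\<close>

lemma overlap_sum:
  assumes "unitary n U" "unitary n V"
  shows "j < n \<Longrightarrow> (\<Sum>i<n. overlap U V i j) = 1" "i < n \<Longrightarrow> (\<Sum>j<n. overlap U V i j) = 1"
proof -
  have W: "unitary n (mat_adjoint U * V)" by (intro unitary_mult unitary_adjoint assms)
  show "j < n \<Longrightarrow> (\<Sum>i<n. overlap U V i j) = 1"
    unfolding overlap_def by (rule unitary_col_norm[OF W])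
  assume i: "i < n"
  have "(\<Sum>j<n. overlap U V i j) = (\<Sum>j<n. (norm (mat_adjoint (mat_adjoint U * V) $$ (j, i)))\<^sup>2)"
    unfolding overlap_def using unitary_dim[OF W] i by (intro sum.cong) (auto simp del: index_mult_mat)
  also have "\<dots> = 1" by (rule unitary_col_norm[OF unitary_adjoint[OF W] i])
  finally show "(\<Sum>j<n. overlap U V i j) = 1" .
qed

text \<open>Cyclicity of the trace collects both bases in W = U^* V, leaving the trace of diag(F) W
  diag(G) W^*. From here on the problem about two states is one about double sums of
  scalars.\<close>

lemma mtrace_fcalc_mult:
  assumes "unitary n U" "unitary n V"
  shows "mtrace (fcalc U F * fcalc V G) = (\<Sum>i<n. \<Sum>j<n. F i * G j * of_real (overlap U V i j))"
proof -
  define W where "W = mat_adjoint U * V"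
  have W: "unitary n W" unfolding W_def by (intro unitary_mult unitary_adjoint assms)
  note d = unitary_dim[OF assms(1)] unitary_dim[OF assms(2)] unitary_dim[OF W]
  have c: "diagm n F * W \<in> carrier_mat n n" "diagm n G * mat_adjoint W \<in> carrier_mat n n"
    by (rule carrier_matI; simp add: d)+
  have "mtrace (fcalc U F * fcalc V G) = mtrace (U * (diagm n F * W * diagm n G * mat_adjoint V))"
    by (simp add: fcalc_def W_def mult_assoc_dim d)
  also have "\<dots> = mtrace ((diagm n F * W * diagm n G * mat_adjoint V) * U)"
    by (rule mtrace_mult_comm[of _ n n]) (rule carrier_matI; simp add: d)+
  also have "\<dots> = mtrace ((diagm n F * W) * (diagm n G * mat_adjoint W))"
    by (simp add: W_def mult_assoc_dim adjoint_mult_dim d)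
  also have "\<dots> = (\<Sum>i<n. \<Sum>j<n. (diagm n F * W) $$ (i, j) * (diagm n G * mat_adjoint W) $$ (j, i))"
    by (rule mtrace_mult_sum[OF c])
  also have "\<dots> = (\<Sum>i<n. \<Sum>j<n. F i * G j * of_real (overlap U V i j))"
  proof (intro sum.cong refl)
    fix i j assume "i \<in> {..<n}" "j \<in> {..<n}"
    then show "(diagm n F * W) $$ (i, j) * (diagm n G * mat_adjoint W) $$ (j, i)
      = F i * G j * of_real (overlap U V i j)"
      using d unitaryD(1)[OF W]
      by (simp add: diagm_mult_index[of _ n n] overlap_def complex_norm_square del: of_real_power flip: W_def)
  qed
  finally show ?thesis .
qed

lemma mtrace_fcalc:
  assumes "unitary n U"
  shows "mtrace (fcalc U F) = (\<Sum>i<n. F i)"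
proof -
  have "mtrace (fcalc U F) = mtrace (U * (diagm n F * mat_adjoint U))"
    by (simp add: fcalc_def mult_assoc_dim unitary_dim[OF assms])
  also have "\<dots> = mtrace ((diagm n F * mat_adjoint U) * U)"
    by (rule mtrace_mult_comm[of _ n n]) (rule carrier_matI; simp add: unitary_dim[OF assms])+
  also have "(diagm n F * mat_adjoint U) * U = diagm n F"
    by (simp add: mult_assoc_dim unitary_dim[OF assms] unitaryD(2)[OF assms] mult_one_dim)
  finally show ?thesis by (simp add: mtrace_def)
qed

section \<open>Positive semidefinite matrices and their square roots\<close>

lemma psd_conj:
  assumes "psd n A" and X: "X \<in> carrier_mat n m"
  shows "psd m (mat_adjoint X * A * X)"
proof -
  have A: "A \<in> carrier_mat n n" "mat_adjoint A = A"
    and q: "\<And>v. v \<in> carrier_vec n \<Longrightarrow> 0 \<le> Re ((A *\<^sub>v v) \<bullet>c v)"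
    using assms by (auto simp: psd_def hermitian_def)
  have d: "dim_row X = n" "dim_col X = m" "dim_row A = n" "dim_col A = n" using X A by auto
  have c: "mat_adjoint X * A \<in> carrier_mat m n" "mat_adjoint X * A * X \<in> carrier_mat m m"
    by (rule carrier_matI; simp add: d)+
  show ?thesis unfolding psd_def hermitian_def
  proof (intro conjI ballI c)
    show "mat_adjoint (mat_adjoint X * A * X) = mat_adjoint X * A * X"
      by (simp add: adjoint_mult_dim mult_assoc_dim d A)
    fix v :: "complex vec" assume v: "v \<in> carrier_vec m"
    have Xv: "X *\<^sub>v v \<in> carrier_vec n" by (rule mult_mat_vec_carrier[OF X v])
    have AXv: "A *\<^sub>v (X *\<^sub>v v) \<in> carrier_vec n" by (rule mult_mat_vec_carrier[OF A(1) Xv])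
    have "(mat_adjoint X * A * X) *\<^sub>v v = mat_adjoint X *\<^sub>v (A *\<^sub>v (X *\<^sub>v v))"
      by (simp add: assoc_mult_mat_vec[OF c(1) X v]
          assoc_mult_mat_vec[OF mat_adjoint_carrier[OF X] A(1) Xv])
    then have "((mat_adjoint X * A * X) *\<^sub>v v) \<bullet>c v = (A *\<^sub>v (X *\<^sub>v v)) \<bullet>c (X *\<^sub>v v)"
      using cscalar_prod_adjoint[OF mat_adjoint_carrier[OF X] AXv v] by simp
    then show "0 \<le> Re (((mat_adjoint X * A * X) *\<^sub>v v) \<bullet>c v)" using q[OF Xv] by simp
  qed
qed

lemma cscalar_prod_self_nonneg:
  fixes v :: "complex vec"
  shows "0 \<le> Re (v \<bullet>c v)"
  by (simp add: cscalar_prod_self[OF carrier_vec_dim_vec] sum_nonneg)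

lemma psd_one: "psd n (1\<^sub>m n)"
  by (auto simp: psd_def hermitian_def cscalar_prod_self_nonneg)

lemma psd_gram:
  assumes "X \<in> carrier_mat n m"
  shows "psd m (mat_adjoint X * X)"
  using psd_conj[OF psd_one assms] assms by (simp add: mult_one_dim)

lemma psd_diag_nonneg:
  assumes "psd n A" "i < n"
  shows "A $$ (i, i) = of_real (Re (A $$ (i, i)))" "0 \<le> Re (A $$ (i, i))"
proof -
  have A: "A \<in> carrier_mat n n" "hermitian A"
    and q: "\<And>v. v \<in> carrier_vec n \<Longrightarrow> 0 \<le> Re ((A *\<^sub>v v) \<bullet>c v)"
    using assms by (auto simp: psd_def)
  show "A $$ (i, i) = of_real (Re (A $$ (i, i)))"
    using hermitian_index[OF A(2,1) assms(2,2)] by (simp add: complex_eq_iff)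
  have "(A *\<^sub>v unit_vec n i) \<bullet>c unit_vec n i = A $$ (i, i)"
  proof -
    have "(A *\<^sub>v unit_vec n i) \<bullet>c unit_vec n i
        = (\<Sum>j<n. (A *\<^sub>v unit_vec n i) $ j * cnj (unit_vec n i $ j))"
      by (rule cscalar_prod_sum) simp
    also have "\<dots> = (\<Sum>j<n. if j = i then A $$ (j, i) else 0)"
      using A(1) assms(2) by (intro sum.cong) auto
    finally show ?thesis using assms(2) by simp
  qed
  then show "0 \<le> Re (A $$ (i, i))" using q[of "unit_vec n i"] by simp
qed

lemma psd_spectral:
  assumes "psd n A"
  obtains U p where "unitary n U" "A = fcalc U (\<lambda>i. of_real (p i))" "\<And>i. i < n \<Longrightarrow> 0 \<le> p i"
proof -
  have A: "A \<in> carrier_mat n n" "hermitian A" using assms by (auto simp: psd_def)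
  from spectral_eigenbasis[OF this] obtain U p where U: "unitary n U"
    and e: "A * U = U * diagm n (\<lambda>i. of_real (p i))" by blast
  note d = unitary_dim[OF U]
  have dA: "dim_row A = n" "dim_col A = n" using A by auto
  have "A = A * (U * mat_adjoint U)" by (simp add: unitaryD(3)[OF U] mult_one_dim dA)
  also have "\<dots> = (A * U) * mat_adjoint U" by (simp add: mult_assoc_dim d dA)
  finally have 1: "A = fcalc U (\<lambda>i. of_real (p i))" by (simp add: e fcalc_def d)
  have "mat_adjoint U * A * U = diagm n (\<lambda>i. of_real (p i))"
    by (simp add: mult_assoc_dim d dA e mult_cancel_left_dim[OF unitaryD(2)[OF U]])
  then have "0 \<le> p i" if "i < n" for i
    using psd_diag_nonneg(2)[OF psd_conj[OF assms unitaryD(1)[OF U]] that] that by simp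
  with U 1 that show ?thesis by blast
qed

lemma psd_fcalc:
  assumes "unitary n U" "\<And>i. i < n \<Longrightarrow> 0 \<le> p i"
  shows "psd n (fcalc U (\<lambda>i. of_real (p i)))"
proof -
  note d = unitary_dim[OF assms(1)]
  define X where "X = diagm n (\<lambda>i. of_real (sqrt (p i))) * mat_adjoint U"
  have X: "X \<in> carrier_mat n n" by (rule carrier_matI) (simp_all add: X_def d)
  have "mat_adjoint X * X = fcalc U (\<lambda>i. of_real (sqrt (p i)) * of_real (sqrt (p i)))"
    by (simp add: X_def fcalc_def d mult_assoc_dim adjoint_mult_dim diagm_adjoint flip: diagm_mult)
  also have "\<dots> = fcalc U (\<lambda>i. of_real (p i))"
    by (rule fcalc_cong) (use assms(2) d in \<open>auto simp flip: of_real_mult\<close>)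
  finally show ?thesis using psd_gram[OF X] by simp
qed

(* In an eigenbasis of B - C the two matrices differ only on the diagonal, where both are nonnegative;
   the diagonals of the squares then force equality. *)
lemma psd_sqrt_unique:
  assumes "psd n B" "psd n C" "B * B = C * C"
  shows "B = C"
proof -
  have B: "B \<in> carrier_mat n n" "mat_adjoint B = B" and C: "C \<in> carrier_mat n n" "mat_adjoint C = C"
    using assms by (auto simp: psd_def hermitian_def)
  have dB: "dim_row B = n" "dim_col B = n" "dim_row C = n" "dim_col C = n" using B C by auto
  have "hermitian (B - C)" by (simp add: hermitian_def mat_adjoint_minus[OF B(1) C(1)] B C)
  then obtain U l where U: "unitary n U" and e: "(B - C) * U = U * diagm n (\<lambda>i. of_real (l i))"
    using spectral_eigenbasis[OF minus_carrier_mat[OF C(1)]] by blast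
  note d = unitary_dim[OF U]
  define B' where "B' = mat_adjoint U * B * U"
  define C' where "C' = mat_adjoint U * C * U"
  have pB: "psd n B'" and pC: "psd n C'"
    unfolding B'_def C'_def
    using psd_conj[OF assms(1) unitaryD(1)[OF U]] psd_conj[OF assms(2) unitaryD(1)[OF U]] .
  then have cB: "B' \<in> carrier_mat n n" "hermitian B'" and cC: "C' \<in> carrier_mat n n" "hermitian C'"
    by (auto simp: psd_def)
  have "mat_adjoint U * ((B - C) * U) = diagm n (\<lambda>i. of_real (l i))"
    by (simp add: e mult_cancel_left_dim[OF unitaryD(2)[OF U]] d)
  moreover have "mat_adjoint U * ((B - C) * U) = B' - C'"
  proof -
    note Uc = unitaryD(1)[OF U]
    have "(B - C) * U = B * U - C * U" by (rule minus_mult_distrib_mat[OF B(1) C(1) Uc])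
    then have "mat_adjoint U * ((B - C) * U) = mat_adjoint U * (B * U) - mat_adjoint U * (C * U)"
      using mult_minus_distrib_mat[OF mat_adjoint_carrier[OF Uc] mult_carrier_mat[OF B(1) Uc] mult_carrier_mat[OF C(1) Uc]]
      by (simp only:)
    then show ?thesis by (simp add: B'_def C'_def mult_assoc_dim d dB)
  qed
  ultimately have BC: "B' - C' = diagm n (\<lambda>i. of_real (l i))" by simp
  have sq: "B' * B' = C' * C'"
  proof -
    have "B' * B' = mat_adjoint U * ((B * B) * U)"
      by (simp add: B'_def mult_assoc_dim d dB mult_cancel_left_dim[OF unitaryD(3)[OF U]])
    also have "\<dots> = C' * C'"
      unfolding assms(3) by (simp add: C'_def mult_assoc_dim d dB mult_cancel_left_dim[OF unitaryD(3)[OF U]])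
    finally show ?thesis .
  qed
  have diag: "(M * M) $$ (k, k) = (\<Sum>j<n. of_real ((norm (M $$ (k, j)))\<^sup>2))"
    if "hermitian M" "M \<in> carrier_mat n n" "k < n" for M k
  proof -
    have "(M * M) $$ (k, k) = (\<Sum>j<n. M $$ (k, j) * M $$ (j, k))"
      by (rule index_mult_mat_sum[OF that(2,2,3,3)])
    also have "\<dots> = (\<Sum>j<n. of_real ((norm (M $$ (k, j)))\<^sup>2))"
    proof (rule sum.cong[OF refl])
      fix j assume "j \<in> {..<n}"
      then have "M $$ (j, k) = cnj (M $$ (k, j))" using hermitian_index[OF that(1,2), of j k] that(3) by simp
      then show "M $$ (k, j) * M $$ (j, k) = of_real ((norm (M $$ (k, j)))\<^sup>2)"
        by (simp add: complex_norm_square del: of_real_power)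
    qed
    finally show ?thesis .
  qed
  have l0: "l k = 0" if k: "k < n" for k
  proof -
    have off: "B' $$ (k, j) = C' $$ (k, j)" if "j < n" "j \<noteq> k" for j
    proof -
      have "(B' - C') $$ (k, j) = 0" unfolding BC using that k by simp
      then show ?thesis using that k cB cC by simp
    qed
    have "(\<Sum>j<n. of_real ((norm (B' $$ (k, j)))\<^sup>2)) = (\<Sum>j<n. complex_of_real ((norm (C' $$ (k, j)))\<^sup>2))"
      using diag[OF cB(2,1) k] diag[OF cC(2,1) k] sq by simp
    then have "(\<Sum>j<n. (norm (B' $$ (k, j)))\<^sup>2) = (\<Sum>j<n. (norm (C' $$ (k, j)))\<^sup>2)"
      by (simp only: of_real_sum[symmetric] of_real_eq_iff)
    moreover have "(\<Sum>j\<in>{..<n} - {k}. (norm (B' $$ (k, j)))\<^sup>2) = (\<Sum>j\<in>{..<n} - {k}. (norm (C' $$ (k, j)))\<^sup>2)"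
      by (rule sum.cong) (auto simp: off)
    ultimately have "(norm (B' $$ (k, k)))\<^sup>2 = (norm (C' $$ (k, k)))\<^sup>2"
      using k by (simp add: sum.remove[of "{..<n}" k])
    then have "norm (B' $$ (k, k)) = norm (C' $$ (k, k))" by simp
    then have "B' $$ (k, k) = C' $$ (k, k)"
      using psd_diag_nonneg[OF pB k] psd_diag_nonneg[OF pC k]
      by (metis abs_of_nonneg norm_of_real)
    then have "(B' - C') $$ (k, k) = 0" using k cB cC by simp
    then show ?thesis unfolding BC using k by simp
  qed
  have "diagm n (\<lambda>i. of_real (l i)) = 0\<^sub>m n n" by (rule eq_matI) (auto simp: l0)
  then have "(B - C) * U = 0\<^sub>m n n" using e unitaryD(1)[OF U] by simp
  then have "(B - C) * U * mat_adjoint U = 0\<^sub>m n n" using d by simp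
  then have z: "B - C = 0\<^sub>m n n" by (simp add: mult_assoc_dim d dB unitaryD(3)[OF U] mult_one_dim)
  show ?thesis
  proof (rule eq_matI)
    fix i j assume ij: "i < dim_row C" "j < dim_col C"
    then have "(B - C) $$ (i, j) = 0" unfolding z using dB by simp
    then show "B $$ (i, j) = C $$ (i, j)" using ij dB by simp
  qed (use dB in auto)
qed

text \<open>The \<open>THE\<close> in \<open>msqrt\<close> is justified by
  \<open>psd_sqrt_unique\<close>; taking roots of the eigenvalues gives existence.\<close>

lemma msqrt_fcalc:
  assumes "unitary n U" "\<And>i. i < n \<Longrightarrow> 0 \<le> p i"
  shows "msqrt (fcalc U (\<lambda>i. of_real (p i))) = fcalc U (\<lambda>i. of_real (sqrt (p i)))"
proof -
  have sq: "fcalc U (\<lambda>i. of_real (sqrt (p i))) * fcalc U (\<lambda>i. of_real (sqrt (p i))) = fcalc U (\<lambda>i. of_real (p i))"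
    unfolding fcalc_mult[OF assms(1)]
    by (rule fcalc_cong) (use assms(2) unitary_dim[OF assms(1)] in \<open>auto simp flip: of_real_mult\<close>)
  have ps: "psd n (fcalc U (\<lambda>i. of_real (sqrt (p i))))" by (rule psd_fcalc[OF assms(1)]) (use assms(2) in auto)
  have dr: "dim_row (fcalc U (\<lambda>i. of_real (p i))) = n" by (simp add: unitary_dim[OF assms(1)])
  show ?thesis unfolding msqrt_def dr
  proof (rule the_equality)
    show "psd n (fcalc U (\<lambda>i. of_real (sqrt (p i)))) \<and>
      fcalc U (\<lambda>i. of_real (sqrt (p i))) * fcalc U (\<lambda>i. of_real (sqrt (p i))) = fcalc U (\<lambda>i. of_real (p i))"
      using sq ps by simp
    fix B assume "psd n B \<and> B * B = fcalc U (\<lambda>i. of_real (p i))"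
    then show "B = fcalc U (\<lambda>i. of_real (sqrt (p i)))"
      using psd_sqrt_unique[OF _ ps, of B] sq by simp
  qed
qed

definition eigen_decomp :: "nat \<Rightarrow> complex mat \<Rightarrow> complex mat \<Rightarrow> (nat \<Rightarrow> real) \<Rightarrow> bool" where
  "eigen_decomp n \<rho> U p \<longleftrightarrow> unitary n U \<and> \<rho> = fcalc U (\<lambda>i. of_real (p i)) \<and> (\<forall>i<n. 0 \<le> p i) \<and> (\<Sum>i<n. p i) = 1"

lemma eigen_decompD:
  assumes "eigen_decomp n \<rho> U p"
  shows "unitary n U" "\<rho> = fcalc U (\<lambda>i. of_real (p i))" "(\<Sum>i<n. p i) = 1"
    "i < n \<Longrightarrow> 0 \<le> p i" "i < n \<Longrightarrow> p i \<le> 1"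
proof -
  show "unitary n U" "\<rho> = fcalc U (\<lambda>i. of_real (p i))" and s: "(\<Sum>i<n. p i) = 1"
    and p: "i < n \<Longrightarrow> 0 \<le> p i" for i
    using assms by (auto simp: eigen_decomp_def)
  assume "i < n"
  then show "p i \<le> 1" using member_le_sum[of i "{..<n}" p] p s by auto
qed

text \<open>The trace of the product of the two square roots, in eigenbases. Classically, it is the
  Bhattacharyya coefficient of the weights p_i w_ij and q_j w_ij, with w_ij the overlaps.\<close>

definition affinity :: "nat \<Rightarrow> complex mat \<Rightarrow> (nat \<Rightarrow> real) \<Rightarrow> complex mat \<Rightarrow> (nat \<Rightarrow> real) \<Rightarrow> real" where
  "affinity n U p V q = (\<Sum>i<n. \<Sum>j<n. sqrt (p i) * sqrt (q j) * overlap U V i j)"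

text \<open>With R and S the two roots, R^2 and S^2 have trace 1, and by cyclicity both mixed
  products have the same real trace T; the trace of (R - S)^2 is therefore 2 - 2T.\<close>

lemma hellinger_eq_affinity:
  assumes "eigen_decomp n \<rho> U p" "eigen_decomp n \<sigma> V q"
  shows "hellinger \<rho> \<sigma> = sqrt (1 - affinity n U p V q)"
proof -
  note U = eigen_decompD[OF assms(1)] and V = eigen_decompD[OF assms(2)]
  define R where "R = fcalc U (\<lambda>i. of_real (sqrt (p i)))"
  define S where "S = fcalc V (\<lambda>i. of_real (sqrt (q i)))"
  have c: "R \<in> carrier_mat n n" "S \<in> carrier_mat n n" using U V by (auto simp: R_def S_def)
  have RR: "mtrace (R * R) = 1"
  proof -
    have "mtrace (R * R) = (\<Sum>i<n. of_real (sqrt (p i)) * of_real (sqrt (p i)))"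
      by (simp only: R_def fcalc_mult[OF U(1)] mtrace_fcalc[OF U(1)])
    also have "\<dots> = of_real (\<Sum>i<n. p i)"
      by (simp add: U(4) flip: of_real_mult)
    finally show ?thesis using U(3) by simp
  qed
  have SS: "mtrace (S * S) = 1"
  proof -
    have "mtrace (S * S) = (\<Sum>i<n. of_real (sqrt (q i)) * of_real (sqrt (q i)))"
      by (simp only: S_def fcalc_mult[OF V(1)] mtrace_fcalc[OF V(1)])
    also have "\<dots> = of_real (\<Sum>i<n. q i)"
      by (simp add: V(4) flip: of_real_mult)
    finally show ?thesis using V(3) by simp
  qed
  define T where "T = affinity n U p V q"
  have RS: "mtrace (R * S) = of_real T"
    unfolding R_def S_def mtrace_fcalc_mult[OF U(1) V(1)] T_def affinity_def by simp
  have SR: "mtrace (S * R) = of_real T"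
    using mtrace_mult_comm[OF c] RS by simp
  have cp: "R * R \<in> carrier_mat n n" "R * S \<in> carrier_mat n n" "S * R \<in> carrier_mat n n" "S * S \<in> carrier_mat n n"
    using mult_carrier_mat[OF c(1,1)] mult_carrier_mat[OF c] mult_carrier_mat[OF c(2,1)] mult_carrier_mat[OF c(2,2)] .
  have "(R - S) * (R - S) = (R * R - R * S) - (S * R - S * S)"
    using minus_mult_distrib_mat[OF c minus_carrier_mat[OF c(2)]]
      mult_minus_distrib_mat[OF c(1,1,2)] mult_minus_distrib_mat[OF c(2,1,2)] by (simp only:)
  moreover have "mtrace ((R * R - R * S) - (S * R - S * S)) = 1 - of_real T - (of_real T - 1)"
    by (simp only: mtrace_minus[OF minus_carrier_mat[OF cp(2)] minus_carrier_mat[OF cp(4)]]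
        mtrace_minus[OF cp(1,2)] mtrace_minus[OF cp(3,4)] RR SS RS SR)
  ultimately have "Re (mtrace ((R - S) * (R - S))) / 2 = 1 - T" by simp
  moreover have "msqrt \<rho> = R" unfolding R_def U(2)
    by (rule msqrt_fcalc[OF U(1)]) (rule U(4))
  moreover have "msqrt \<sigma> = S" unfolding S_def V(2)
    by (rule msqrt_fcalc[OF V(1)]) (rule V(4))
  ultimately show ?thesis unfolding hellinger_def by (simp add: T_def)
qed

text \<open>A column u of \<open>U\<close> with nonzero value F is A (u / F), so it lies in the
  column space; such columns are orthonormal, hence independent and no more numerous than the
  dimension of that space. This turns the rank hypothesis into a bound on the number of nonzero
  eigenvalues.\<close>

lemma card_support_le_mrank:
  assumes U: "unitary n U"
  shows "card {i. i < n \<and> F i \<noteq> 0} \<le> mrank (fcalc U F)"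
proof -
  define A where "A = fcalc U F"
  interpret cof_vec_space n "TYPE(complex)" .
  note d = unitary_dim[OF U]
  have A: "A \<in> carrier_mat n n" using U by (simp add: A_def)
  have dA: "dim_row A = n" "dim_col A = n" using A by auto
  define I where "I = {i. i < n \<and> F i \<noteq> 0}"
  have fI: "finite I" by (simp add: I_def)
  have ip: "col U i \<bullet>c col U j = (if i = j then 1 else 0)" if "i < n" "j < n" for i j
  proof -
    have "col U i \<bullet>c col U j = (\<Sum>k<n. mat_adjoint U $$ (j, k) * U $$ (k, i))"
      using that d by (subst cscalar_prod_sum[of _ n]) (auto intro!: sum.cong)
    also have "\<dots> = (mat_adjoint U * U) $$ (j, i)"
      using that unitaryD(1)[OF U] by (subst index_mult_mat_sum[of _ n n _ n]) auto
    finally show ?thesis using that by (auto simp: unitaryD(2)[OF U])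
  qed
  have inj: "inj_on (col U) I"
  proof (rule inj_onI)
    fix i j assume "i \<in> I" "j \<in> I" "col U i = col U j"
    then show "i = j" using ip[of i j] ip[of i i] by (auto simp: I_def split: if_splits)
  qed
  have sub: "col U ` I \<subseteq> span (set (cols A))"
  proof (rule image_subsetI)
    fix i assume "i \<in> I"
    then have i: "i < n" "F i \<noteq> 0" by (auto simp: I_def)
    have "A * U = U * diagm n F"
      by (simp add: A_def fcalc_def d mult_assoc_dim unitaryD(2)[OF U] mult_one_dim)
    then have "col (A * U) i = col (U * diagm n F) i" by simp
    moreover have "col (A * U) i = A *\<^sub>v col U i"
      using i by (intro col_mult2[OF A unitaryD(1)[OF U]])
    moreover have "col (U * diagm n F) i = F i \<cdot>\<^sub>v col U i"
      using i d by (intro eq_vecI) (auto simp: mult_diagm_index[OF unitaryD(1)[OF U]] mult.commute)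
    ultimately have ev: "A *\<^sub>v col U i = F i \<cdot>\<^sub>v col U i" by simp
    have "A *\<^sub>v ((1 / F i) \<cdot>\<^sub>v col U i) = col U i"
    proof -
      have "col U i \<in> carrier_vec n" using d by auto
      from mult_mat_vec[OF A this, of "1 / F i"] show ?thesis
        using i d by (simp add: ev smult_smult_assoc)
    qed
    moreover have "(1 / F i) \<cdot>\<^sub>v col U i \<in> carrier_vec (dim_col A)" using d dA by auto
    moreover have "col U i \<in> carrier_vec (dim_row A)" using d dA by auto
    ultimately have "col U i \<in> col_space A" unfolding col_space_eq[OF A] by blast
    then show "col U i \<in> span (set (cols A))" by (simp add: col_space_def)
  qed
  have cU: "col U ` I \<subseteq> carrier_vec n" using d by auto
  have li: "lin_indpt (col U ` I)"
  proof (rule finite_lin_indpt2)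
    show "finite (col U ` I)" using fI by simp
    show "col U ` I \<subseteq> carrier_vec n" using cU by simp
    fix a :: "complex vec \<Rightarrow> complex" assume z: "lincomb a (col U ` I) = 0\<^sub>v n"
    show "\<forall>v\<in>col U ` I. a v = 0"
    proof
      fix v assume "v \<in> col U ` I"
      then obtain j where j: "j \<in> I" "v = col U j" by auto
      have jn: "j < n" using j by (simp add: I_def)
      \<comment> \<open>Pairing the vanishing combination with one of the orthonormal columns
        isolates its coefficient.\<close>
      have "0 = lincomb a (col U ` I) \<bullet>c col U j" using z d by (simp add: scalar_prod_def)
      also have "\<dots> = (\<Sum>k<n. (\<Sum>x\<in>col U ` I. a x * x $ k) * cnj (col U j $ k))"
        using d by (subst cscalar_prod_sum[of _ n]) (auto simp: lincomb_index[OF _ cU])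
      also have "\<dots> = (\<Sum>k<n. (\<Sum>i\<in>I. a (col U i) * col U i $ k) * cnj (col U j $ k))"
        by (simp add: sum.reindex[OF inj])
      also have "\<dots> = (\<Sum>i\<in>I. \<Sum>k<n. a (col U i) * (col U i $ k * cnj (col U j $ k)))"
        by (subst sum.swap) (simp add: sum_distrib_right mult.assoc)
      also have "\<dots> = (\<Sum>i\<in>I. a (col U i) * (col U i \<bullet>c col U j))"
      proof (rule sum.cong[OF refl])
        fix i
        have "col U j \<in> carrier_vec n" using d by auto
        from cscalar_prod_sum[OF this, of "col U i"]
        show "(\<Sum>k<n. a (col U i) * (col U i $ k * cnj (col U j $ k))) = a (col U i) * (col U i \<bullet>c col U j)"
          by (simp add: sum_distrib_left)
      qed
      also have "\<dots> = (\<Sum>i\<in>I. if i = j then a (col U i) else 0)"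
        by (intro sum.cong refl) (auto simp: I_def ip jn)
      also have "\<dots> = a (col U j)" using j fI by simp
      finally show "a v = 0" using j by simp
    qed
  qed
  have cols: "set (cols A) \<subseteq> carrier_vec n" using A cols_dim[of A] by auto
  have sm: "submodule class_ring (span (set (cols A))) V" by (rule span_is_submodule[OF cols])
  have vs: "vectorspace class_ring (span_vs (set (cols A)))"
    using span_is_subspace[OF cols] by (rule subspace_is_vs)
  have "card (col U ` I) \<le> vectorspace.dim class_ring (span_vs (set (cols A)))"
  proof (rule vectorspace.li_le_dim(2)[OF vs])
    show "vectorspace.fin_dim class_ring (span_vs (set (cols A)))" by (rule fin_dim_span_cols[OF A])
    show "col U ` I \<subseteq> carrier (span_vs (set (cols A)))" using sub by simp
    show "\<not> LinearCombinations.module.lin_dep class_ring (span_vs (set (cols A))) (col U ` I)"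
      using span_li_not_depend(2)[OF sub sm] li by simp
  qed
  then show ?thesis
    using card_image[OF inj] by (simp add: mrank_def rank_def dA flip: A_def I_def)
qed

section \<open>Kronecker products\<close>

lemma sum_lessThan_mult:
  fixes f :: "nat \<Rightarrow> 'a::comm_monoid_add"
  shows "(\<Sum>x<m * n. f x) = (\<Sum>i<m. \<Sum>j<n. f (i * n + j))"
proof (induction m)
  case (Suc m)
  have "(\<Sum>x<Suc m * n. f x) = (\<Sum>x<m * n. f x) + (\<Sum>x=m * n..<m * n + n. f x)"
    using sum.atLeastLessThan_concat[of 0 "m * n" "m * n + n" f] by (simp add: atLeast0LessThan add.commute)
  also have "(\<Sum>x=m * n..<m * n + n. f x) = (\<Sum>j<n. f (m * n + j))"
    using sum.shift_bounds_nat_ivl[of f 0 "m * n" n] by (simp add: atLeast0LessThan add.commute)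
  finally show ?case using Suc by simp
qed simp

lemma mult_add_less:
  fixes i j m n :: nat
  assumes "i < m" "j < n"
  shows "i * n + j < m * n"
proof -
  have "i * n + j < Suc i * n" using assms by simp
  also have "\<dots> \<le> m * n" using assms by (intro mult_right_mono) auto
  finally show ?thesis .
qed

lemma div_mod_bounds:
  fixes i m n :: nat
  assumes "i < m * n"
  shows "i div n < m" "i mod n < n"
  using assms by (auto simp: less_mult_imp_div_less intro!: mod_less_divisor) (metis mult_0_right not_gr_zero not_less_zero)

lemma kron_dim [simp]:
  "dim_row (kron A B) = dim_row A * dim_row B" "dim_col (kron A B) = dim_col A * dim_col B"
  by (auto simp: kron_def)

lemma kron_carrier:
  "A \<in> carrier_mat a b \<Longrightarrow> B \<in> carrier_mat c d \<Longrightarrow> kron A B \<in> carrier_mat (a * c) (b * d)"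
  by (rule carrier_matI) auto

lemma kron_index:
  assumes "i < dim_row A * dim_row B" "j < dim_col A * dim_col B"
  shows "kron A B $$ (i, j)
    = A $$ (i div dim_row B, j div dim_col B) * B $$ (i mod dim_row B, j mod dim_col B)"
  using assms by (simp add: kron_def)

lemma kron_index_split:
  assumes "i < dim_row A" "k < dim_row B" "j < dim_col A" "l < dim_col B"
  shows "kron A B $$ (i * dim_row B + k, j * dim_col B + l) = A $$ (i, j) * B $$ (k, l)"
  using assms by (subst kron_index) (auto intro: mult_add_less)

lemma kron_mult:
  assumes "dim_col A = dim_row C" "dim_col B = dim_row D"
  shows "kron A B * kron C D = kron (A * C) (B * D)"
proof (rule eq_matI)
  fix i j assume "i < dim_row (kron (A * C) (B * D))" "j < dim_col (kron (A * C) (B * D))"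
  then have i: "i < dim_row A * dim_row B" and j: "j < dim_col C * dim_col D" by auto
  note ib = div_mod_bounds[OF i] and jb = div_mod_bounds[OF j]
  have "(kron A B * kron C D) $$ (i, j) = (\<Sum>l<dim_col A * dim_col B. kron A B $$ (i, l) * kron C D $$ (l, j))"
    by (rule index_mult_mat_sum[of _ "dim_row A * dim_row B" _ _ "dim_col C * dim_col D"])
       (auto simp: assms i j)
  also have "\<dots> = (\<Sum>x<dim_col A. \<Sum>y<dim_col B.
      kron A B $$ (i, x * dim_col B + y) * kron C D $$ (x * dim_col B + y, j))"
    by (rule sum_lessThan_mult)
  also have "\<dots> = (\<Sum>x<dim_col A. \<Sum>y<dim_col B.
      (A $$ (i div dim_row B, x) * C $$ (x, j div dim_col D)) * (B $$ (i mod dim_row B, y) * D $$ (y, j mod dim_col D)))"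
  proof (intro sum.cong refl)
    fix x y assume "x \<in> {..<dim_col A}" "y \<in> {..<dim_col B}"
    then have xy: "x < dim_col A" "y < dim_col B" by auto
    then have l: "x * dim_col B + y < dim_col A * dim_col B" by (intro mult_add_less)
    show "kron A B $$ (i, x * dim_col B + y) * kron C D $$ (x * dim_col B + y, j)
      = (A $$ (i div dim_row B, x) * C $$ (x, j div dim_col D)) * (B $$ (i mod dim_row B, y) * D $$ (y, j mod dim_col D))"
      using xy l i j assms by (simp add: kron_index)
  qed
  also have "\<dots> = (A * C) $$ (i div dim_row B, j div dim_col D) * (B * D) $$ (i mod dim_row B, j mod dim_col D)"
    using ib jb assms
    by (subst (1 2) index_mult_mat_sum[of _ "dim_row _" "dim_col _" _ "dim_col _"])
       (auto simp: sum_product)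
  also have "\<dots> = kron (A * C) (B * D) $$ (i, j)"
    using i j by (subst kron_index) auto
  finally show "(kron A B * kron C D) $$ (i, j) = kron (A * C) (B * D) $$ (i, j)" .
qed auto

lemma kron_adjoint: "mat_adjoint (kron A B) = kron (mat_adjoint A) (mat_adjoint B)"
proof (rule eq_matI)
  fix i j assume "i < dim_row (kron (mat_adjoint A) (mat_adjoint B))" "j < dim_col (kron (mat_adjoint A) (mat_adjoint B))"
  then have i: "i < dim_col A * dim_col B" and j: "j < dim_row A * dim_row B" by auto
  then show "mat_adjoint (kron A B) $$ (i, j) = kron (mat_adjoint A) (mat_adjoint B) $$ (i, j)"
    using div_mod_bounds[OF i] div_mod_bounds[OF j] by (simp add: kron_index)
qed auto

lemma kron_add_left:
  assumes "dim_row A = dim_row A'" "dim_col A = dim_col A'"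
  shows "kron (A + A') B = kron A B + kron A' B"
proof (rule eq_matI)
  fix i j assume "i < dim_row (kron A B + kron A' B)" "j < dim_col (kron A B + kron A' B)"
  then have i: "i < dim_row A' * dim_row B" and j: "j < dim_col A' * dim_col B" by auto
  then show "kron (A + A') B $$ (i, j) = (kron A B + kron A' B) $$ (i, j)"
    using div_mod_bounds[OF i] div_mod_bounds[OF j] assms by (simp add: kron_index algebra_simps)
qed (use assms in auto)

lemma kron_add_right:
  assumes "dim_row B = dim_row B'" "dim_col B = dim_col B'"
  shows "kron A (B + B') = kron A B + kron A B'"
proof (rule eq_matI)
  fix i j assume "i < dim_row (kron A B + kron A B')" "j < dim_col (kron A B + kron A B')"
  then have i: "i < dim_row A * dim_row B'" and j: "j < dim_col A * dim_col B'" by auto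
  then show "kron A (B + B') $$ (i, j) = (kron A B + kron A B') $$ (i, j)"
    using div_mod_bounds[OF i] div_mod_bounds[OF j] assms by (simp add: kron_index algebra_simps)
qed (use assms in auto)

lemma kron_smult_left: "kron (c \<cdot>\<^sub>m A) B = c \<cdot>\<^sub>m kron A B"
proof (rule eq_matI)
  fix i j assume "i < dim_row (c \<cdot>\<^sub>m kron A B)" "j < dim_col (c \<cdot>\<^sub>m kron A B)"
  then have i: "i < dim_row A * dim_row B" and j: "j < dim_col A * dim_col B" by auto
  then show "kron (c \<cdot>\<^sub>m A) B $$ (i, j) = (c \<cdot>\<^sub>m kron A B) $$ (i, j)"
    using div_mod_bounds[OF i] div_mod_bounds[OF j] by (simp add: kron_index)
qed auto

lemma kron_smult_right: "kron A (c \<cdot>\<^sub>m B) = c \<cdot>\<^sub>m kron A B"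
proof (rule eq_matI)
  fix i j assume "i < dim_row (c \<cdot>\<^sub>m kron A B)" "j < dim_col (c \<cdot>\<^sub>m kron A B)"
  then have i: "i < dim_row A * dim_row B" and j: "j < dim_col A * dim_col B" by auto
  then show "kron A (c \<cdot>\<^sub>m B) $$ (i, j) = (c \<cdot>\<^sub>m kron A B) $$ (i, j)"
    using div_mod_bounds[OF i] div_mod_bounds[OF j] by (simp add: kron_index)
qed auto

lemma kron_one: "kron (1\<^sub>m m) (1\<^sub>m n) = 1\<^sub>m (m * n)"
proof (rule eq_matI)
  fix i j assume "i < dim_row (1\<^sub>m (m * n) :: complex mat)" "j < dim_col (1\<^sub>m (m * n) :: complex mat)"
  then have i: "i < m * n" and j: "j < m * n" by auto
  have "i = j \<longleftrightarrow> i div n = j div n \<and> i mod n = j mod n"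
    by (metis div_mult_mod_eq)
  then show "kron (1\<^sub>m m) (1\<^sub>m n) $$ (i, j) = (1\<^sub>m (m * n) :: complex mat) $$ (i, j)"
    using i j div_mod_bounds[OF i] div_mod_bounds[OF j] by (simp add: kron_index)
qed auto

lemma kron_one_left: "kron (1\<^sub>m 1) A = A"
  by (rule eq_matI) (auto simp: kron_index)

lemma kron_one_right: "kron A (1\<^sub>m 1) = A"
  by (rule eq_matI) (auto simp: kron_index)

lemma kron_assoc: "kron (kron A B) C = kron A (kron B C)"
proof (rule eq_matI)
  fix i j assume "i < dim_row (kron A (kron B C))" "j < dim_col (kron A (kron B C))"
  then have i: "i < dim_row A * dim_row B * dim_row C" and j: "j < dim_col A * dim_col B * dim_col C"
    by (auto simp: mult.assoc)
  note ib = div_mod_bounds[OF i] and jb = div_mod_bounds[OF j]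
  have dm: "x div (b * c) = x div c div b" "x mod (b * c) div c = x div c mod b" "x mod (b * c) mod c = x mod c"
    if "c > 0" for x b c :: nat
    using that by (simp_all add: mult.commute[of b c] div_mult2_eq mod_mult2_eq)
  have r: "i mod (dim_row B * dim_row C) < dim_row B * dim_row C"
    "j mod (dim_col B * dim_col C) < dim_col B * dim_col C"
    using div_mod_bounds(2)[of i "dim_row A" "dim_row B * dim_row C"]
      div_mod_bounds(2)[of j "dim_col A" "dim_col B * dim_col C"] i j by (auto simp: mult.assoc)
  have "kron (kron A B) C $$ (i, j) = kron A B $$ (i div dim_row C, j div dim_col C) * C $$ (i mod dim_row C, j mod dim_col C)"
    using i j by (subst kron_index) auto
  also have "\<dots> = A $$ (i div dim_row C div dim_row B, j div dim_col C div dim_col B)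
      * (B $$ (i div dim_row C mod dim_row B, j div dim_col C mod dim_col B) * C $$ (i mod dim_row C, j mod dim_col C))"
    using ib jb by (subst kron_index) auto
  also have "\<dots> = A $$ (i div (dim_row B * dim_row C), j div (dim_col B * dim_col C))
      * kron B C $$ (i mod (dim_row B * dim_row C), j mod (dim_col B * dim_col C))"
    using ib jb r by (subst kron_index) (auto simp: dm)
  also have "\<dots> = kron A (kron B C) $$ (i, j)"
    using i j by (subst (2) kron_index) (auto simp: mult.assoc)
  finally show "kron (kron A B) C $$ (i, j) = kron A (kron B C) $$ (i, j)" .
qed (auto simp: mult.assoc)

lemma mtrace_kron:
  assumes "A \<in> carrier_mat m m" "B \<in> carrier_mat n n"
  shows "mtrace (kron A B) = mtrace A * mtrace B"
proof -
  have "mtrace (kron A B) = (\<Sum>i<m. \<Sum>k<n. kron A B $$ (i * n + k, i * n + k))"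
    using assms by (simp add: mtrace_def sum_lessThan_mult)
  also have "\<dots> = (\<Sum>i<m. \<Sum>k<n. A $$ (i, i) * B $$ (k, k))"
    using assms kron_index_split[of _ A _ B] by (intro sum.cong) auto
  finally show ?thesis using assms by (simp add: mtrace_def sum_product)
qed

text \<open>The permutation matrix taking x (x) y to y (x) x for x of dimension \<open>m\<close> and
  y of dimension \<open>n\<close>. Unequal dimensions are allowed so that one copy can be moved past
  a whole block of copies.\<close>

definition swapm :: "nat \<Rightarrow> nat \<Rightarrow> complex mat" where
  "swapm m n = mat (n * m) (m * n)
     (\<lambda>(a, b). if a div m = b mod n \<and> a mod m = b div n then 1 else 0)"

lemma swapm_dim [simp]: "dim_row (swapm m n) = n * m" "dim_col (swapm m n) = m * n"
  by (auto simp: swapm_def)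

lemma swapm_adjoint: "mat_adjoint (swapm m n) = swapm n m"
  by (rule eq_matI) (auto simp: swapm_def)

lemma mult_swapm_index:
  assumes "M \<in> carrier_mat p (n * m)" "x < p" "i < m" "j < n"
  shows "(M * swapm m n) $$ (x, i * n + j) = M $$ (x, j * m + i)"
proof -
  have b: "i * n + j < m * n" using assms by (intro mult_add_less)
  have "(M * swapm m n) $$ (x, i * n + j) = (\<Sum>l<n * m. M $$ (x, l) * swapm m n $$ (l, i * n + j))"
    by (rule index_mult_mat_sum[of _ p _ _ "m * n"]) (use assms b in auto)
  also have "\<dots> = (\<Sum>l<n * m. if l = j * m + i then M $$ (x, l) else 0)"
  proof (rule sum.cong[OF refl])
    fix l assume "l \<in> {..<n * m}"
    then have l: "l < n * m" by simp
    have "l div m = j \<and> l mod m = i \<longleftrightarrow> l = j * m + i"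
      using assms(3) by auto
    then show "M $$ (x, l) * swapm m n $$ (l, i * n + j) = (if l = j * m + i then M $$ (x, l) else 0)"
      using l b assms by (simp add: swapm_def)
  qed
  also have "\<dots> = M $$ (x, j * m + i)" using mult_add_less[OF assms(4,3)] by simp
  finally show ?thesis .
qed

lemma swapm_kron:
  assumes "A \<in> carrier_mat m m" "B \<in> carrier_mat n n"
  shows "kron B A * swapm m n = swapm m n * kron A B"
proof (rule eq_matI)
  have kc: "kron B A \<in> carrier_mat (n * m) (n * m)" "mat_adjoint (kron A B) \<in> carrier_mat (m * n) (m * n)"
    using assms by (auto intro!: carrier_matI)
  fix x y assume "x < dim_row (swapm m n * kron A B)" "y < dim_col (swapm m n * kron A B)"
  then have x: "x < n * m" and y: "y < m * n" using assms by auto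
  define k l i j where d: "k = x div m" "l = x mod m" "i = y div n" "j = y mod n"
  have b: "k < n" "l < m" "i < m" "j < n" unfolding d using div_mod_bounds[OF x] div_mod_bounds[OF y] by auto
  have xy: "x = k * m + l" "y = i * n + j" unfolding d by simp_all
  have "(kron B A * swapm m n) $$ (x, y) = kron B A $$ (x, j * m + i)"
    unfolding xy(2) by (rule mult_swapm_index[OF kc(1) x b(3,4)])
  also have "\<dots> = B $$ (k, j) * A $$ (l, i)"
    unfolding xy(1) using kron_index_split[of k B l A j i] assms b by auto
  finally have 1: "(kron B A * swapm m n) $$ (x, y) = B $$ (k, j) * A $$ (l, i)" .
  \<comment> \<open>Only multiplication by a swap from the right has been computed; multiplication
    from the left is reduced to it by taking adjoints.\<close>
  have "mat_adjoint (swapm m n * kron A B) = mat_adjoint (kron A B) * swapm n m"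
    using assms by (simp add: adjoint_mult_dim swapm_adjoint)
  then have "cnj ((swapm m n * kron A B) $$ (x, y)) = (mat_adjoint (kron A B) * swapm n m) $$ (y, x)"
    using x y assms by (metis carrier_matD kron_dim(2) index_mult_mat(2,3) mat_adjoint_index swapm_dim(1))
  also have "\<dots> = mat_adjoint (kron A B) $$ (y, l * n + k)"
    unfolding xy(1) by (rule mult_swapm_index[OF kc(2) y b(1,2)])
  also have "\<dots> = cnj (kron A B $$ (l * n + k, i * n + j))"
    using y mult_add_less[OF b(2,1)] assms unfolding xy(2) by simp
  also have "kron A B $$ (l * n + k, i * n + j) = A $$ (l, i) * B $$ (k, j)"
    using kron_index_split[of l A k B i j] assms b by auto
  finally have "(swapm m n * kron A B) $$ (x, y) = A $$ (l, i) * B $$ (k, j)"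
    by (metis complex_cnj_cancel_iff)
  with 1 show "(kron B A * swapm m n) $$ (x, y) = (swapm m n * kron A B) $$ (x, y)" by simp
qed (use assms in auto)

lemma swapm_mult: "swapm n m * swapm m n = 1\<^sub>m (m * n)"
proof (rule eq_matI)
  fix x y assume "x < dim_row (1\<^sub>m (m * n) :: complex mat)" "y < dim_col (1\<^sub>m (m * n) :: complex mat)"
  then have x: "x < m * n" and y: "y < m * n" by auto
  define i j where d: "i = y div n" "j = y mod n"
  have b: "i < m" "j < n" unfolding d using div_mod_bounds[OF y] by auto
  have yy: "y = i * n + j" unfolding d by simp
  have bb: "j * m + i < n * m" using b by (intro mult_add_less)
  have c: "swapm n m \<in> carrier_mat (m * n) (n * m)" by (rule carrier_matI) auto
  have "(swapm n m * swapm m n) $$ (x, y) = swapm n m $$ (x, j * m + i)"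
    unfolding yy by (rule mult_swapm_index[OF c x b])
  also have "\<dots> = (if x div n = i \<and> x mod n = j then 1 else 0)"
    using x bb b by (simp add: swapm_def)
  also have "\<dots> = (1\<^sub>m (m * n) :: complex mat) $$ (x, y)"
    using x y d by (metis div_mult_mod_eq index_one_mat(1))
  finally show "(swapm n m * swapm m n) $$ (x, y) = (1\<^sub>m (m * n) :: complex mat) $$ (x, y)" .
qed auto

text \<open>Positive factors are Gram matrices X^* X and Y^* Y, and their Kronecker product is the
  Gram matrix of \<open>kron X Y\<close>.\<close>

lemma psd_kron:
  assumes "psd m A" "psd n B"
  shows "psd (m * n) (kron A B)"
proof -
  have fac: "\<exists>X\<in>carrier_mat k k. C = mat_adjoint X * X" if "psd k C" for k C
  proof -
    from psd_spectral[OF that] obtain U p where U: "unitary k U" and C: "C = fcalc U (\<lambda>i. of_real (p i))"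
      and p: "\<And>i. i < k \<Longrightarrow> 0 \<le> p i" by blast
    define X where "X = fcalc U (\<lambda>i. of_real (sqrt (p i)))"
    have "psd k X" unfolding X_def by (rule psd_fcalc[OF U]) (use p in auto)
    then have X: "X \<in> carrier_mat k k" "mat_adjoint X = X" by (auto simp: psd_def hermitian_def)
    have "X * X = C" unfolding X_def C fcalc_mult[OF U]
      by (rule fcalc_cong) (use p unitary_dim[OF U] in \<open>auto simp flip: of_real_mult\<close>)
    with X show ?thesis by (intro bexI[of _ X]) auto
  qed
  from fac[OF assms(1)] obtain X where X: "X \<in> carrier_mat m m" "A = mat_adjoint X * X" by blast
  from fac[OF assms(2)] obtain Y where Y: "Y \<in> carrier_mat n n" "B = mat_adjoint Y * Y" by blast
  have "kron A B = mat_adjoint (kron X Y) * kron X Y"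
    unfolding X(2) Y(2) using X(1) Y(1) by (simp add: kron_adjoint kron_mult)
  then show ?thesis using psd_gram[OF kron_carrier[OF X(1) Y(1)]] by simp
qed

section \<open>Circuits of partial swaps\<close>

text \<open>Contracting the first register against the swap leaves the trace of (X (x) 1) V (tau (x)
  R), in which X moves cyclically to the right of tau. The proof carries this out on
  indices.\<close>

lemma mtrace_kron_swap:
  assumes X: "X \<in> carrier_mat d d" and t: "\<tau> \<in> carrier_mat d d" and R: "R \<in> carrier_mat D D"
    and V: "V \<in> carrier_mat (d * D) (d * D)"
  shows "mtrace (kron X (V * kron \<tau> R) * kron (swapm d d) (1\<^sub>m D)) = mtrace (V * kron (\<tau> * X) R)"
proof -
  define M where "M = V * kron \<tau> R"
  have M: "M \<in> carrier_mat (d * D) (d * D)" unfolding M_def by (rule mult_carrier_mat[OF V kron_carrier[OF t R]])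
  have XM: "kron X M \<in> carrier_mat (d * d * D) (d * d * D)"
    using kron_carrier[OF X M] by (simp add: mult.assoc)
  have Mi: "M $$ (x, i * D + k) = (\<Sum>l<d. \<Sum>q<D. V $$ (x, l * D + q) * (\<tau> $$ (l, i) * R $$ (q, k)))"
    if "x < d * D" "i < d" "k < D" for x i k
  proof -
    have "M $$ (x, i * D + k) = (\<Sum>y<d * D. V $$ (x, y) * kron \<tau> R $$ (y, i * D + k))"
      unfolding M_def by (rule index_mult_mat_sum[OF V kron_carrier[OF t R] that(1) mult_add_less[OF that(2,3)]])
    also have "\<dots> = (\<Sum>l<d. \<Sum>q<D. V $$ (x, l * D + q) * kron \<tau> R $$ (l * D + q, i * D + k))"
      by (rule sum_lessThan_mult)
    also have "\<dots> = (\<Sum>l<d. \<Sum>q<D. V $$ (x, l * D + q) * (\<tau> $$ (l, i) * R $$ (q, k)))"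
    proof (intro sum.cong refl)
      fix l q assume "l \<in> {..<d}" "q \<in> {..<D}"
      then show "V $$ (x, l * D + q) * kron \<tau> R $$ (l * D + q, i * D + k) = V $$ (x, l * D + q) * (\<tau> $$ (l, i) * R $$ (q, k))"
        using kron_index_split[of l \<tau> q R i k] t R that by auto
    qed
    finally show ?thesis .
  qed
  let ?Q = "kron X M * kron (swapm d d) (1\<^sub>m D)"
  have sw: "?Q $$ (x, (i * d + j) * D + k) = kron X M $$ (x, (j * d + i) * D + k)"
    if "x < d * d * D" "i < d" "j < d" "k < D" for x i j k
  proof -
    have c: "(i * d + j) * D + k < d * d * D" using that by (intro mult_add_less)
    have cc: "kron (swapm d d) (1\<^sub>m D) \<in> carrier_mat (d * d * D) (d * d * D)" by (rule carrier_matI) auto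
    have "?Q $$ (x, (i * d + j) * D + k)
      = (\<Sum>y<d * d * D. kron X M $$ (x, y) * kron (swapm d d) (1\<^sub>m D) $$ (y, (i * d + j) * D + k))"
      by (rule index_mult_mat_sum[OF XM cc that(1) c])
    also have "\<dots> = (\<Sum>p<d * d. \<Sum>q<D. kron X M $$ (x, p * D + q) * kron (swapm d d) (1\<^sub>m D) $$ (p * D + q, (i * d + j) * D + k))"
      by (rule sum_lessThan_mult)
    also have "\<dots> = (\<Sum>p<d * d. \<Sum>q<D. if q = k then (if p = j * d + i then kron X M $$ (x, p * D + q) else 0) else 0)"
    proof (intro sum.cong refl)
      fix p q assume "p \<in> {..<d * d}" "q \<in> {..<D}"
      then have pq: "p < d * d" "q < D" by auto
      have ij: "i * d + j < d * d" using that by (intro mult_add_less)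
      have "kron (swapm d d) (1\<^sub>m D) $$ (p * D + q, (i * d + j) * D + k)
        = swapm d d $$ (p, i * d + j) * (1\<^sub>m D) $$ (q, k)"
        using kron_index_split[of p "swapm d d" q "1\<^sub>m D" "i * d + j" k] pq ij that by simp
      moreover have "swapm d d $$ (p, i * d + j) = (if p = j * d + i then 1 else 0)"
      proof -
        have "p div d = j \<and> p mod d = i \<longleftrightarrow> p = j * d + i" using that by auto
        then show ?thesis using pq ij that by (simp add: swapm_def)
      qed
      ultimately show "kron X M $$ (x, p * D + q) * kron (swapm d d) (1\<^sub>m D) $$ (p * D + q, (i * d + j) * D + k)
        = (if q = k then (if p = j * d + i then kron X M $$ (x, p * D + q) else 0) else 0)"
        using pq that by simp
    qed
    also have "\<dots> = kron X M $$ (x, (j * d + i) * D + k)"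
      using that mult_add_less[OF that(3,2)] by simp
    finally show ?thesis .
  qed
  have "mtrace ?Q
      = (\<Sum>x<d * d * D. ?Q $$ (x, x))"
    using X M by (simp add: mtrace_def mult.assoc)
  also have "\<dots> = (\<Sum>i<d. \<Sum>j<d. \<Sum>k<D. ?Q $$ ((i * d + j) * D + k, (i * d + j) * D + k))"
    by (simp only: sum_lessThan_mult)
  also have "\<dots> = (\<Sum>i<d. \<Sum>j<d. \<Sum>k<D. X $$ (i, j) * M $$ (j * D + k, i * D + k))"
  proof (intro sum.cong refl)
    fix i j k assume "i \<in> {..<d}" "j \<in> {..<d}" "k \<in> {..<D}"
    then have b: "i < d" "j < d" "k < D" by auto
    have l: "(i * d + j) * D + k < d * d * D" using b by (intro mult_add_less)
    have jk: "j * D + k < d * D" "i * D + k < d * D" using b by (auto intro: mult_add_less)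
    \<comment> \<open>Two bracketings of one index: the swap acts on the pair (i, j), whereas
      \<open>kron X M\<close> separates i from (j, k).\<close>
    have e: "(i * d + j) * D + k = i * (d * D) + (j * D + k)" "(j * d + i) * D + k = j * (d * D) + (i * D + k)"
      by (simp_all add: algebra_simps)
    have "?Q $$ ((i * d + j) * D + k, (i * d + j) * D + k)
      = kron X M $$ ((i * d + j) * D + k, (j * d + i) * D + k)" by (rule sw[OF l b])
    also have "\<dots> = kron X M $$ (i * (d * D) + (j * D + k), j * (d * D) + (i * D + k))" by (simp only: e)
    also have "\<dots> = X $$ (i, j) * M $$ (j * D + k, i * D + k)"
      using kron_index_split[of i X "j * D + k" M j "i * D + k"] X M b jk by simp
    finally show "?Q $$ ((i * d + j) * D + k, (i * d + j) * D + k)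
      = X $$ (i, j) * M $$ (j * D + k, i * D + k)" .
  qed
  also have "\<dots> = (\<Sum>i<d. \<Sum>j<d. \<Sum>k<D. \<Sum>l<d. \<Sum>q<D. V $$ (j * D + k, l * D + q) * (\<tau> $$ (l, i) * X $$ (i, j) * R $$ (q, k)))"
  proof (intro sum.cong refl)
    fix i j k assume "i \<in> {..<d}" "j \<in> {..<d}" "k \<in> {..<D}"
    then have b: "i < d" "j < d" "k < D" by auto
    show "X $$ (i, j) * M $$ (j * D + k, i * D + k)
      = (\<Sum>l<d. \<Sum>q<D. V $$ (j * D + k, l * D + q) * (\<tau> $$ (l, i) * X $$ (i, j) * R $$ (q, k)))"
      unfolding Mi[OF mult_add_less[OF b(2,3)] b(1,3)] by (simp add: sum_distrib_left mult_ac)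
  qed
  also have "\<dots> = (\<Sum>j<d. \<Sum>k<D. \<Sum>l<d. \<Sum>q<D. \<Sum>i<d. V $$ (j * D + k, l * D + q) * (\<tau> $$ (l, i) * X $$ (i, j) * R $$ (q, k)))"
    by (rule trans[OF sum.swap], rule sum.cong[OF refl], rule trans[OF sum.swap], rule sum.cong[OF refl],
        rule trans[OF sum.swap], rule sum.cong[OF refl], rule sum.swap)
  also have "\<dots> = (\<Sum>j<d. \<Sum>k<D. \<Sum>l<d. \<Sum>q<D. V $$ (j * D + k, l * D + q) * ((\<tau> * X) $$ (l, j) * R $$ (q, k)))"
    by (intro sum.cong refl) (simp add: index_mult_mat_sum[OF t X] sum_distrib_left sum_distrib_right)
  also have "\<dots> = (\<Sum>x<d * D. \<Sum>y<d * D. V $$ (x, y) * kron (\<tau> * X) R $$ (y, x))"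
  proof -
    have "kron (\<tau> * X) R $$ (l * D + q, j * D + k) = (\<tau> * X) $$ (l, j) * R $$ (q, k)"
      if "l < d" "q < D" "j < d" "k < D" for l q j k
      using kron_index_split[of l "\<tau> * X" q R j k] t X R that by auto
    then show ?thesis by (simp add: sum_lessThan_mult)
  qed
  also have "\<dots> = mtrace (V * kron (\<tau> * X) R)"
    by (rule mtrace_mult_sum[symmetric, OF V kron_carrier[OF mult_carrier_mat[OF t X] R]])
  finally show ?thesis unfolding M_def .
qed

(* V' acts on system, copy, rest as P (1 (x) V) (c P - i s) with P the swap of system and copy, so that
   tracing out the copy leaves V applied to (c - i s tau) X. *)
lemma circuit_step:
  fixes c s \<kappa> :: real
  assumes V: "V \<in> carrier_mat (d * D) (d * D)" "mat_adjoint V * V = of_real \<kappa> \<cdot>\<^sub>m 1\<^sub>m (d * D)"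
  obtains V' where "V' \<in> carrier_mat (d * (d * D)) (d * (d * D))"
    "mat_adjoint V' * V' = of_real (\<kappa> * (c\<^sup>2 + s\<^sup>2)) \<cdot>\<^sub>m 1\<^sub>m (d * (d * D))"
    "\<And>X \<tau> R. X \<in> carrier_mat d d \<Longrightarrow> \<tau> \<in> carrier_mat d d \<Longrightarrow> R \<in> carrier_mat D D \<Longrightarrow> mtrace \<tau> = 1 \<Longrightarrow>
      mtrace (V' * kron X (kron \<tau> R)) = mtrace (V * kron (of_real c \<cdot>\<^sub>m X + (- \<i> * of_real s) \<cdot>\<^sub>m (\<tau> * X)) R)"
proof -
  define N where "N = d * (d * D)"
  define P where "P = kron (swapm d d) (1\<^sub>m D)"
  define IV where "IV = kron (1\<^sub>m d) V"
  define W where "W = of_real c \<cdot>\<^sub>m P + (- \<i> * of_real s) \<cdot>\<^sub>m 1\<^sub>m N"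
  have dV: "dim_row V = d * D" "dim_col V = d * D" using V by auto
  have dims: "dim_row P = N" "dim_col P = N" "dim_row IV = N" "dim_col IV = N" "dim_row W = N" "dim_col W = N"
    by (auto simp: P_def IV_def W_def N_def dV mult.assoc)
  have P: "P \<in> carrier_mat N N" and IV: "IV \<in> carrier_mat N N" and Wc: "W \<in> carrier_mat N N"
    by (rule carrier_matI; simp add: dims)+
  have Pa: "mat_adjoint P = P" by (simp add: P_def kron_adjoint swapm_adjoint)
  have PP: "P * P = 1\<^sub>m N" by (simp add: P_def N_def kron_mult swapm_mult mult_one_dim kron_one mult.assoc)
  have IVIV: "mat_adjoint IV * IV = of_real \<kappa> \<cdot>\<^sub>m 1\<^sub>m N"
    by (simp add: IV_def kron_adjoint kron_mult dV V(2) mult_one_dim kron_smult_right kron_one N_def)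
  define W' where "W' = of_real c \<cdot>\<^sub>m P + (\<i> * of_real s) \<cdot>\<^sub>m 1\<^sub>m N"
  have W'c: "W' \<in> carrier_mat N N" using P by (simp add: W'_def)
  have Wa: "mat_adjoint W = W'"
  proof -
    have "mat_adjoint W = mat_adjoint (of_real c \<cdot>\<^sub>m P) + mat_adjoint ((- \<i> * of_real s) \<cdot>\<^sub>m 1\<^sub>m N)"
      unfolding W_def by (rule mat_adjoint_add[of _ N N]) (use P in auto)
    then show ?thesis by (simp only: mat_adjoint_smult Pa mat_adjoint_one W'_def) simp
  qed
  \<comment> \<open>As P is a self-adjoint involution, the cross terms of (c P + i s)(c P - i s)
    cancel.\<close>
  have WW: "W' * W = of_real (c\<^sup>2 + s\<^sup>2) \<cdot>\<^sub>m 1\<^sub>m N"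
  proof -
    have eq: "W' * W = of_real c \<cdot>\<^sub>m (of_real c \<cdot>\<^sub>m 1\<^sub>m N + (\<i> * of_real s) \<cdot>\<^sub>m P)
      + (- \<i> * of_real s) \<cdot>\<^sub>m (of_real c \<cdot>\<^sub>m P + (\<i> * of_real s) \<cdot>\<^sub>m 1\<^sub>m N)"
      unfolding W'_def W_def
      by (simp add: add_mult_dim mult_add_dim smult_mult_dim mult_smult_dim mult_one_dim dims PP)
    show ?thesis unfolding eq
      by (rule eq_matI) (use P in \<open>auto simp: algebra_simps power2_eq_square\<close>)
  qed
  define V' where "V' = P * (IV * W)"
  have V'c: "V' \<in> carrier_mat N N" by (rule carrier_matI) (auto simp: V'_def dims)
  have iso: "mat_adjoint V' * V' = of_real (\<kappa> * (c\<^sup>2 + s\<^sup>2)) \<cdot>\<^sub>m 1\<^sub>m N"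
  proof -
    have "mat_adjoint V' * V' = W' * ((mat_adjoint IV * IV) * W)"
      by (simp add: V'_def adjoint_mult_dim dims Pa Wa mult_assoc_dim mult_cancel_left_dim[OF PP]
          W'c[THEN carrier_matD(2)])
    also have "\<dots> = of_real \<kappa> \<cdot>\<^sub>m (W' * W)"
      using W'c by (simp add: IVIV mult_smult_dim smult_mult_dim mult_one_dim dims)
    finally show ?thesis by (simp add: WW smult_smult_mat)
  qed
  have tr: "mtrace (V' * kron X (kron \<tau> R)) = mtrace (V * kron (of_real c \<cdot>\<^sub>m X + (- \<i> * of_real s) \<cdot>\<^sub>m (\<tau> * X)) R)"
    if X: "X \<in> carrier_mat d d" and t: "\<tau> \<in> carrier_mat d d" and R: "R \<in> carrier_mat D D" and t1: "mtrace \<tau> = 1"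
    for X \<tau> R
  proof -
    define Z where "Z = kron X (kron \<tau> R)"
    have Z: "Z \<in> carrier_mat N N" unfolding Z_def N_def by (intro kron_carrier X t R)
    have dZ: "dim_row Z = N" "dim_col Z = N" using Z by auto
    have dX: "dim_row X = d" "dim_col X = d" "dim_row \<tau> = d" "dim_col \<tau> = d" "dim_row R = D" "dim_col R = D"
      using X t R by auto
    have ZP: "Z * P = P * kron \<tau> (kron X R)"
    proof -
      have "Z * P = kron (kron X \<tau>) R * kron (swapm d d) (1\<^sub>m D)" by (simp add: Z_def P_def kron_assoc)
      also have "\<dots> = kron (swapm d d * kron \<tau> X) R"
        by (simp add: kron_mult dX mult_one_dim swapm_kron[OF t X])
      also have "\<dots> = P * kron (kron \<tau> X) R" by (simp add: P_def kron_mult dX mult_one_dim)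
      finally show ?thesis by (simp add: kron_assoc)
    qed
    have c1: "IV * Z * P \<in> carrier_mat N N" "IV * kron \<tau> (kron X R) \<in> carrier_mat N N"
      by (rule carrier_matI; simp add: dims dX N_def)+
    \<comment> \<open>The c-term contains two swaps. Moving one around the trace exchanges system
      and copy, and the swaps cancel; the copy factors off with trace 1.\<close>
    have A: "mtrace (P * (IV * (P * Z))) = mtrace (V * kron X R)"
    proof -
      have "mtrace (P * (IV * (P * Z))) = mtrace ((IV * (P * Z)) * P)"
        by (rule mtrace_mult_comm[OF P, of _]) (rule carrier_matI; simp add: dims dZ)
      also have "(IV * (P * Z)) * P = IV * (P * (P * kron \<tau> (kron X R)))"
        by (simp add: mult_assoc_dim dims dZ ZP)
      also have "\<dots> = IV * kron \<tau> (kron X R)"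
        by (simp add: mult_cancel_left_dim[OF PP] dims dX N_def)
      also have "\<dots> = kron \<tau> (V * kron X R)" by (simp add: IV_def kron_mult dX dV mult_one_dim)
      also have "mtrace \<dots> = mtrace \<tau> * mtrace (V * kron X R)"
        by (rule mtrace_kron[OF t]) (rule mult_carrier_mat[OF V(1) kron_carrier[OF X R]])
      finally show ?thesis by (simp add: t1)
    qed
    \<comment> \<open>The s-term contains a single swap, which multiplies the system operator by the
      copy.\<close>
    have B: "mtrace (P * (IV * Z)) = mtrace (V * kron (\<tau> * X) R)"
    proof -
      have "mtrace (P * (IV * Z)) = mtrace ((IV * Z) * P)"
        by (rule mtrace_mult_comm[OF P, of _]) (rule carrier_matI; simp add: dims dZ)
      also have "(IV * Z) * P = kron X (V * kron \<tau> R) * kron (swapm d d) (1\<^sub>m D)"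
        by (simp add: IV_def Z_def P_def kron_mult dX dV mult_one_dim)
      also have "mtrace \<dots> = mtrace (V * kron (\<tau> * X) R)" by (rule mtrace_kron_swap[OF X t R V(1)])
      finally show ?thesis .
    qed
    have c2: "P * (IV * (P * Z)) \<in> carrier_mat N N" "P * (IV * Z) \<in> carrier_mat N N"
      "IV * (P * Z) \<in> carrier_mat N N" "IV * Z \<in> carrier_mat N N" "P * Z \<in> carrier_mat N N"
      by (rule carrier_matI; simp add: dims dZ)+
    have "W * Z = of_real c \<cdot>\<^sub>m (P * Z) + (- \<i> * of_real s) \<cdot>\<^sub>m Z"
      by (simp add: W_def add_mult_dim smult_mult_dim mult_one_dim dims dZ)
    then have "V' * Z = P * (IV * (of_real c \<cdot>\<^sub>m (P * Z) + (- \<i> * of_real s) \<cdot>\<^sub>m Z))"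
      by (simp add: V'_def mult_assoc_dim dims dZ)
    also have "IV * (of_real c \<cdot>\<^sub>m (P * Z) + (- \<i> * of_real s) \<cdot>\<^sub>m Z)
        = of_real c \<cdot>\<^sub>m (IV * (P * Z)) + (- \<i> * of_real s) \<cdot>\<^sub>m (IV * Z)"
      by (simp add: mult_add_dim mult_smult_dim dims dZ)
    also have "P * \<dots> = of_real c \<cdot>\<^sub>m (P * (IV * (P * Z))) + (- \<i> * of_real s) \<cdot>\<^sub>m (P * (IV * Z))"
      by (simp add: mult_add_dim mult_smult_dim dims dZ)
    finally have "mtrace (V' * Z) = of_real c * mtrace (P * (IV * (P * Z))) + (- \<i> * of_real s) * mtrace (P * (IV * Z))"
      using c2 by (simp add: mtrace_add[of _ N] mtrace_smult[of _ N])
    also have "\<dots> = of_real c * mtrace (V * kron X R) + (- \<i> * of_real s) * mtrace (V * kron (\<tau> * X) R)"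
      by (simp only: A B)
    also have "\<dots> = mtrace (V * kron (of_real c \<cdot>\<^sub>m X + (- \<i> * of_real s) \<cdot>\<^sub>m (\<tau> * X)) R)"
    proof -
      define M where "M = d * D"
      have VM: "V \<in> carrier_mat M M" using V by (simp add: M_def)
      have k: "kron X R \<in> carrier_mat M M" "kron (\<tau> * X) R \<in> carrier_mat M M"
        unfolding M_def by (intro kron_carrier mult_carrier_mat[OF t X] X R)+
      have vk: "V * kron X R \<in> carrier_mat M M" "V * kron (\<tau> * X) R \<in> carrier_mat M M"
        by (rule mult_carrier_mat[OF VM], rule k)+
      have "kron (of_real c \<cdot>\<^sub>m X + (- \<i> * of_real s) \<cdot>\<^sub>m (\<tau> * X)) R
        = of_real c \<cdot>\<^sub>m kron X R + (- \<i> * of_real s) \<cdot>\<^sub>m kron (\<tau> * X) R"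
        by (simp add: kron_add_left kron_smult_left dX)
      then have "V * kron (of_real c \<cdot>\<^sub>m X + (- \<i> * of_real s) \<cdot>\<^sub>m (\<tau> * X)) R
        = of_real c \<cdot>\<^sub>m (V * kron X R) + (- \<i> * of_real s) \<cdot>\<^sub>m (V * kron (\<tau> * X) R)"
        by (simp add: mult_add_dim mult_smult_dim dX dV)
      then show ?thesis using vk by (simp add: mtrace_add[of _ M] mtrace_smult[of _ M])
    qed
    finally show ?thesis unfolding Z_def .
  qed
  show ?thesis by (rule that[of V', folded N_def]) (use V'c iso tr in auto)
qed

(* True stands for a copy of rho, False for a copy of sigma. *)
fun wordst :: "complex mat \<Rightarrow> complex mat \<Rightarrow> bool list \<Rightarrow> complex mat" where
  "wordst \<rho> \<sigma> [] = 1\<^sub>m 1"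
| "wordst \<rho> \<sigma> (b # w) = kron (if b then \<rho> else \<sigma>) (wordst \<rho> \<sigma> w)"

lemma wordst_carrier:
  assumes "\<rho> \<in> carrier_mat d d" "\<sigma> \<in> carrier_mat d d"
  shows "wordst \<rho> \<sigma> w \<in> carrier_mat (d ^ length w) (d ^ length w)"
  by (rule carrier_matI; induction w) (use assms in auto)

lemma wordst_append: "wordst \<rho> \<sigma> (v @ w) = kron (wordst \<rho> \<sigma> v) (wordst \<rho> \<sigma> w)"
  by (induction v) (simp_all only: append.simps wordst.simps kron_one_left kron_assoc)

lemma mtrace_wordst:
  assumes "\<rho> \<in> carrier_mat d d" "\<sigma> \<in> carrier_mat d d" "mtrace \<rho> = 1" "mtrace \<sigma> = 1"
  shows "mtrace (wordst \<rho> \<sigma> w) = 1"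
proof (induction w)
  case (Cons b w)
  then show ?case
    using mtrace_kron[OF _ wordst_carrier[OF assms(1,2)], of "if b then \<rho> else \<sigma>" d w] assms by simp
qed (simp add: mtrace_def)

lemma wordst_adjoint:
  assumes "hermitian \<rho>" "hermitian \<sigma>"
  shows "mat_adjoint (wordst \<rho> \<sigma> w) = wordst \<rho> \<sigma> w"
  by (induction w) (use assms in \<open>auto simp: kron_adjoint hermitian_def\<close>)

text \<open>The effect on the system operator of a sequence of steps: an entry (b, c, s) multiplies
  from the left by c - i s times the chosen state, and the head of the list acts first.\<close>

fun circ :: "complex mat \<Rightarrow> complex mat \<Rightarrow> (bool \<times> real \<times> real) list \<Rightarrow> complex mat \<Rightarrow> complex mat" where
  "circ \<rho> \<sigma> [] X = X"
| "circ \<rho> \<sigma> ((b, c, s) # l) X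
    = circ \<rho> \<sigma> l (of_real c \<cdot>\<^sub>m X + (- \<i> * of_real s) \<cdot>\<^sub>m ((if b then \<rho> else \<sigma>) * X))"

text \<open>\<open>V\<close> is a scaled isometry: recording V^* V as an exact multiple of the
  identity makes the contraction property multiplicative along the circuit. The trace identity is
  required for every \<open>X\<close>, since the induction feeds in partially processed
  operators.\<close>

definition realizes :: "nat \<Rightarrow> (bool \<times> real \<times> real) list \<Rightarrow> complex mat \<Rightarrow> real \<Rightarrow> bool" where
  "realizes d l V \<kappa> \<longleftrightarrow> V \<in> carrier_mat (d ^ Suc (length l)) (d ^ Suc (length l)) \<and> 0 \<le> \<kappa> \<and> \<kappa> \<le> 1 \<and>
    mat_adjoint V * V = of_real \<kappa> \<cdot>\<^sub>m 1\<^sub>m (d ^ Suc (length l)) \<and>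
    (\<forall>\<rho> \<sigma> X. \<rho> \<in> carrier_mat d d \<longrightarrow> \<sigma> \<in> carrier_mat d d \<longrightarrow> mtrace \<rho> = 1 \<longrightarrow> mtrace \<sigma> = 1 \<longrightarrow>
      X \<in> carrier_mat d d \<longrightarrow>
      mtrace (V * kron X (wordst \<rho> \<sigma> (map fst l))) = mtrace (circ \<rho> \<sigma> l X))"

lemma realizesD:
  assumes "realizes d l V \<kappa>"
  shows "V \<in> carrier_mat (d ^ Suc (length l)) (d ^ Suc (length l))" "0 \<le> \<kappa>" "\<kappa> \<le> 1"
    "mat_adjoint V * V = of_real \<kappa> \<cdot>\<^sub>m 1\<^sub>m (d ^ Suc (length l))"
    "\<rho> \<in> carrier_mat d d \<Longrightarrow> \<sigma> \<in> carrier_mat d d \<Longrightarrow> mtrace \<rho> = 1 \<Longrightarrow> mtrace \<sigma> = 1 \<Longrightarrow>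
      X \<in> carrier_mat d d \<Longrightarrow>
      mtrace (V * kron X (wordst \<rho> \<sigma> (map fst l))) = mtrace (circ \<rho> \<sigma> l X)"
  using assms unfolding realizes_def by blast+

lemma circuit_exists:
  assumes "\<And>b c s. (b, c, s) \<in> set l \<Longrightarrow> c\<^sup>2 + s\<^sup>2 \<le> 1"
  shows "\<exists>V \<kappa>. realizes d l V \<kappa>"
  using assms
proof (induction l)
  case Nil
  have "mat_adjoint (1\<^sub>m d) * 1\<^sub>m d = (of_real 1 :: complex) \<cdot>\<^sub>m 1\<^sub>m d"
    by (rule eq_matI) auto
  then have "realizes d [] (1\<^sub>m d) 1"
    unfolding realizes_def list.map wordst.simps kron_one_right circ.simps by auto
  then show ?case by blast
next
  case (Cons a l)
  obtain b c s where a: "a = (b, c, s)" by (cases a)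
  have cs: "c\<^sup>2 + s\<^sup>2 \<le> 1" using Cons.prems[of b c s] by (simp add: a)
  have "\<exists>V \<kappa>. realizes d l V \<kappa>" by (rule Cons.IH) (use Cons.prems in auto)
  then obtain V \<kappa> where r: "realizes d l V \<kappa>" by blast
  note k = realizesD(2,3)[OF r] and tr = realizesD(5)[OF r]
  note V = realizesD(1,4)[OF r, unfolded power_Suc]
  obtain V' where V': "V' \<in> carrier_mat (d * (d * d ^ length l)) (d * (d * d ^ length l))"
    "mat_adjoint V' * V' = of_real (\<kappa> * (c\<^sup>2 + s\<^sup>2)) \<cdot>\<^sub>m 1\<^sub>m (d * (d * d ^ length l))"
    and step: "\<And>X \<tau> R. X \<in> carrier_mat d d \<Longrightarrow> \<tau> \<in> carrier_mat d d \<Longrightarrow>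
      R \<in> carrier_mat (d ^ length l) (d ^ length l) \<Longrightarrow> mtrace \<tau> = 1 \<Longrightarrow>
      mtrace (V' * kron X (kron \<tau> R)) = mtrace (V * kron (of_real c \<cdot>\<^sub>m X + (- \<i> * of_real s) \<cdot>\<^sub>m (\<tau> * X)) R)"
    by (rule circuit_step[OF V, of c s]) (rule that)
  have "realizes d (a # l) V' (\<kappa> * (c\<^sup>2 + s\<^sup>2))"
    unfolding realizes_def
  proof (intro conjI allI impI)
    show "V' \<in> carrier_mat (d ^ Suc (length (a # l))) (d ^ Suc (length (a # l)))"
      using V'(1) by simp
    show "mat_adjoint V' * V' = of_real (\<kappa> * (c\<^sup>2 + s\<^sup>2)) \<cdot>\<^sub>m 1\<^sub>m (d ^ Suc (length (a # l)))"
      using V'(2) by simp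
    show "0 \<le> \<kappa> * (c\<^sup>2 + s\<^sup>2)" using k by simp
    show "\<kappa> * (c\<^sup>2 + s\<^sup>2) \<le> 1" using k cs by (intro mult_le_one) auto
    fix \<rho> \<sigma> X :: "complex mat"
    assume r: "\<rho> \<in> carrier_mat d d" "\<sigma> \<in> carrier_mat d d" "mtrace \<rho> = 1" "mtrace \<sigma> = 1" and X: "X \<in> carrier_mat d d"
    define t where "t = (if b then \<rho> else \<sigma>)"
    have t: "t \<in> carrier_mat d d" "mtrace t = 1" using r by (auto simp: t_def)
    have "mtrace (V' * kron X (wordst \<rho> \<sigma> (map fst (a # l)))) = mtrace (V' * kron X (kron t (wordst \<rho> \<sigma> (map fst l))))"
      by (simp add: a t_def)
    also have "\<dots> = mtrace (V * kron (of_real c \<cdot>\<^sub>m X + (- \<i> * of_real s) \<cdot>\<^sub>m (t * X)) (wordst \<rho> \<sigma> (map fst l)))"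
      using wordst_carrier[OF r(1,2), of "map fst l"] by (intro step[OF X t(1) _ t(2)]) simp
    also have "\<dots> = mtrace (circ \<rho> \<sigma> l (of_real c \<cdot>\<^sub>m X + (- \<i> * of_real s) \<cdot>\<^sub>m (t * X)))"
      by (rule tr[OF r]) (use X mult_carrier_mat[OF t(1) X] in auto)
    finally show "mtrace (V' * kron X (wordst \<rho> \<sigma> (map fst (a # l)))) = mtrace (circ \<rho> \<sigma> (a # l) X)"
      by (simp add: a t_def)
  qed
  then show ?case by blast
qed

section \<open>Observables with bounded quadratic form\<close>

definition qform :: "complex mat \<Rightarrow> complex vec \<Rightarrow> complex" where
  "qform A v = (A *\<^sub>v v) \<bullet>c v"

lemma qform_sum:
  assumes "A \<in> carrier_mat n n" "v \<in> carrier_vec n"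
  shows "qform A v = (\<Sum>i<n. \<Sum>j<n. A $$ (i, j) * v $ j * cnj (v $ i))"
  unfolding qform_def cscalar_prod_sum[OF assms(2)]
  by (rule sum.cong[OF refl], subst mult_mat_vec_sum[OF assms]) (auto simp: sum_distrib_right)

lemma qform_add:
  assumes "A \<in> carrier_mat n n" "B \<in> carrier_mat n n" "v \<in> carrier_vec n"
  shows "qform (A + B) v = qform A v + qform B v"
  using assms by (simp add: qform_sum[of _ n] sum.distrib algebra_simps)

lemma qform_smult:
  assumes "A \<in> carrier_mat n n" "v \<in> carrier_vec n"
  shows "qform (c \<cdot>\<^sub>m A) v = c * qform A v"
  using assms by (simp add: qform_sum[of _ n] sum_distrib_left algebra_simps)

lemma qform_adjoint:
  assumes "A \<in> carrier_mat n n" "v \<in> carrier_vec n"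
  shows "qform (mat_adjoint A) v = cnj (qform A v)"
proof -
  have "qform (mat_adjoint A) v = (\<Sum>i<n. \<Sum>j<n. cnj (A $$ (j, i)) * v $ j * cnj (v $ i))"
    using assms by (simp add: qform_sum[of _ n])
  also have "\<dots> = (\<Sum>i<n. \<Sum>j<n. cnj (A $$ (i, j)) * v $ i * cnj (v $ j))"
    by (rule sum.swap)
  also have "\<dots> = cnj (qform A v)"
    using assms by (simp add: qform_sum[of _ n] mult_ac)
  finally show ?thesis .
qed

lemma qform_one: "v \<in> carrier_vec n \<Longrightarrow> qform (1\<^sub>m n) v = of_real (Re (v \<bullet>c v))"
  by (simp add: qform_def cscalar_prod_self)

text \<open>Cauchy-Schwarz in its arithmetic-geometric form: |y_i v_i| <= (|y_i|^2 + |v_i|^2)/2 for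
  y = V v, where |y|^2 = kappa |v|^2 <= |v|^2.\<close>

lemma norm_qform_contraction:
  assumes V: "V \<in> carrier_mat n n" "mat_adjoint V * V = of_real \<kappa> \<cdot>\<^sub>m 1\<^sub>m n" and k: "\<kappa> \<le> 1"
    and v: "v \<in> carrier_vec n"
  shows "norm (qform V v) \<le> Re (v \<bullet>c v)"
proof -
  define y where "y = V *\<^sub>v v"
  have y: "y \<in> carrier_vec n" unfolding y_def by (rule mult_mat_vec_carrier[OF V(1) v])
  have "y \<bullet>c y = (mat_adjoint V *\<^sub>v y) \<bullet>c v"
    using cscalar_prod_adjoint[OF mat_adjoint_carrier[OF V(1)] y v] by (simp add: y_def)
  also have "mat_adjoint V *\<^sub>v y = (mat_adjoint V * V) *\<^sub>v v"
    unfolding y_def by (rule assoc_mult_mat_vec[symmetric, OF mat_adjoint_carrier[OF V(1)] V(1) v])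
  also have "\<dots> \<bullet>c v = qform (of_real \<kappa> \<cdot>\<^sub>m 1\<^sub>m n) v" by (simp only: V(2) qform_def)
  also have "\<dots> = of_real \<kappa> * of_real (Re (v \<bullet>c v))"
    by (simp only: qform_smult[OF one_carrier_mat v] qform_one[OF v])
  finally have yk: "Re (y \<bullet>c y) = \<kappa> * Re (v \<bullet>c v)" by simp
  have "norm (qform V v) \<le> (\<Sum>i<n. norm (y $ i * cnj (v $ i)))"
    unfolding qform_def y_def[symmetric] cscalar_prod_sum[OF v] by (rule norm_sum)
  also have "\<dots> \<le> (\<Sum>i<n. ((norm (y $ i))\<^sup>2 + (norm (v $ i))\<^sup>2) / 2)"
  proof (rule sum_mono)
    fix i
    have "0 \<le> (norm (y $ i) - norm (v $ i))\<^sup>2" by simp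
    then show "norm (y $ i * cnj (v $ i)) \<le> ((norm (y $ i))\<^sup>2 + (norm (v $ i))\<^sup>2) / 2"
      by (simp add: norm_mult power2_diff)
  qed
  also have "\<dots> = (Re (y \<bullet>c y) + Re (v \<bullet>c v)) / 2"
    by (simp add: cscalar_prod_self[OF y] cscalar_prod_self[OF v] sum_divide_distrib[symmetric] sum.distrib)
  also have "\<dots> \<le> Re (v \<bullet>c v)"
    using mult_right_mono[OF k cscalar_prod_self_nonneg[of v]] yk by simp
  finally show ?thesis .
qed

text \<open>\<open>A\<close> is not assumed hermitian and \<open>\<phi>\<close> may be complex.
  \<open>B\<close> bounds the numerical radius, which is subadditive and is all that is needed to
  rescale the hermitian part of \<open>A\<close> to an effect.\<close>

definition observable :: "nat \<Rightarrow> bool list \<Rightarrow> real \<Rightarrow> (complex mat \<Rightarrow> complex mat \<Rightarrow> complex) \<Rightarrow> bool" where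
  "observable d w B \<phi> \<longleftrightarrow> (\<exists>A \<in> carrier_mat (d ^ length w) (d ^ length w).
     (\<forall>v \<in> carrier_vec (d ^ length w). norm (qform A v) \<le> B * Re (v \<bullet>c v)) \<and>
     (\<forall>\<rho> \<sigma>. density d \<rho> \<longrightarrow> density d \<sigma> \<longrightarrow> mtrace (A * wordst \<rho> \<sigma> w) = \<phi> \<rho> \<sigma>))"

lemma densityD:
  assumes "density d \<rho>"
  shows "\<rho> \<in> carrier_mat d d" "hermitian \<rho>" "mtrace \<rho> = 1" "psd d \<rho>"
  using assms by (auto simp: density_def psd_def)

text \<open>The system register starts as a copy of rho, which accounts for the leading
  \<open>True\<close> and for the extra factor rho in the trace.\<close>

lemma observable_circuit:
  assumes "\<And>b c s. (b, c, s) \<in> set l \<Longrightarrow> c\<^sup>2 + s\<^sup>2 \<le> 1"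
  shows "observable d (True # map fst l) 1 (\<lambda>\<rho> \<sigma>. mtrace (circ \<rho> \<sigma> l \<rho>))"
proof -
  have "\<exists>V \<kappa>. realizes d l V \<kappa>" by (rule circuit_exists) (use assms in auto)
  then obtain V \<kappa> where r: "realizes d l V \<kappa>" by blast
  note V = realizesD[OF r]
  show ?thesis unfolding observable_def
  proof (intro bexI[of _ V] conjI ballI allI impI)
    show "V \<in> carrier_mat (d ^ length (True # map fst l)) (d ^ length (True # map fst l))" using V(1) by simp
    fix v :: "complex vec" assume "v \<in> carrier_vec (d ^ length (True # map fst l))"
    then show "norm (qform V v) \<le> 1 * Re (v \<bullet>c v)"
      using norm_qform_contraction[OF V(1,4,3)] by simp
  next
    fix \<rho> \<sigma> assume "density d \<rho>" "density d \<sigma>"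
    then show "mtrace (V * wordst \<rho> \<sigma> (True # map fst l)) = mtrace (circ \<rho> \<sigma> l \<rho>)"
      using V(5)[of \<rho> \<sigma> \<rho>] densityD by auto
  qed
qed

lemma observable_smult:
  assumes "observable d w B \<phi>"
  shows "observable d w (norm c * B) (\<lambda>\<rho> \<sigma>. c * \<phi> \<rho> \<sigma>)"
proof -
  let ?N = "d ^ length w"
  from assms obtain A where A: "A \<in> carrier_mat ?N ?N"
    "\<And>v. v \<in> carrier_vec ?N \<Longrightarrow> norm (qform A v) \<le> B * Re (v \<bullet>c v)"
    "\<And>\<rho> \<sigma>. density d \<rho> \<Longrightarrow> density d \<sigma> \<Longrightarrow> mtrace (A * wordst \<rho> \<sigma> w) = \<phi> \<rho> \<sigma>"
    by (auto simp: observable_def)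
  show ?thesis unfolding observable_def
  proof (intro bexI[of _ "c \<cdot>\<^sub>m A"] conjI ballI allI impI)
    show "c \<cdot>\<^sub>m A \<in> carrier_mat ?N ?N" using A by simp
    fix v :: "complex vec" assume v: "v \<in> carrier_vec ?N"
    show "norm (qform (c \<cdot>\<^sub>m A) v) \<le> norm c * B * Re (v \<bullet>c v)"
      using mult_left_mono[OF A(2)[OF v] norm_ge_zero[of c]]
      by (simp add: qform_smult[OF A(1) v] norm_mult mult.assoc)
  next
    fix \<rho> \<sigma> assume r: "density d \<rho>" "density d \<sigma>"
    have w: "wordst \<rho> \<sigma> w \<in> carrier_mat ?N ?N" using wordst_carrier densityD(1) r by blast
    show "mtrace ((c \<cdot>\<^sub>m A) * wordst \<rho> \<sigma> w) = c * \<phi> \<rho> \<sigma>"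
      using A(1) w by (simp add: smult_mult_dim mtrace_smult[OF mult_carrier_mat[OF A(1) w]] A(3)[OF r])
  qed
qed

lemma observable_add:
  assumes "observable d w B \<phi>" "observable d w B' \<phi>'"
  shows "observable d w (B + B') (\<lambda>\<rho> \<sigma>. \<phi> \<rho> \<sigma> + \<phi>' \<rho> \<sigma>)"
proof -
  let ?N = "d ^ length w"
  from assms(1) obtain A where A: "A \<in> carrier_mat ?N ?N"
    "\<And>v. v \<in> carrier_vec ?N \<Longrightarrow> norm (qform A v) \<le> B * Re (v \<bullet>c v)"
    "\<And>\<rho> \<sigma>. density d \<rho> \<Longrightarrow> density d \<sigma> \<Longrightarrow> mtrace (A * wordst \<rho> \<sigma> w) = \<phi> \<rho> \<sigma>"
    by (auto simp: observable_def)
  from assms(2) obtain A' where A': "A' \<in> carrier_mat ?N ?N"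
    "\<And>v. v \<in> carrier_vec ?N \<Longrightarrow> norm (qform A' v) \<le> B' * Re (v \<bullet>c v)"
    "\<And>\<rho> \<sigma>. density d \<rho> \<Longrightarrow> density d \<sigma> \<Longrightarrow> mtrace (A' * wordst \<rho> \<sigma> w) = \<phi>' \<rho> \<sigma>"
    by (auto simp: observable_def)
  show ?thesis unfolding observable_def
  proof (intro bexI[of _ "A + A'"] conjI ballI allI impI)
    show "A + A' \<in> carrier_mat ?N ?N" using A A' by simp
    fix v :: "complex vec" assume v: "v \<in> carrier_vec ?N"
    show "norm (qform (A + A') v) \<le> (B + B') * Re (v \<bullet>c v)"
      using norm_triangle_ineq[of "qform A v" "qform A' v"] A(2)[OF v] A'(2)[OF v]
      by (simp add: qform_add[OF A(1) A'(1) v] algebra_simps)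
  next
    fix \<rho> \<sigma> assume r: "density d \<rho>" "density d \<sigma>"
    have w: "wordst \<rho> \<sigma> w \<in> carrier_mat ?N ?N" using wordst_carrier densityD(1) r by blast
    show "mtrace ((A + A') * wordst \<rho> \<sigma> w) = \<phi> \<rho> \<sigma> + \<phi>' \<rho> \<sigma>"
      using A(1) A'(1) w
      by (simp add: add_mult_dim mtrace_add[OF mult_carrier_mat[OF A(1) w] mult_carrier_mat[OF A'(1) w]] A(3)[OF r] A'(3)[OF r])
  qed
qed

lemma observable_zero: "observable d w 0 (\<lambda>_ _. 0)"
  unfolding observable_def
proof (intro bexI[of _ "0\<^sub>m (d ^ length w) (d ^ length w)"] conjI ballI allI impI)
  fix \<rho> \<sigma> assume r: "density d \<rho>" "density d \<sigma>"
  have "wordst \<rho> \<sigma> w \<in> carrier_mat (d ^ length w) (d ^ length w)" using wordst_carrier densityD(1) r by blast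
  then show "mtrace (0\<^sub>m (d ^ length w) (d ^ length w) * wordst \<rho> \<sigma> w) = 0"
    by (simp add: mtrace_def)
qed (auto simp: qform_sum[of _ "d ^ length w"])

lemma observable_sum:
  assumes "finite I" "\<And>i. i \<in> I \<Longrightarrow> observable d w (B i) (\<phi> i)"
  shows "observable d w (\<Sum>i\<in>I. B i) (\<lambda>\<rho> \<sigma>. \<Sum>i\<in>I. \<phi> i \<rho> \<sigma>)"
  using assms by (induction I) (auto intro: observable_zero observable_add)

lemma psd_iff_qform:
  "psd n A \<longleftrightarrow> A \<in> carrier_mat n n \<and> mat_adjoint A = A \<and> (\<forall>v \<in> carrier_vec n. 0 \<le> Re (qform A v))"
  by (simp add: psd_def hermitian_def qform_def)

lemma psd_add: "psd n A \<Longrightarrow> psd n B \<Longrightarrow> psd n (A + B)"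
  by (auto simp: psd_iff_qform mat_adjoint_add[of _ n n] qform_add[of _ n])

lemma psd_smult: "psd n A \<Longrightarrow> 0 \<le> c \<Longrightarrow> psd n (of_real c \<cdot>\<^sub>m A)"
  by (auto simp: psd_iff_qform mat_adjoint_smult qform_smult[of _ n])

lemma effect_of_observable:
  assumes "observable d w B \<phi>" "B > 0"
  obtains E where "psd (d ^ length w) E" "psd (d ^ length w) (1\<^sub>m (d ^ length w) - E)"
    "\<And>\<rho> \<sigma>. density d \<rho> \<Longrightarrow> density d \<sigma> \<Longrightarrow> mtrace (E * wordst \<rho> \<sigma> w) = of_real ((1 + Re (\<phi> \<rho> \<sigma>) / B) / 2)"
proof -
  define N where "N = d ^ length w"
  from assms(1) obtain A where A: "A \<in> carrier_mat N N"
    "\<And>v. v \<in> carrier_vec N \<Longrightarrow> norm (qform A v) \<le> B * Re (v \<bullet>c v)"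
    "\<And>\<rho> \<sigma>. density d \<rho> \<Longrightarrow> density d \<sigma> \<Longrightarrow> mtrace (A * wordst \<rho> \<sigma> w) = \<phi> \<rho> \<sigma>"
    by (auto simp: observable_def N_def)
  (* t = 1/(4B) gives E and t = -1/(4B) gives 1 - E. *)
  have psd_half: "psd N (of_real (1 / 2) \<cdot>\<^sub>m 1\<^sub>m N + of_real t \<cdot>\<^sub>m (A + mat_adjoint A))"
    if t: "\<bar>t\<bar> = 1 / (4 * B)" for t :: real
    unfolding psd_iff_qform
  proof (intro conjI ballI)
    have c: "of_real (1 / 2) \<cdot>\<^sub>m 1\<^sub>m N \<in> carrier_mat N N" "of_real t \<cdot>\<^sub>m (A + mat_adjoint A) \<in> carrier_mat N N"
      using A by auto
    show "of_real (1 / 2) \<cdot>\<^sub>m 1\<^sub>m N + of_real t \<cdot>\<^sub>m (A + mat_adjoint A) \<in> carrier_mat N N"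
      using c by auto
    have "mat_adjoint (A + mat_adjoint A) = A + mat_adjoint A"
      by (simp only: mat_adjoint_add[OF A(1) mat_adjoint_carrier[OF A(1)]] mat_adjoint_adjoint)
         (rule comm_add_mat[OF mat_adjoint_carrier[OF A(1)] A(1)])
    then show "mat_adjoint (of_real (1 / 2) \<cdot>\<^sub>m 1\<^sub>m N + of_real t \<cdot>\<^sub>m (A + mat_adjoint A))
      = of_real (1 / 2) \<cdot>\<^sub>m 1\<^sub>m N + of_real t \<cdot>\<^sub>m (A + mat_adjoint A)"
      by (simp only: mat_adjoint_add[OF c] mat_adjoint_smult mat_adjoint_one complex_cnj_complex_of_real)
    fix v :: "complex vec" assume v: "v \<in> carrier_vec N"
    have q: "qform (of_real (1 / 2) \<cdot>\<^sub>m 1\<^sub>m N + of_real t \<cdot>\<^sub>m (A + mat_adjoint A)) v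
      = of_real (1 / 2) * of_real (Re (v \<bullet>c v)) + of_real t * (qform A v + cnj (qform A v))"
      by (simp only: qform_add[OF c v] qform_smult[OF one_carrier_mat v] qform_one[OF v]
          qform_smult[OF add_carrier_mat[OF mat_adjoint_carrier[OF A(1)]] v]
          qform_add[OF A(1) mat_adjoint_carrier[OF A(1)] v] qform_adjoint[OF A(1) v])
    have "\<bar>Re (qform A v)\<bar> \<le> B * Re (v \<bullet>c v)" using abs_Re_le_cmod[of "qform A v"] A(2)[OF v] by linarith
    then have "\<bar>t\<bar> * \<bar>Re (qform A v)\<bar> \<le> 1 / (4 * B) * (B * Re (v \<bullet>c v))"
      unfolding t by (rule mult_left_mono) (use assms(2) in simp)
    then have "\<bar>t * Re (qform A v)\<bar> \<le> Re (v \<bullet>c v) / 4" using assms(2) by (simp add: abs_mult)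
    then show "0 \<le> Re (qform (of_real (1 / 2) \<cdot>\<^sub>m 1\<^sub>m N + of_real t \<cdot>\<^sub>m (A + mat_adjoint A)) v)"
      unfolding q by simp
  qed
  define t where "t = 1 / (4 * B)"
  define E where "E = of_real (1 / 2) \<cdot>\<^sub>m 1\<^sub>m N + of_real t \<cdot>\<^sub>m (A + mat_adjoint A)"
  have "psd N E" unfolding E_def by (rule psd_half) (use assms(2) in \<open>simp add: t_def\<close>)
  moreover have "1\<^sub>m N - E = of_real (1 / 2) \<cdot>\<^sub>m 1\<^sub>m N + of_real (- t) \<cdot>\<^sub>m (A + mat_adjoint A)"
    by (rule eq_matI) (use A(1) in \<open>auto simp: E_def algebra_simps\<close>)
  moreover have "psd N (of_real (1 / 2) \<cdot>\<^sub>m 1\<^sub>m N + of_real (- t) \<cdot>\<^sub>m (A + mat_adjoint A))"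
    by (rule psd_half) (use assms(2) in \<open>simp add: t_def\<close>)
  moreover have "mtrace (E * wordst \<rho> \<sigma> w) = of_real ((1 + Re (\<phi> \<rho> \<sigma>) / B) / 2)"
    if r: "density d \<rho>" "density d \<sigma>" for \<rho> \<sigma>
  proof -
    define R where "R = wordst \<rho> \<sigma> w"
    have R: "R \<in> carrier_mat N N" using wordst_carrier densityD(1) r unfolding R_def N_def by blast
    have dR: "dim_row R = N" "dim_col R = N" "dim_row A = N" "dim_col A = N" using R A by auto
    have Ra: "mat_adjoint R = R" unfolding R_def by (rule wordst_adjoint) (use densityD(2) r in auto)
    have R1: "mtrace R = 1" unfolding R_def by (rule mtrace_wordst[of _ d]) (use densityD r in auto)
    have AR: "A * R \<in> carrier_mat N N" "mat_adjoint A * R \<in> carrier_mat N N" by (rule carrier_matI; simp add: dR)+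
    have "mtrace (mat_adjoint A * R) = mtrace (mat_adjoint (R * A))"
      by (simp add: adjoint_mult_dim dR Ra)
    also have "\<dots> = cnj (mtrace (R * A))" by (rule mtrace_adjoint) (rule carrier_matI; simp add: dR)
    also have "mtrace (R * A) = mtrace (A * R)" by (rule mtrace_mult_comm[OF R A(1)])
    finally have adj: "mtrace (mat_adjoint A * R) = cnj (\<phi> \<rho> \<sigma>)" using A(3)[OF r] by (simp add: R_def)
    have "E * R = of_real (1 / 2) \<cdot>\<^sub>m R + of_real t \<cdot>\<^sub>m (A * R + mat_adjoint A * R)"
      unfolding E_def by (simp only: add_mult_dim smult_mult_dim dR mult_one_dim index_smult_mat index_one_mat
          index_add_mat mat_adjoint_dim)
    then have "mtrace (E * R) = of_real (1 / 2) * mtrace R + of_real t * (mtrace (A * R) + mtrace (mat_adjoint A * R))"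
      using AR R by (simp only: mtrace_add[of _ N] mtrace_smult[of _ N] smult_carrier_mat add_carrier_mat)
    also have "\<dots> = of_real ((1 + Re (\<phi> \<rho> \<sigma>) / B) / 2)"
      using A(3)[OF r] assms(2) by (simp add: R1 adj R_def[symmetric] complex_eq_iff t_def field_simps)
    finally show ?thesis by (simp add: R_def)
  qed
  ultimately show ?thesis using that[of E] unfolding N_def by simp
qed

section \<open>Repetition and the final algorithm\<close>

(* Measure {E, 1 - E} on each of N blocks and accept with probability h (number of outcomes E). *)
fun repeff :: "nat \<Rightarrow> complex mat \<Rightarrow> nat \<Rightarrow> (nat \<Rightarrow> real) \<Rightarrow> complex mat" where
  "repeff n E 0 h = of_real (h 0) \<cdot>\<^sub>m 1\<^sub>m 1"
| "repeff n E (Suc N) h = kron E (repeff n E N (\<lambda>j. h (Suc j))) + kron (1\<^sub>m n - E) (repeff n E N h)"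

text \<open>The expectation of \<open>h\<close> under the binomial distribution with parameters
  \<open>N\<close> and \<open>p\<close>, by conditioning on the first trial. The recursion mirrors
  that of \<open>repeff\<close>.\<close>

fun binexp :: "real \<Rightarrow> nat \<Rightarrow> (nat \<Rightarrow> real) \<Rightarrow> real" where
  "binexp p 0 h = h 0"
| "binexp p (Suc N) h = p * binexp p N (\<lambda>j. h (Suc j)) + (1 - p) * binexp p N h"

lemma repeff_carrier:
  assumes "E \<in> carrier_mat n n"
  shows "repeff n E N h \<in> carrier_mat (n ^ N) (n ^ N)"
proof (induction N arbitrary: h)
  case (Suc N)
  show ?case
    using kron_carrier[OF assms Suc] kron_carrier[OF minus_carrier_mat[OF assms] Suc] by simp
qed simp

lemma psd_repeff:
  assumes "psd n E" "psd n (1\<^sub>m n - E)" "\<And>j. 0 \<le> h j"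
  shows "psd (n ^ N) (repeff n E N h)"
  using assms(3)
proof (induction N arbitrary: h)
  case 0
  then show ?case using psd_smult[OF psd_one, of "h 0" 1] by simp
next
  case (Suc N)
  then show ?case
    using psd_add[OF psd_kron[OF assms(1) Suc.IH] psd_kron[OF assms(2) Suc.IH]] by simp
qed

text \<open>Rejecting is accepting with probability 1 - h, so the complementary effect is again of
  the form \<open>repeff\<close>, and its positivity is another case of
  \<open>psd_repeff\<close>.\<close>

lemma repeff_add_complement:
  assumes "E \<in> carrier_mat n n"
  shows "repeff n E N h + repeff n E N (\<lambda>j. 1 - h j) = 1\<^sub>m (n ^ N)"
proof (induction N arbitrary: h)
  case 0
  show ?case by (rule eq_matI) auto
next
  case (Suc N)
  define A where "A = repeff n E N (\<lambda>j. h (Suc j))"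
  define A' where "A' = repeff n E N (\<lambda>j. 1 - h (Suc j))"
  define B where "B = repeff n E N h"
  define B' where "B' = repeff n E N (\<lambda>j. 1 - h j)"
  define F where "F = 1\<^sub>m n - E"
  have c: "A \<in> carrier_mat (n ^ N) (n ^ N)" "A' \<in> carrier_mat (n ^ N) (n ^ N)"
    "B \<in> carrier_mat (n ^ N) (n ^ N)" "B' \<in> carrier_mat (n ^ N) (n ^ N)" "F \<in> carrier_mat n n"
    using repeff_carrier[OF assms] minus_carrier_mat[OF assms] by (auto simp: A_def A'_def B_def B'_def F_def)
  have AA: "A + A' = 1\<^sub>m (n ^ N)" "B + B' = 1\<^sub>m (n ^ N)"
    using Suc[of "\<lambda>j. h (Suc j)"] Suc[of h] by (simp_all add: A_def A'_def B_def B'_def)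
  have k: "kron E A \<in> carrier_mat (n ^ Suc N) (n ^ Suc N)" "kron E A' \<in> carrier_mat (n ^ Suc N) (n ^ Suc N)"
    "kron F B \<in> carrier_mat (n ^ Suc N) (n ^ Suc N)" "kron F B' \<in> carrier_mat (n ^ Suc N) (n ^ Suc N)"
    unfolding power_Suc by (intro kron_carrier assms c)+
  have "repeff n E (Suc N) h + repeff n E (Suc N) (\<lambda>j. 1 - h j) = (kron E A + kron F B) + (kron E A' + kron F B')"
    by (simp add: A_def A'_def B_def B'_def F_def)
  also have "\<dots> = (kron E A + kron E A') + (kron F B + kron F B')"
    by (rule eq_matI) (use k in auto)
  also have "\<dots> = kron E (A + A') + kron F (B + B')"
    using c by (simp add: kron_add_right)
  also have "\<dots> = kron (E + F) (1\<^sub>m (n ^ N))"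
    using assms c by (simp add: AA kron_add_left)
  also have "E + F = 1\<^sub>m n" by (rule eq_matI) (use assms in \<open>auto simp: F_def\<close>)
  finally show ?case by (simp add: kron_one)
qed

text \<open>The blocks are in a product state, so traces factor, and splitting off the first block
  reproduces the recursion of \<open>binexp\<close>.\<close>

lemma mtrace_repeff:
  assumes E: "E \<in> carrier_mat n n" and R: "wordst \<rho> \<sigma> w \<in> carrier_mat n n"
    and p: "mtrace (E * wordst \<rho> \<sigma> w) = of_real p" and one: "mtrace (wordst \<rho> \<sigma> w) = 1"
    and carr: "\<And>N. wordst \<rho> \<sigma> (concat (replicate N w)) \<in> carrier_mat (n ^ N) (n ^ N)"
  shows "mtrace (repeff n E N h * wordst \<rho> \<sigma> (concat (replicate N w))) = of_real (binexp p N h)"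
proof (induction N arbitrary: h)
  case 0
  show ?case by (simp add: smult_mult_dim mtrace_def mult_one_dim)
next
  case (Suc N)
  define W where "W = wordst \<rho> \<sigma> w"
  define S where "S = wordst \<rho> \<sigma> (concat (replicate N w))"
  define A where "A = repeff n E N (\<lambda>j. h (Suc j))"
  define B where "B = repeff n E N h"
  define F where "F = 1\<^sub>m n - E"
  have c: "W \<in> carrier_mat n n" "S \<in> carrier_mat (n ^ N) (n ^ N)" "A \<in> carrier_mat (n ^ N) (n ^ N)"
    "B \<in> carrier_mat (n ^ N) (n ^ N)" "F \<in> carrier_mat n n"
    using R carr repeff_carrier[OF E] minus_carrier_mat[OF E] by (auto simp: W_def S_def A_def B_def F_def)
  have d: "dim_row W = n" "dim_col W = n" "dim_row S = n ^ N" "dim_col S = n ^ N" "dim_row A = n ^ N" "dim_col A = n ^ N"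
    "dim_row B = n ^ N" "dim_col B = n ^ N" "dim_row E = n" "dim_col E = n" "dim_row F = n" "dim_col F = n"
    using c E by auto
  have FW: "mtrace (F * W) = of_real (1 - p)"
  proof -
    have "F * W = W - E * W" unfolding F_def
      using minus_mult_distrib_mat[OF one_carrier_mat E c(1)] c(1) by simp
    then show ?thesis using mtrace_minus[OF c(1) mult_carrier_mat[OF E c(1)]] p one by (simp add: W_def)
  qed
  have "repeff n E (Suc N) h * wordst \<rho> \<sigma> (concat (replicate (Suc N) w)) = (kron E A + kron F B) * kron W S"
    by (simp add: A_def B_def F_def W_def S_def wordst_append)
  also have "\<dots> = kron (E * W) (A * S) + kron (F * W) (B * S)"
    by (simp add: add_mult_dim kron_mult d)
  finally have "mtrace (repeff n E (Suc N) h * wordst \<rho> \<sigma> (concat (replicate (Suc N) w)))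
    = mtrace (E * W) * mtrace (A * S) + mtrace (F * W) * mtrace (B * S)"
    using mtrace_add[OF kron_carrier[OF mult_carrier_mat[OF E c(1)] mult_carrier_mat[OF c(3,2)]]
        kron_carrier[OF mult_carrier_mat[OF c(5,1)] mult_carrier_mat[OF c(4,2)]]]
      mtrace_kron[OF mult_carrier_mat[OF E c(1)] mult_carrier_mat[OF c(3,2)]]
      mtrace_kron[OF mult_carrier_mat[OF c(5,1)] mult_carrier_mat[OF c(4,2)]]
    by simp
  then show ?case using Suc[of "\<lambda>j. h (Suc j)"] Suc[of h] FW p
    by (simp add: A_def B_def S_def W_def)
qed

section \<open>Moments and tails of the binomial expectation\<close>

lemma binexp_mono:
  assumes "0 \<le> p" "p \<le> 1" "\<And>j. h j \<le> g j"
  shows "binexp p N h \<le> binexp p N g"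
  using assms(3)
proof (induction N arbitrary: h g)
  case (Suc N)
  then show ?case using assms by (auto intro!: add_mono mult_left_mono)
qed simp

lemma binexp_complement: "binexp p N (\<lambda>j. 1 - h j) = 1 - binexp p N h"
proof (induction N arbitrary: h)
  case (Suc N)
  show ?case by (simp only: binexp.simps Suc) (simp add: algebra_simps)
qed simp

lemma binexp_cmult: "binexp p N (\<lambda>j. c * h j) = c * binexp p N h"
  by (induction N arbitrary: h) (simp_all add: algebra_simps)

text \<open>The centre \<open>a\<close> is arbitrary so that the induction closes: a success in the
  first trial replaces \<open>a\<close> by a - 1. Only the case a = N p, the variance, is used
  afterwards.\<close>

lemma binexp_second_moment:
  "binexp p N (\<lambda>j. (real j - a)\<^sup>2) = real N * (p * (1 - p)) + (real N * p - a)\<^sup>2"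
proof (induction N arbitrary: a)
  case (Suc N)
  have "binexp p (Suc N) (\<lambda>j. (real j - a)\<^sup>2)
    = p * binexp p N (\<lambda>j. (real j - (a - 1))\<^sup>2) + (1 - p) * binexp p N (\<lambda>j. (real j - a)\<^sup>2)"
    by (simp add: algebra_simps)
  also have "\<dots> = real (Suc N) * (p * (1 - p)) + (real (Suc N) * p - a)\<^sup>2"
    unfolding Suc by (simp add: power2_eq_square algebra_simps)
  finally show ?case .
qed simp

text \<open>\<open>h\<close> lies below the parabola (j - N p)^2 / (N delta)^2, whose expectation is
  at most 1/(4 N delta^2) because p (1 - p) <= 1/4; the assumption on \<open>N\<close> makes this at
  most 1/3.\<close>

lemma binexp_chebyshev:
  assumes p: "0 \<le> p" "p \<le> 1" and \<delta>: "0 < \<delta>" and N: "3 / (4 * \<delta>\<^sup>2) \<le> real N"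
    and h: "\<And>j. h j \<le> 1" "\<And>j. \<bar>real j - real N * p\<bar> < real N * \<delta> \<Longrightarrow> h j \<le> 0"
  shows "binexp p N h \<le> 1 / 3"
proof -
  have N0: "real N > 0"
  proof -
    have "0 < 3 / (4 * \<delta>\<^sup>2)" using \<delta> by simp
    then show ?thesis using N by linarith
  qed
  have ND: "real N * \<delta> > 0" using N0 \<delta> by simp
  have "h j \<le> (1 / (real N * \<delta>)\<^sup>2) * (real j - real N * p)\<^sup>2" for j
  proof (cases "\<bar>real j - real N * p\<bar> < real N * \<delta>")
    case True
    then show ?thesis using h(2)[of j] by (auto intro: order_trans)
  next
    case False
    then have "(real N * \<delta>)\<^sup>2 \<le> \<bar>real j - real N * p\<bar>\<^sup>2"
      using ND by (intro power_mono) auto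
    then have "(1 / (real N * \<delta>)\<^sup>2) * (real N * \<delta>)\<^sup>2 \<le> (1 / (real N * \<delta>)\<^sup>2) * (real j - real N * p)\<^sup>2"
      by (intro mult_left_mono) auto
    moreover have "(1 / (real N * \<delta>)\<^sup>2) * (real N * \<delta>)\<^sup>2 = 1"
      using ND less_imp_neq[OF ND] by simp
    ultimately have "1 \<le> (1 / (real N * \<delta>)\<^sup>2) * (real j - real N * p)\<^sup>2" by linarith
    then show ?thesis using h(1)[of j] by linarith
  qed
  then have "binexp p N h \<le> binexp p N (\<lambda>j. (1 / (real N * \<delta>)\<^sup>2) * (real j - real N * p)\<^sup>2)"
    by (intro binexp_mono p)
  also have "\<dots> = (1 / (real N * \<delta>)\<^sup>2) * (real N * (p * (1 - p)))"
    unfolding binexp_cmult binexp_second_moment by simp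
  also have "\<dots> \<le> (1 / (real N * \<delta>)\<^sup>2) * (real N * (1 / 4))"
  proof (intro mult_left_mono)
    have "0 \<le> (p - 1 / 2)\<^sup>2" by simp
    then show "p * (1 - p) \<le> 1 / 4" by (simp add: power2_eq_square algebra_simps)
  qed auto
  also have "\<dots> = 1 / (4 * (real N * \<delta>\<^sup>2))"
    using N0 \<delta> by (simp add: power2_eq_square field_simps)
  also have "\<dots> \<le> 1 / 3"
  proof -
    have "3 \<le> 4 * (real N * \<delta>\<^sup>2)" using N \<delta> by (simp add: divide_le_eq mult_ac)
    then show ?thesis by (intro divide_left_mono) auto
  qed
  finally show ?thesis .
qed

text \<open>A sample-access algorithm receives all copies of rho before those of sigma, whereas
  after repetition the word alternates between them. One unitary depending only on the word does the
  sorting for all pairs of matrices.\<close>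

lemma word_permutation:
  "\<exists>U. unitary (d ^ length w) U \<and> (\<forall>\<rho> \<sigma>. \<rho> \<in> carrier_mat d d \<longrightarrow> \<sigma> \<in> carrier_mat d d \<longrightarrow>
     U * wordst \<rho> \<sigma> w = kron (tpow \<rho> (count_list w True)) (tpow \<sigma> (count_list w False)) * U)"
proof (induction w)
  case Nil
  have "unitary 1 (1\<^sub>m 1)" by (simp add: unitary_def)
  then show ?case by (intro exI[of _ "1\<^sub>m 1"]) (auto simp: kron_one_left simp del: One_nat_def)
next
  case (Cons b w)
  have tp: "tpow \<rho> n \<in> carrier_mat (d ^ n) (d ^ n)" if "\<rho> \<in> carrier_mat d d" for \<rho> n
    by (induction n) (auto intro!: kron_carrier that)
  define k l where kl: "k = count_list w True" "l = count_list w False"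
  have len: "length w = k + l" unfolding kl by (induction w) auto
  from Cons obtain U where U: "unitary (d ^ length w) U"
    and e: "\<And>\<rho> \<sigma>. \<rho> \<in> carrier_mat d d \<Longrightarrow> \<sigma> \<in> carrier_mat d d \<Longrightarrow>
      U * wordst \<rho> \<sigma> w = kron (tpow \<rho> k) (tpow \<sigma> l) * U"
    unfolding kl by blast
  note dU = unitary_dim[OF U]
  define U1 where "U1 = kron (1\<^sub>m d) U"
  have U1: "unitary (d ^ length (b # w)) U1"
    unfolding unitary_def
  proof
    show "U1 \<in> carrier_mat (d ^ length (b # w)) (d ^ length (b # w))"
      by (rule carrier_matI) (simp_all add: U1_def dU)
    show "mat_adjoint U1 * U1 = 1\<^sub>m (d ^ length (b # w))"
      by (simp add: U1_def kron_adjoint kron_mult dU unitaryD(2)[OF U] mult_one_dim kron_one)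
  qed
  have U1e: "U1 * wordst \<rho> \<sigma> (b # w) = kron (if b then \<rho> else \<sigma>) (kron (tpow \<rho> k) (tpow \<sigma> l)) * U1"
    if r: "\<rho> \<in> carrier_mat d d" "\<sigma> \<in> carrier_mat d d" for \<rho> \<sigma>
  proof -
    have "dim_row (kron (tpow \<rho> k) (tpow \<sigma> l)) = d ^ length w" "dim_col (kron (tpow \<rho> k) (tpow \<sigma> l)) = d ^ length w"
      using tp[OF r(1), of k] tp[OF r(2), of l] by (auto simp: len power_add)
    moreover have "dim_row (wordst \<rho> \<sigma> w) = d ^ length w" "dim_col (wordst \<rho> \<sigma> w) = d ^ length w"
      using wordst_carrier[OF r, of w] by auto
    ultimately show ?thesis using r by (simp add: U1_def kron_mult dU mult_one_dim e[OF r])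
  qed
  show ?case
  proof (cases b)
    case True
    have "U1 * wordst \<rho> \<sigma> (b # w) = kron (tpow \<rho> (count_list (b # w) True)) (tpow \<sigma> (count_list (b # w) False)) * U1"
      if r: "\<rho> \<in> carrier_mat d d" "\<sigma> \<in> carrier_mat d d" for \<rho> \<sigma>
      using U1e[OF r] True by (simp add: kl kron_assoc)
    with U1 show ?thesis by blast
  next
    case False
    \<comment> \<open>A leading copy of sigma is moved past the \<open>k\<close> sorted copies of
      rho, a swap of dimensions d and d^k.\<close>
    define S where "S = kron (swapm d (d ^ k)) (1\<^sub>m (d ^ l))"
    have S: "unitary (d ^ length (b # w)) S"
      unfolding unitary_def
    proof
      show "S \<in> carrier_mat (d ^ length (b # w)) (d ^ length (b # w))"
        by (rule carrier_matI) (simp_all add: S_def len power_add)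
      show "mat_adjoint S * S = 1\<^sub>m (d ^ length (b # w))"
        by (simp add: S_def kron_adjoint kron_mult swapm_adjoint swapm_mult mult_one_dim kron_one len power_add mult.assoc)
    qed
    have dS: "dim_row S = d ^ Suc (length w)" "dim_col S = d ^ Suc (length w)" using unitary_dim[OF S] by auto
    have dU1: "dim_row U1 = d ^ Suc (length w)" "dim_col U1 = d ^ Suc (length w)" using unitary_dim[OF U1] by auto
    have "(S * U1) * wordst \<rho> \<sigma> (b # w)
      = kron (tpow \<rho> (count_list (b # w) True)) (tpow \<sigma> (count_list (b # w) False)) * (S * U1)"
      if r: "\<rho> \<in> carrier_mat d d" "\<sigma> \<in> carrier_mat d d" for \<rho> \<sigma>
    proof -
      define A where "A = tpow \<rho> k"
      define B where "B = tpow \<sigma> l"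
      have A: "A \<in> carrier_mat (d ^ k) (d ^ k)" and B: "B \<in> carrier_mat (d ^ l) (d ^ l)"
        unfolding A_def B_def by (rule tp, rule r)+
      have dAB: "dim_row A = d ^ k" "dim_col A = d ^ k" "dim_row B = d ^ l" "dim_col B = d ^ l"
        "dim_row \<sigma> = d" "dim_col \<sigma> = d" using A B r by auto
      have dW: "dim_row (wordst \<rho> \<sigma> (b # w)) = d ^ Suc (length w)"
        using wordst_carrier[OF r, of "b # w"] by auto
      have Sk: "S * kron \<sigma> (kron A B) = kron A (kron \<sigma> B) * S"
      proof -
        have "S * kron \<sigma> (kron A B) = kron (swapm d (d ^ k)) (1\<^sub>m (d ^ l)) * kron (kron \<sigma> A) B"
          by (simp add: S_def kron_assoc)
        also have "\<dots> = kron (swapm d (d ^ k) * kron \<sigma> A) B"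
          by (simp add: kron_mult dAB mult_one_dim)
        also have "\<dots> = kron (kron A \<sigma> * swapm d (d ^ k)) B"
          by (simp only: swapm_kron[OF r(2) A])
        also have "\<dots> = kron (kron A \<sigma>) B * S"
          by (simp add: S_def kron_mult dAB mult_one_dim mult.commute)
        finally show ?thesis by (simp add: kron_assoc)
      qed
      have "(S * U1) * wordst \<rho> \<sigma> (b # w) = S * (U1 * wordst \<rho> \<sigma> (b # w))"
        by (rule mult_assoc_dim) (simp_all only: dS dU1 dW)
      also have "U1 * wordst \<rho> \<sigma> (b # w) = kron \<sigma> (kron A B) * U1"
        using U1e[OF r] False by (simp add: A_def B_def)
      also have "S * (kron \<sigma> (kron A B) * U1) = (S * kron \<sigma> (kron A B)) * U1"
        by (rule mult_assoc_dim[symmetric]) (simp_all add: dS dU1 dAB len power_add)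
      also have "\<dots> = kron A (kron \<sigma> B) * (S * U1)"
        unfolding Sk by (rule mult_assoc_dim) (simp_all add: dS dU1 dAB len power_add)
      also have "kron A (kron \<sigma> B) = kron (tpow \<rho> (count_list (b # w) True)) (tpow \<sigma> (count_list (b # w) False))"
        using False by (simp add: A_def B_def kl)
      finally show ?thesis .
    qed
    with unitary_mult[OF S U1] show ?thesis by blast
  qed
qed

text \<open>The channel undoes the sorting by the single Kraus operator U^*, and the ancilla is
  one-dimensional; the effect is then measured on the word it was built for.\<close>

lemma algorithm_of_effect:
  assumes E: "psd (d ^ length w) E" "psd (d ^ length w) (1\<^sub>m (d ^ length w) - E)"
  shows "\<exists>k l a \<tau> Ks m E'. k + l = length w \<and> valid_algorithm d k l a \<tau> Ks m E' \<and>
    (\<forall>\<rho> \<sigma>. density d \<rho> \<longrightarrow> density d \<sigma> \<longrightarrow>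
      prob_close k l \<tau> Ks m E' \<rho> \<sigma> = Re (mtrace (E * wordst \<rho> \<sigma> w)))"
proof -
  define k l where kl: "k = count_list w True" "l = count_list w False"
  have len: "k + l = length w" unfolding kl by (induction w) auto
  from word_permutation[of d w] obtain U where U: "unitary (d ^ length w) U"
    and e: "\<And>\<rho> \<sigma>. \<rho> \<in> carrier_mat d d \<Longrightarrow> \<sigma> \<in> carrier_mat d d \<Longrightarrow>
      U * wordst \<rho> \<sigma> w = kron (tpow \<rho> k) (tpow \<sigma> l) * U"
    unfolding kl by blast
  note dU = unitary_dim[OF U]
  have Uc: "mat_adjoint U \<in> carrier_mat (d ^ length w) (d ^ length w)"
    by (rule mat_adjoint_carrier[OF unitaryD(1)[OF U]])
  have "density 1 (1\<^sub>m 1)" using psd_one[of 1] by (simp add: density_def mtrace_def)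
  moreover have "is_channel (d ^ (k + l) * 1) (d ^ length w) [mat_adjoint U]"
    using unitaryD(3)[OF U] Uc by (simp add: is_channel_def len)
  ultimately have va: "valid_algorithm d k l 1 (1\<^sub>m 1) [mat_adjoint U] (d ^ length w) E"
    using E by (simp add: valid_algorithm_def)
  have "prob_close k l (1\<^sub>m 1) [mat_adjoint U] (d ^ length w) E \<rho> \<sigma> = Re (mtrace (E * wordst \<rho> \<sigma> w))"
    if r: "density d \<rho>" "density d \<sigma>" for \<rho> \<sigma>
  proof -
    have rc: "\<rho> \<in> carrier_mat d d" "\<sigma> \<in> carrier_mat d d" using densityD(1) r by auto
    have W: "wordst \<rho> \<sigma> w \<in> carrier_mat (d ^ length w) (d ^ length w)" by (rule wordst_carrier[OF rc])
    then have dW: "dim_row (wordst \<rho> \<sigma> w) = d ^ length w" "dim_col (wordst \<rho> \<sigma> w) = d ^ length w" by auto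
    have tp: "dim_row (tpow X n) = dim_row X ^ n" "dim_col (tpow X n) = dim_col X ^ n" for X n
      by (induction n) auto
    have dK: "dim_row (kron (tpow \<rho> k) (tpow \<sigma> l)) = d ^ length w" "dim_col (kron (tpow \<rho> k) (tpow \<sigma> l)) = d ^ length w"
      using rc by (auto simp: tp simp flip: len power_add)
    have "mat_adjoint U * kron (tpow \<rho> k) (tpow \<sigma> l) * U = mat_adjoint U * (U * wordst \<rho> \<sigma> w)"
      unfolding e[OF rc] by (rule mult_assoc_dim) (simp_all only: mat_adjoint_dim dU dK)
    also have "\<dots> = wordst \<rho> \<sigma> w"
      by (rule mult_cancel_left_dim[OF unitaryD(2)[OF U]]) (simp_all add: dU dW)
    finally have "apply_channel (d ^ length w) [mat_adjoint U] (kron (kron (tpow \<rho> k) (tpow \<sigma> l)) (1\<^sub>m 1)) = wordst \<rho> \<sigma> w"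
      using W unfolding kron_one_right by (simp add: apply_channel_def)
    then show ?thesis unfolding prob_close_def by simp
  qed
  with va len show ?thesis by blast
qed

section \<open>Estimating the affinity\<close>

lemma density_eigen_decomp:
  assumes "density d \<rho>"
  obtains U p where "eigen_decomp d \<rho> U p" "card {i. i < d \<and> p i \<noteq> 0} \<le> mrank \<rho>"
proof -
  from densityD(4)[OF assms] obtain U p where U: "unitary d U" "\<rho> = fcalc U (\<lambda>i. of_real (p i))"
    and p: "\<And>i. i < d \<Longrightarrow> 0 \<le> p i"
    using psd_spectral by blast
  have "of_real (\<Sum>i<d. p i) = (1 :: complex)"
    using densityD(3)[OF assms] mtrace_fcalc[OF U(1), of "\<lambda>i. of_real (p i)"] U(2) by simp
  then have "(\<Sum>i<d. p i) = 1" using of_real_eq_1_iff by blast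
  then have "eigen_decomp d \<rho> U p" using U p by (simp add: eigen_decomp_def)
  moreover have "card {i. i < d \<and> p i \<noteq> 0} \<le> mrank \<rho>"
    using card_support_le_mrank[OF U(1), of "\<lambda>i. of_real (p i)"] U(2) by simp
  ultimately show ?thesis by (rule that)
qed

section \<open>Circuits evaluated in the eigenbases of the two states\<close>

lemma circ_append: "circ \<rho> \<sigma> (l @ l') X = circ \<rho> \<sigma> l' (circ \<rho> \<sigma> l X)"
  by (induction l arbitrary: X) auto

lemma circ_replicate_True:
  assumes U: "unitary d U" and \<rho>: "\<rho> = fcalc U (\<lambda>i. of_real (p i))"
  shows "circ \<rho> \<sigma> (replicate n (True, c, s)) (fcalc U F)
    = fcalc U (\<lambda>i. (of_real c - \<i> * of_real (s * p i)) ^ n * F i)"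
proof (induction n arbitrary: F)
  case (Suc n)
  have "of_real c \<cdot>\<^sub>m fcalc U F + (- \<i> * of_real s) \<cdot>\<^sub>m (\<rho> * fcalc U F)
      = fcalc U (\<lambda>i. of_real c * F i + (- \<i> * of_real s) * (of_real (p i) * F i))"
    by (simp only: \<rho> fcalc_mult[OF U] fcalc_smult[OF U] fcalc_add[OF U])
  also have "\<dots> = fcalc U (\<lambda>i. (of_real c - \<i> * of_real (s * p i)) * F i)"
    by (rule fcalc_cong) (simp add: algebra_simps)
  finally show ?case using Suc by (simp add: mult_ac)
qed simp

text \<open>The two states need not commute, so the steps with sigma act on the left factor only and
  \<open>Y\<close> is carried along unchanged.\<close>

lemma circ_replicate_False:
  assumes V: "unitary d V" and \<sigma>: "\<sigma> = fcalc V (\<lambda>i. of_real (q i))" and Y: "Y \<in> carrier_mat d d"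
  shows "circ \<rho> \<sigma> (replicate n (False, c, s)) (fcalc V G * Y)
    = fcalc V (\<lambda>i. (of_real c - \<i> * of_real (s * q i)) ^ n * G i) * Y"
proof (induction n arbitrary: G)
  case (Suc n)
  have d: "dim_row Y = d" "dim_row V = d" using Y unitary_dim[OF V] by auto
  have "of_real c \<cdot>\<^sub>m (fcalc V G * Y) + (- \<i> * of_real s) \<cdot>\<^sub>m (\<sigma> * (fcalc V G * Y))
      = (of_real c \<cdot>\<^sub>m fcalc V G + (- \<i> * of_real s) \<cdot>\<^sub>m (\<sigma> * fcalc V G)) * Y"
    by (simp add: add_mult_dim smult_mult_dim mult_assoc_dim \<sigma> d)
  also have "of_real c \<cdot>\<^sub>m fcalc V G + (- \<i> * of_real s) \<cdot>\<^sub>m (\<sigma> * fcalc V G)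
      = fcalc V (\<lambda>i. of_real c * G i + (- \<i> * of_real s) * (of_real (q i) * G i))"
    by (simp only: \<sigma> fcalc_mult[OF V] fcalc_smult[OF V] fcalc_add[OF V])
  also have "\<dots> = fcalc V (\<lambda>i. (of_real c - \<i> * of_real (s * q i)) * G i)"
    by (rule fcalc_cong) (simp add: algebra_simps)
  finally show ?case using Suc by (simp add: mult_ac)
qed simp

(* The idle steps (1, 0) make all circuits act on the same word of copies. *)
definition schedule :: "nat \<Rightarrow> nat \<Rightarrow> nat \<Rightarrow> (bool \<times> real \<times> real) list" where
  "schedule K n m = (let h = 1 / (real K)\<^sup>2 in
     replicate n (True, 1 - h\<^sup>2, h) @ replicate (K ^ 4 - n) (True, 1, 0) @
     replicate (K * m) (False, 1 - h\<^sup>2, h) @ replicate (K ^ 4 - K * m) (False, 1, 0))"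

lemma map_fst_schedule:
  assumes "n \<le> K ^ 4" "m \<le> K ^ 3"
  shows "map fst (schedule K n m) = replicate (K ^ 4) True @ replicate (K ^ 4) False"
proof -
  have "K * m \<le> K * K ^ 3" using assms by simp
  then have "K * m \<le> K ^ 4" by (simp add: power_Suc[symmetric] del: power_Suc)
  then have "replicate (K * m) False @ replicate (K ^ 4 - K * m) False = replicate (K ^ 4) False"
    by (simp flip: replicate_add)
  moreover have "replicate n True @ replicate (K ^ 4 - n) True = replicate (K ^ 4) True"
    using assms by (simp flip: replicate_add)
  moreover have "map fst (schedule K n m) = (replicate n True @ replicate (K ^ 4 - n) True)
      @ (replicate (K * m) False @ replicate (K ^ 4 - K * m) False)"
    by (simp add: schedule_def Let_def)
  ultimately show ?thesis by (simp only:)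
qed

lemma circ_schedule:
  assumes U: "unitary d U" "\<rho> = fcalc U (\<lambda>i. of_real (p i))"
    and V: "unitary d V" "\<sigma> = fcalc V (\<lambda>i. of_real (q i))"
  defines "h K \<equiv> 1 / (real K)\<^sup>2"
  shows "mtrace (circ \<rho> \<sigma> (schedule K n m) \<rho>) = (\<Sum>i<d. \<Sum>j<d.
    stepv (h K) (p i) ^ n * of_real (p i) * (stepv (h K) (q j) ^ K) ^ m * of_real (overlap U V i j))"
proof -
  have st: "of_real (1 - (h K)\<^sup>2) - \<i> * of_real (h K * x) = stepv (h K) x" for x
    by (simp add: stepv_def complex_eq_iff)
  have X: "circ \<rho> \<sigma> (replicate (K ^ 4 - n) (True, 1, 0)) (circ \<rho> \<sigma> (replicate n (True, 1 - (h K)\<^sup>2, h K)) \<rho>)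
      = fcalc U (\<lambda>i. stepv (h K) (p i) ^ n * of_real (p i))"
    unfolding U(2) circ_replicate_True[OF U(1) refl] st by simp
  define Y where "Y = fcalc U (\<lambda>i. stepv (h K) (p i) ^ n * of_real (p i))"
  have Y: "Y \<in> carrier_mat d d" using U by (simp add: Y_def)
  \<comment> \<open>The identity, written in the eigenbasis of sigma, is the starting value for the
    steps with sigma.\<close>
  have Y1: "Y = fcalc V (\<lambda>_. 1) * Y" using Y by (simp flip: fcalc_one[OF V(1)])
  have "circ \<rho> \<sigma> (replicate (K ^ 4 - K * m) (False, 1, 0)) (circ \<rho> \<sigma> (replicate (K * m) (False, 1 - (h K)\<^sup>2, h K)) Y)
      = fcalc V (\<lambda>j. (stepv (h K) (q j) ^ K) ^ m) * Y"
    by (subst Y1) (simp only: V(2) circ_replicate_False[OF V(1) refl Y] st power_mult, simp)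
  then have "mtrace (circ \<rho> \<sigma> (schedule K n m) \<rho>) = mtrace (fcalc V (\<lambda>j. (stepv (h K) (q j) ^ K) ^ m) * Y)"
    by (simp add: schedule_def Let_def circ_append X h_def[symmetric] Y_def[symmetric])
  also have "\<dots> = mtrace (Y * fcalc V (\<lambda>j. (stepv (h K) (q j) ^ K) ^ m))"
    by (rule mtrace_mult_comm[OF fcalc_carrier[OF V(1)] Y])
  also have "\<dots> = (\<Sum>i<d. \<Sum>j<d.
    stepv (h K) (p i) ^ n * of_real (p i) * (stepv (h K) (q j) ^ K) ^ m * of_real (overlap U V i j))"
    unfolding Y_def by (rule mtrace_fcalc_mult[OF U(1) V(1)])
  finally show ?thesis .
qed

(* The phases rot and cnj rot of the two series cancel in the product, so they do not appear here. *)
definition affinity_est :: "nat \<Rightarrow> complex mat \<Rightarrow> complex mat \<Rightarrow> complex" where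
  "affinity_est K \<rho> \<sigma> = (\<Sum>n\<le>K ^ 4. \<Sum>m\<le>K ^ 3.
     of_real (cbin n * sqc m * (sqrt K / K)) * mtrace (circ \<rho> \<sigma> (schedule K n m) \<rho>))"

text \<open>The first \<open>True\<close> is the system register. Each state has K^4 step copies, as
  n <= K^4 and K m <= K * K^3.\<close>

definition est_word :: "nat \<Rightarrow> bool list" where
  "est_word K = True # replicate (K ^ 4) True @ replicate (K ^ 4) False"

lemma observable_mono:
  assumes "observable d w B \<phi>" "B \<le> B'"
  shows "observable d w B' \<phi>"
proof -
  have "x \<le> B' * Re (v \<bullet>c v)" if "x \<le> B * Re (v \<bullet>c v)" for x and v :: "complex vec"
    using mult_right_mono[OF assms(2) cscalar_prod_self_nonneg[of v]] that by linarith
  then show ?thesis using assms(1) unfolding observable_def by meson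
qed

text \<open>Each circuit is a contraction, so the 1-norm of the coefficients bounds the sum: at most
  2 K^2 from the inverse root of length K^4, at most 2 from the root, times the prefactor sqrt K /
  K.\<close>

lemma observable_affinity_est:
  assumes K: "K \<ge> 2"
  shows "observable d (est_word K) (4 * real K * sqrt K) (affinity_est K)"
proof (rule observable_mono)
  have K0: "real K > 0" using K by simp
  have h: "0 < 1 / (real K)\<^sup>2" "1 / (real K)\<^sup>2 \<le> 1"
    using K0 K one_le_power[of "real K" 2] by auto
  have cs: "c\<^sup>2 + s\<^sup>2 \<le> 1" if "(b, c, s) \<in> set (schedule K n m)" for b c s n m
  proof -
    define h where "h = 1 / (real K)\<^sup>2"
    have "h * h \<le> 1" using h by (simp add: h_def mult_le_one)
    then have "(h * h) * (h * h) \<le> (h * h) * 1" by (intro mult_left_mono) auto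
    then have "(1 - h\<^sup>2)\<^sup>2 + h\<^sup>2 \<le> 1" by (simp add: power2_eq_square algebra_simps)
    then show ?thesis using that by (auto simp: schedule_def Let_def h_def)
  qed
  have "observable d (est_word K) (\<Sum>n\<le>K ^ 4. \<Sum>m\<le>K ^ 3. norm (of_real (cbin n * sqc m * (sqrt K / K)) :: complex) * 1)
    (\<lambda>\<rho> \<sigma>. \<Sum>n\<le>K ^ 4. \<Sum>m\<le>K ^ 3.
     of_real (cbin n * sqc m * (sqrt K / K)) * mtrace (circ \<rho> \<sigma> (schedule K n m) \<rho>))"
  proof (intro observable_sum observable_smult)
    fix n m assume "n \<in> {..K ^ 4}" "m \<in> {..K ^ 3}"
    then have "True # map fst (schedule K n m) = est_word K" by (simp add: map_fst_schedule est_word_def)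
    then show "observable d (est_word K) 1 (\<lambda>\<rho> \<sigma>. mtrace (circ \<rho> \<sigma> (schedule K n m) \<rho>))"
      using observable_circuit[of "schedule K n m" d] cs by metis
  qed auto
  then show "observable d (est_word K)
      (\<Sum>n\<le>K ^ 4. \<Sum>m\<le>K ^ 3. norm (of_real (cbin n * sqc m * (sqrt K / K)) :: complex) * 1) (affinity_est K)"
    unfolding affinity_est_def .
  have "(\<Sum>n\<le>K ^ 4. \<Sum>m\<le>K ^ 3. norm (of_real (cbin n * sqc m * (sqrt K / K)) :: complex) * 1)
      = (\<Sum>n\<le>K ^ 4. cbin n) * (\<Sum>m\<le>K ^ 3. \<bar>sqc m\<bar>) * (sqrt K / K)"
  proof -
    have "(\<Sum>n\<le>K ^ 4. \<Sum>m\<le>K ^ 3. norm (of_real (cbin n * sqc m * (sqrt K / K)) :: complex) * 1)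
      = (\<Sum>n\<le>K ^ 4. \<Sum>m\<le>K ^ 3. cbin n * \<bar>sqc m\<bar> * (sqrt K / K))"
      using cbin_pos by (intro sum.cong refl) (simp add: abs_mult less_imp_le abs_of_pos del: of_real_mult of_real_divide)
    also have "\<dots> = (\<Sum>n\<le>K ^ 4. \<Sum>m\<le>K ^ 3. cbin n * \<bar>sqc m\<bar>) * (sqrt K / K)"
      by (simp only: sum_distrib_right)
    also have "(\<Sum>n\<le>K ^ 4. \<Sum>m\<le>K ^ 3. cbin n * \<bar>sqc m\<bar>) = (\<Sum>n\<le>K ^ 4. cbin n) * (\<Sum>m\<le>K ^ 3. \<bar>sqc m\<bar>)"
      by (rule sum_product[symmetric])
    finally show ?thesis .
  qed
  also have "\<dots> \<le> (2 * (real K)\<^sup>2) * 2 * (sqrt K / K)"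
  proof (intro mult_right_mono mult_mono)
    have "(1::real) \<le> real K ^ 4" using K by (intro one_le_power) simp
    then have "2 * real (K ^ 4) + 1 \<le> (2 * (real K)\<^sup>2)\<^sup>2" by (simp flip: power_mult add: power_mult_distrib)
    then have "sqrt (2 * real (K ^ 4) + 1) \<le> 2 * (real K)\<^sup>2" by (intro real_le_lsqrt) auto
    then show "(\<Sum>n\<le>K ^ 4. cbin n) \<le> 2 * (real K)\<^sup>2" using sum_cbin_le[of "K ^ 4"] by linarith
    show "(\<Sum>m\<le>K ^ 3. \<bar>sqc m\<bar>) \<le> 2" by (rule sum_abs_sqc_le)
  qed (auto intro: sum_nonneg)
  also have "\<dots> = 4 * real K * sqrt K" using K0 by (simp add: power2_eq_square)
  finally show "(\<Sum>n\<le>K ^ 4. \<Sum>m\<le>K ^ 3. norm (of_real (cbin n * sqc m * (sqrt K / K)) :: complex) * 1)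
      \<le> 4 * real K * sqrt K" .
qed

lemma affinity_est_fcalc:
  assumes U: "unitary d U" "\<rho> = fcalc U (\<lambda>i. of_real (p i))"
    and V: "unitary d V" "\<sigma> = fcalc V (\<lambda>i. of_real (q i))"
  defines "h K \<equiv> 1 / (real K)\<^sup>2"
  shows "affinity_est K \<rho> \<sigma> = (\<Sum>i<d. \<Sum>j<d.
     (of_real (p i) * (rot * of_real (1 / K) * (\<Sum>n\<le>K ^ 4. of_real (cbin n) * stepv (h K) (p i) ^ n))) *
     (cnj rot * of_real (sqrt K) * (\<Sum>m\<le>K ^ 3. of_real (sqc m) * (stepv (h K) (q j) ^ K) ^ m)) *
     of_real (overlap U V i j))"
proof -
  let ?f = "\<lambda>n m i j. of_real (cbin n * sqc m * (sqrt K / K)) *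
     (stepv (h K) (p i) ^ n * of_real (p i) * (stepv (h K) (q j) ^ K) ^ m * of_real (overlap U V i j))"
  let ?g = "\<lambda>i j. (of_real (p i) * (rot * of_real (1 / K) * (\<Sum>n\<le>K ^ 4. of_real (cbin n) * stepv (h K) (p i) ^ n))) *
     (cnj rot * of_real (sqrt K) * (\<Sum>m\<le>K ^ 3. of_real (sqc m) * (stepv (h K) (q j) ^ K) ^ m)) *
     of_real (overlap U V i j)"
  have "affinity_est K \<rho> \<sigma> = (\<Sum>n\<le>K ^ 4. \<Sum>m\<le>K ^ 3. \<Sum>i<d. \<Sum>j<d. ?f n m i j)"
    unfolding affinity_est_def circ_schedule[OF U V] h_def by (simp only: sum_distrib_left)
  also have "\<dots> = (\<Sum>n\<le>K ^ 4. \<Sum>i<d. \<Sum>j<d. \<Sum>m\<le>K ^ 3. ?f n m i j)"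
    by (rule sum.cong[OF refl], rule trans[OF sum.swap], rule sum.cong[OF refl], rule sum.swap)
  also have "\<dots> = (\<Sum>i<d. \<Sum>j<d. \<Sum>n\<le>K ^ 4. \<Sum>m\<le>K ^ 3. ?f n m i j)"
    by (rule trans[OF sum.swap], rule sum.cong[OF refl], rule sum.swap)
  also have "\<dots> = (\<Sum>i<d. \<Sum>j<d. ?g i j)"
  proof (intro sum.cong refl)
    fix i j
    define N M where "N = K ^ 4" and "M = K ^ 3"
    define u v where "u = stepv (h K) (p i)" and "v = stepv (h K) (q j) ^ K"
    define a b where "a n = of_real (cbin n) * u ^ n" and "b m = of_real (sqc m) * v ^ m" for n m
    define C where "C = (of_real (sqrt K / K) * of_real (p i) * of_real (overlap U V i j) :: complex)"
    have "(\<Sum>n\<le>N. \<Sum>m\<le>M. of_real (cbin n * sqc m * (sqrt K / K)) * (u ^ n * of_real (p i) * v ^ m * of_real (overlap U V i j)))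
      = (\<Sum>n\<le>N. \<Sum>m\<le>M. C * (a n * b m))"
      by (intro sum.cong refl) (simp add: a_def b_def C_def)
    also have "\<dots> = C * (\<Sum>n\<le>N. \<Sum>m\<le>M. a n * b m)"
      by (simp only: sum_distrib_left)
    also have "(\<Sum>n\<le>N. \<Sum>m\<le>M. a n * b m) = sum a {..N} * sum b {..M}"
      by (rule sum_product[symmetric])
    \<comment> \<open>The phases are inserted as \<open>cnj rot * rot = 1\<close> to match the two
      scalar approximations.\<close>
    also have "C * (sum a {..N} * sum b {..M}) = (cnj rot * rot) * C * (sum a {..N} * sum b {..M})" by (simp add: rot_facts)
    also have "\<dots> = (of_real (p i) * (rot * of_real (1 / K) * sum a {..N})) * (cnj rot * of_real (sqrt K) * sum b {..M}) * of_real (overlap U V i j)"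
      by (simp add: C_def)
    finally show "(\<Sum>n\<le>N. \<Sum>m\<le>M. of_real (cbin n * sqc m * (sqrt K / K)) * (u ^ n * of_real (p i) * v ^ m * of_real (overlap U V i j)))
      = (of_real (p i) * (rot * of_real (1 / K) * (\<Sum>n\<le>N. of_real (cbin n) * u ^ n))) *
     (cnj rot * of_real (sqrt K) * (\<Sum>m\<le>M. of_real (sqc m) * v ^ m)) * of_real (overlap U V i j)"
      unfolding a_def b_def .
  qed
  finally show ?thesis .
qed

text \<open>Cauchy-Schwarz over the support, obtained from 2 sqrt p <= p sqrt r + 1/sqrt r, with
  equality at p = 1/r.\<close>

lemma sum_sqrt_le:
  fixes p :: "nat \<Rightarrow> real"
  assumes p: "\<And>i. i < d \<Longrightarrow> 0 \<le> p i" "(\<Sum>i<d. p i) = 1" and c: "card {i. i < d \<and> p i \<noteq> 0} \<le> r" and r: "1 \<le> r"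
  shows "(\<Sum>i<d. sqrt (p i)) \<le> sqrt (real r)"
proof -
  define I where "I = {i. i < d \<and> p i \<noteq> 0}"
  have I: "finite I" "I \<subseteq> {..<d}" by (auto simp: I_def)
  have r0: "real r > 0" using r by simp
  have "(\<Sum>i<d. sqrt (p i)) = (\<Sum>i\<in>I. sqrt (p i))"
    by (rule sum.mono_neutral_right) (use I in \<open>auto simp: I_def\<close>)
  also have "\<dots> \<le> (\<Sum>i\<in>I. (p i * sqrt r + 1 / sqrt r) / 2)"
  proof (rule sum_mono)
    fix i assume "i \<in> I"
    then have pi: "0 \<le> p i" using p(1) by (simp add: I_def)
    have "0 \<le> (sqrt (p i) * sqrt r - 1)\<^sup>2" by simp
    moreover have "(sqrt (p i) * sqrt r - 1)\<^sup>2 = p i * r - 2 * (sqrt (p i) * sqrt r) + 1"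
      using pi r0 by (simp add: power2_diff power_mult_distrib)
    moreover have "(p i * sqrt r + 1 / sqrt r) * sqrt r = p i * r + 1"
      using r0 by (simp add: distrib_right mult.assoc)
    ultimately have "2 * sqrt (p i) * sqrt r \<le> (p i * sqrt r + 1 / sqrt r) * sqrt r" by linarith
    then have "2 * sqrt (p i) \<le> p i * sqrt r + 1 / sqrt r" using r0 by (simp add: mult_le_cancel_right)
    then show "sqrt (p i) \<le> (p i * sqrt r + 1 / sqrt r) / 2" by simp
  qed
  also have "\<dots> = ((\<Sum>i\<in>I. p i) * sqrt r + real (card I) * (1 / sqrt r)) / 2"
    by (simp add: sum_divide_distrib[symmetric] sum.distrib sum_distrib_right)
  also have "(\<Sum>i\<in>I. p i) = (\<Sum>i<d. p i)"
    by (rule sum.mono_neutral_left) (use I in \<open>auto simp: I_def\<close>)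
  also have "((\<Sum>i<d. p i) * sqrt r + real (card I) * (1 / sqrt r)) / 2 \<le> (1 * sqrt r + real r * (1 / sqrt r)) / 2"
    using c r0 by (intro divide_right_mono add_mono mult_right_mono) (auto simp: p(2) I_def)
  also have "\<dots> = sqrt r" by (simp add: real_div_sqrt)
  finally show ?thesis .
qed

text \<open>With a, b the exact roots and F, G their approximations, F G - a b = (F - a)(G - b) + (F
  - a) b + a (G - b). The overlaps sum to 1 in each row and column, so a term that depends on one
  index only is summed over that index alone. The first term then gives eta^2 r, and the other two
  give eta sqrt r each by \<open>sum_sqrt_le\<close>, with eta = 6/K.\<close>

lemma affinity_est_error:
  assumes K: "K \<ge> 2" and r: "1 \<le> r"
    and \<rho>: "eigen_decomp d \<rho> U p" "card {i. i < d \<and> p i \<noteq> 0} \<le> r"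
    and \<sigma>: "eigen_decomp d \<sigma> V q" "card {i. i < d \<and> q i \<noteq> 0} \<le> r"
  shows "norm (affinity_est K \<rho> \<sigma> - of_real (affinity d U p V q)) \<le> (6 / K)\<^sup>2 * r + 2 * (6 / K) * sqrt r"
proof -
  note U = eigen_decompD[OF \<rho>(1)] and V = eigen_decompD[OF \<sigma>(1)]
  define F where "F i = of_real (p i) * (rot * of_real (1 / K) * (\<Sum>n\<le>K ^ 4. of_real (cbin n) * stepv (1 / (real K)\<^sup>2) (p i) ^ n))" for i
  define G where "G j = cnj rot * of_real (sqrt K) * (\<Sum>m\<le>K ^ 3. of_real (sqc m) * (stepv (1 / (real K)\<^sup>2) (q j) ^ K) ^ m)" for j
  define \<eta> where "\<eta> = 6 / real K"
  have \<eta>: "\<eta> \<ge> 0" by (simp add: \<eta>_def)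
  define w where "w = overlap U V"
  have w: "w i j \<ge> 0" for i j by (simp add: w_def overlap_nonneg)
  define I where "I = {i. i < d \<and> p i \<noteq> 0}"
  \<comment> \<open>\<open>F i\<close> carries the factor p_i, so its error vanishes off the
    support. Without this the quadratic error would be summed over the dimension \<open>d\<close>
    instead of the rank.\<close>
  have F: "norm (F i - of_real (sqrt (p i))) \<le> (if i \<in> I then \<eta> else 0)" if "i < d" for i
    using inverse_sqrt_approx[OF K U(4)[OF that] U(5)[OF that]] that
    by (auto simp: I_def F_def \<eta>_def)
  have F': "norm (F i - of_real (sqrt (p i))) \<le> \<eta>" if "i < d" for i
    using F[OF that] \<eta> by (auto split: if_splits)
  have G: "norm (G j - of_real (sqrt (q j))) \<le> \<eta>" if "j < d" for j
    using sqrt_approx[OF K V(4)[OF that] V(5)[OF that]] by (simp add: G_def \<eta>_def)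
  have est: "affinity_est K \<rho> \<sigma> = (\<Sum>i<d. \<Sum>j<d. F i * G j * of_real (w i j))"
    unfolding F_def G_def w_def by (rule affinity_est_fcalc[OF U(1,2) V(1,2)])
  have "affinity_est K \<rho> \<sigma> - of_real (\<Sum>i<d. \<Sum>j<d. sqrt (p i) * sqrt (q j) * w i j)
    = (\<Sum>i<d. \<Sum>j<d. (F i * G j - of_real (sqrt (p i)) * of_real (sqrt (q j))) * of_real (w i j))"
    unfolding est by (simp add: left_diff_distrib sum_subtractf)
  also have "norm \<dots> \<le> (\<Sum>i<d. \<Sum>j<d. ((if i \<in> I then \<eta> else 0) * \<eta> + \<eta> * sqrt (q j) + sqrt (p i) * \<eta>) * w i j)"
  proof (intro sum_norm_le)
    fix i j assume "i \<in> {..<d}" "j \<in> {..<d}"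
    then have ij: "i < d" "j < d" by auto
    define a where "a = (of_real (sqrt (p i)) :: complex)"
    define b where "b = (of_real (sqrt (q j)) :: complex)"
    have na: "norm a = sqrt (p i)" "norm b = sqrt (q j)" using U(4) V(4) ij by (auto simp: a_def b_def)
    have e: "F i * G j - a * b = (F i - a) * (G j - b) + (F i - a) * b + a * (G j - b)"
      by (simp add: algebra_simps)
    have "norm (F i * G j - a * b) \<le> norm ((F i - a) * (G j - b)) + norm ((F i - a) * b) + norm (a * (G j - b))"
      unfolding e using norm_triangle_ineq[of "(F i - a) * (G j - b) + (F i - a) * b" "a * (G j - b)"]
        norm_triangle_ineq[of "(F i - a) * (G j - b)" "(F i - a) * b"] by linarith
    also have "\<dots> \<le> (if i \<in> I then \<eta> else 0) * \<eta> + \<eta> * sqrt (q j) + sqrt (p i) * \<eta>"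
      unfolding norm_mult na
      using F[OF ij(1)] F'[OF ij(1)] G[OF ij(2)] \<eta> U(4)[OF ij(1)] V(4)[OF ij(2)]
      by (intro add_mono mult_mono) (auto simp: a_def b_def)
    finally show "norm ((F i * G j - of_real (sqrt (p i)) * of_real (sqrt (q j))) * of_real (w i j))
      \<le> ((if i \<in> I then \<eta> else 0) * \<eta> + \<eta> * sqrt (q j) + sqrt (p i) * \<eta>) * w i j"
      unfolding norm_mult[of "_ - _"] a_def b_def using w[of i j] by (simp add: mult_right_mono)
  qed
  also have "\<dots> = (\<Sum>i<d. \<Sum>j<d. ((if i \<in> I then \<eta> else 0) * \<eta> + sqrt (p i) * \<eta>) * w i j)
      + (\<Sum>i<d. \<Sum>j<d. \<eta> * sqrt (q j) * w i j)"
    by (simp add: distrib_right sum.distrib)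
  also have "(\<Sum>i<d. \<Sum>j<d. \<eta> * sqrt (q j) * w i j) = (\<Sum>j<d. \<Sum>i<d. \<eta> * sqrt (q j) * w i j)"
    by (rule sum.swap)
  also have "\<dots> = (\<Sum>j<d. \<eta> * sqrt (q j))"
    using overlap_sum(1)[OF U(1) V(1)] by (simp add: w_def flip: sum_distrib_left)
  also have "(\<Sum>i<d. \<Sum>j<d. ((if i \<in> I then \<eta> else 0) * \<eta> + sqrt (p i) * \<eta>) * w i j)
      = (\<Sum>i<d. (if i \<in> I then \<eta> else 0) * \<eta> + sqrt (p i) * \<eta>)"
    using overlap_sum(2)[OF U(1) V(1)] by (simp add: w_def flip: sum_distrib_left)
  also have "\<dots> = (\<Sum>i<d. if i \<in> I then \<eta> * \<eta> else 0) + (\<Sum>i<d. sqrt (p i)) * \<eta>"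
  proof -
    have "(if i \<in> I then \<eta> else 0) * \<eta> = (if i \<in> I then \<eta> * \<eta> else 0)" for i by simp
    then show ?thesis by (simp only: sum.distrib sum_distrib_right)
  qed
  also have "(\<Sum>i<d. if i \<in> I then \<eta> * \<eta> else 0) = real (card I) * (\<eta> * \<eta>)"
  proof -
    have "{..<d} \<inter> I = I" by (auto simp: I_def)
    then show ?thesis by (simp add: sum.If_cases)
  qed
  also have "(\<Sum>j<d. \<eta> * sqrt (q j)) = \<eta> * (\<Sum>j<d. sqrt (q j))" by (simp add: sum_distrib_left)
  also have "real (card I) * (\<eta> * \<eta>) + (\<Sum>i<d. sqrt (p i)) * \<eta> + \<eta> * (\<Sum>j<d. sqrt (q j))
      \<le> real r * (\<eta> * \<eta>) + sqrt r * \<eta> + \<eta> * sqrt r"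
    using \<rho>(2) \<eta> sum_sqrt_le[OF U(4) U(3) \<rho>(2) r] sum_sqrt_le[OF V(4) V(3) \<sigma>(2) r]
    by (intro add_mono mult_left_mono mult_right_mono) (auto simp: I_def)
  also have "\<dots> = \<eta>\<^sup>2 * r + 2 * \<eta> * sqrt r" by (simp add: power2_eq_square algebra_simps)
  finally show ?thesis by (simp add: w_def \<eta>_def affinity_def)
qed

text \<open>The upper bound is sqrt(p q) <= (p + q)/2 averaged over the doubly stochastic overlaps.
  It makes the radicand in \<open>hellinger_eq_affinity\<close> nonnegative, so the Hellinger
  distance can be squared back.\<close>

lemma affinity_bounds:
  assumes "eigen_decomp d \<rho> U p" "eigen_decomp d \<sigma> V q"
  shows "0 \<le> affinity d U p V q" "affinity d U p V q \<le> 1"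
proof -
  note U = eigen_decompD[OF assms(1)] and V = eigen_decompD[OF assms(2)]
  show "0 \<le> affinity d U p V q" unfolding affinity_def
    by (intro sum_nonneg mult_nonneg_nonneg) (auto simp: U V overlap_nonneg)
  have "affinity d U p V q
      \<le> (\<Sum>i<d. \<Sum>j<d. p i / 2 * overlap U V i j + q j / 2 * overlap U V i j)"
    unfolding affinity_def
  proof (intro sum_mono)
    fix i j assume "i \<in> {..<d}" "j \<in> {..<d}"
    then have pq: "0 \<le> p i" "0 \<le> q j" using U V by auto
    have "0 \<le> (sqrt (p i) - sqrt (q j))\<^sup>2" by simp
    then have "sqrt (p i) * sqrt (q j) \<le> p i / 2 + q j / 2" using pq by (simp add: power2_diff)
    from mult_right_mono[OF this overlap_nonneg]
    show "sqrt (p i) * sqrt (q j) * overlap U V i j \<le> p i / 2 * overlap U V i j + q j / 2 * overlap U V i j"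
      by (simp only: distrib_right)
  qed
  also have "\<dots> = (\<Sum>i<d. \<Sum>j<d. p i / 2 * overlap U V i j) + (\<Sum>j<d. \<Sum>i<d. q j / 2 * overlap U V i j)"
  proof -
    have "(\<Sum>i<d. \<Sum>j<d. q j / 2 * overlap U V i j) = (\<Sum>j<d. \<Sum>i<d. q j / 2 * overlap U V i j)"
      by (rule sum.swap)
    then show ?thesis by (simp only: sum.distrib)
  qed
  also have "\<dots> = (\<Sum>i<d. p i / 2) + (\<Sum>j<d. q j / 2)"
    using overlap_sum[OF U(1) V(1)] by (simp only: sum_distrib_left[symmetric]) simp
  also have "\<dots> = 1" by (simp add: U(3) V(3) flip: sum_divide_distrib)
  finally show "affinity d U p V q \<le> 1" .
qed

text \<open>Threshold test at \<open>\<mu>\<close> for the affinity T. The cases leave a margin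
  eps/2 on either side, of which the approximation uses eps/4; the remaining eps/4 must be resolved
  statistically. The observable has norm bound \<open>B\<close>, so an estimate phi is seen as a
  coin of bias (1 + phi/B)/2.\<close>

lemma tester_exists:
  fixes K N r :: nat and \<epsilon> \<mu> :: real
  assumes K: "K \<ge> 2" "72 * sqrt r / \<epsilon> \<le> K" and r: "1 \<le> r" and \<epsilon>: "0 < \<epsilon>" "\<epsilon> \<le> 1"
    and N: "768 * real K ^ 3 / \<epsilon>\<^sup>2 \<le> N"
  shows "\<exists>k l a \<tau> Ks m E. k + l = N * (1 + 2 * K ^ 4) \<and> valid_algorithm d k l a \<tau> Ks m E \<and>
    (\<forall>\<rho> \<sigma>. density d \<rho> \<longrightarrow> density d \<sigma> \<longrightarrow> mrank \<rho> \<le> r \<longrightarrow> mrank \<sigma> \<le> r \<longrightarrow>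
      (1 - (hellinger \<rho> \<sigma>)\<^sup>2 \<ge> \<mu> + \<epsilon> / 2 \<longrightarrow> prob_close k l \<tau> Ks m E \<rho> \<sigma> \<ge> 2 / 3) \<and>
      (1 - (hellinger \<rho> \<sigma>)\<^sup>2 \<le> \<mu> - \<epsilon> / 2 \<longrightarrow> prob_close k l \<tau> Ks m E \<rho> \<sigma> \<le> 1 / 3))"
proof -
  define B where "B = 4 * real K * sqrt K"
  have K0: "real K > 0" using K by simp
  have B0: "B > 0" using K0 by (simp add: B_def)
  have B2: "B \<ge> 2"
  proof -
    have "real K * sqrt K \<ge> 1 * 1" using K by (intro mult_mono) auto
    then show ?thesis by (simp add: B_def)
  qed
  define w where "w = est_word K"
  define n where "n = d ^ length w"
  obtain E1 where E1: "psd n E1" "psd n (1\<^sub>m n - E1)"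
    and trE: "\<And>\<rho> \<sigma>. density d \<rho> \<Longrightarrow> density d \<sigma> \<Longrightarrow>
      mtrace (E1 * wordst \<rho> \<sigma> w) = of_real ((1 + Re (affinity_est K \<rho> \<sigma>) / B) / 2)"
    using effect_of_observable[OF observable_affinity_est[OF K(1)], of d] B0 unfolding n_def w_def B_def by blast
  have E1c: "E1 \<in> carrier_mat n n" using E1 by (simp add: psd_def)
  \<comment> \<open>The bias that an estimate exactly equal to \<open>\<mu>\<close> would
    produce.\<close>
  define \<theta> where "\<theta> = (1 + \<mu> / B) / 2"
  \<comment> \<open>A distance eps/4 between estimates is a distance (eps/4)/(2B) between
    biases.\<close>
  define \<delta> where "\<delta> = \<epsilon> / (8 * B)"
  have \<delta>: "\<delta> > 0" using \<epsilon> B0 by (simp add: \<delta>_def)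
  define h where "h j = (if real N * \<theta> \<le> real j then 1 else (0::real))" for j
  define W where "W = concat (replicate N w)"
  define E where "E = repeff n E1 N h"
  have lw: "length w = 1 + 2 * K ^ 4" by (simp add: w_def est_word_def)
  have lW: "length W = N * length w" unfolding W_def by (induction N) auto
  have dW: "d ^ length W = n ^ N" by (simp add: lW n_def mult.commute flip: power_mult)
  have "psd (n ^ N) E" unfolding E_def by (rule psd_repeff[OF E1]) (simp add: h_def)
  moreover have "psd (n ^ N) (1\<^sub>m (n ^ N) - E)"
  proof -
    have c: "E \<in> carrier_mat (n ^ N) (n ^ N)" "repeff n E1 N (\<lambda>j. 1 - h j) \<in> carrier_mat (n ^ N) (n ^ N)"
      unfolding E_def by (rule repeff_carrier[OF E1c])+
    have "1\<^sub>m (n ^ N) - E = repeff n E1 N (\<lambda>j. 1 - h j)"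
      unfolding repeff_add_complement[OF E1c, of N h, symmetric] E_def[symmetric]
      by (rule eq_matI) (use c in auto)
    moreover have "psd (n ^ N) (repeff n E1 N (\<lambda>j. 1 - h j))"
      by (rule psd_repeff[OF E1]) (simp add: h_def)
    ultimately show ?thesis by simp
  qed
  ultimately obtain k l a \<tau> Ks m E' where alg: "k + l = length W" "valid_algorithm d k l a \<tau> Ks m E'"
    and prob: "\<And>\<rho> \<sigma>. density d \<rho> \<Longrightarrow> density d \<sigma> \<Longrightarrow>
      prob_close k l \<tau> Ks m E' \<rho> \<sigma> = Re (mtrace (E * wordst \<rho> \<sigma> W))"
    using algorithm_of_effect[of d W E] unfolding dW by blast
  have main: "(1 - (hellinger \<rho> \<sigma>)\<^sup>2 \<ge> \<mu> + \<epsilon> / 2 \<longrightarrow> prob_close k l \<tau> Ks m E' \<rho> \<sigma> \<ge> 2 / 3) \<and>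
      (1 - (hellinger \<rho> \<sigma>)\<^sup>2 \<le> \<mu> - \<epsilon> / 2 \<longrightarrow> prob_close k l \<tau> Ks m E' \<rho> \<sigma> \<le> 1 / 3)"
    if \<rho>: "density d \<rho>" "mrank \<rho> \<le> r" and \<sigma>: "density d \<sigma>" "mrank \<sigma> \<le> r" for \<rho> \<sigma>
  proof -
    from \<rho>(1) obtain U p where U: "eigen_decomp d \<rho> U p" "card {i. i < d \<and> p i \<noteq> 0} \<le> mrank \<rho>"
      by (rule density_eigen_decomp)
    from \<sigma>(1) obtain V q where V: "eigen_decomp d \<sigma> V q" "card {i. i < d \<and> q i \<noteq> 0} \<le> mrank \<sigma>"
      by (rule density_eigen_decomp)
    define T where "T = affinity d U p V q"
    have T: "0 \<le> T" "T \<le> 1" unfolding T_def using affinity_bounds[OF U(1) V(1)] .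
    then have hT: "1 - (hellinger \<rho> \<sigma>)\<^sup>2 = T"
      using hellinger_eq_affinity[OF U(1) V(1)] by (simp add: T_def)
    define \<phi> where "\<phi> = Re (affinity_est K \<rho> \<sigma>)"
    have "norm (affinity_est K \<rho> \<sigma> - of_real T) \<le> (6 / K)\<^sup>2 * r + 2 * (6 / K) * sqrt r"
      unfolding T_def
      by (rule affinity_est_error[OF K(1) r U(1) _ V(1)]) (use U(2) V(2) \<rho> \<sigma> in auto)
    \<comment> \<open>With y = (6/K) sqrt r the bound is y^2 + 2y <= 3y, and the constant 72 gives y
      <= eps/12.\<close>
    also have "\<dots> \<le> \<epsilon> / 4"
    proof -
      define y where "y = 6 / K * sqrt r"
      have "72 * sqrt r \<le> K * \<epsilon>" using K(2) \<epsilon> by (simp add: divide_le_eq)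
      then have y: "0 \<le> y" "y \<le> \<epsilon> / 12" using K0 by (auto simp: y_def field_simps)
      have "y * y \<le> y * 1" using y \<epsilon> by (intro mult_left_mono) auto
      moreover have "(6 / K)\<^sup>2 * r = y * y" by (simp add: y_def power2_eq_square)
      ultimately show ?thesis using y by (simp add: y_def)
    qed
    finally have "\<bar>\<phi> - T\<bar> \<le> \<epsilon> / 4"
      using abs_Re_le_cmod[of "affinity_est K \<rho> \<sigma> - of_real T"] by (simp add: \<phi>_def)
    then have \<phi>: "\<phi> \<le> T + \<epsilon> / 4" "T - \<epsilon> / 4 \<le> \<phi>" by linarith+
    define P where "P = (1 + \<phi> / B) / 2"
    have "\<bar>\<phi>\<bar> \<le> B" using \<phi> T \<epsilon> B2 by linarith
    then have "- 1 \<le> \<phi> / B" "\<phi> / B \<le> 1" using B0 by (auto simp: divide_le_eq le_divide_eq)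
    then have P: "0 \<le> P" "P \<le> 1" by (auto simp: P_def)
    have rc: "\<rho> \<in> carrier_mat d d" "\<sigma> \<in> carrier_mat d d" using densityD(1) \<rho> \<sigma> by auto
    have "mtrace (E * wordst \<rho> \<sigma> W) = of_real (binexp P N h)"
      unfolding E_def W_def
    proof (rule mtrace_repeff[OF E1c])
      show "wordst \<rho> \<sigma> w \<in> carrier_mat n n" unfolding n_def by (rule wordst_carrier[OF rc])
      show "mtrace (E1 * wordst \<rho> \<sigma> w) = of_real P" unfolding P_def \<phi>_def by (rule trE[OF \<rho>(1) \<sigma>(1)])
      show "mtrace (wordst \<rho> \<sigma> w) = 1" by (rule mtrace_wordst[OF rc densityD(3)[OF \<rho>(1)] densityD(3)[OF \<sigma>(1)]])
      fix M
      have "length (concat (replicate M w)) = M * length w" by (induction M) auto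
      then have "d ^ length (concat (replicate M w)) = n ^ M" by (simp add: n_def power_mult[symmetric] mult.commute)
      then show "wordst \<rho> \<sigma> (concat (replicate M w)) \<in> carrier_mat (n ^ M) (n ^ M)"
        using wordst_carrier[OF rc, of "concat (replicate M w)"] by simp
    qed
    then have pr: "prob_close k l \<tau> Ks m E' \<rho> \<sigma> = binexp P N h"
      using prob[OF \<rho>(1) \<sigma>(1)] by simp
    \<comment> \<open>Origin of 768: 3/(4 delta^2) = 48 B^2 / eps^2 and B^2 = 16 K^3.\<close>
    have N\<delta>: "3 / (4 * \<delta>\<^sup>2) \<le> real N"
    proof -
      have "3 / (4 * \<delta>\<^sup>2) = 48 * B\<^sup>2 / \<epsilon>\<^sup>2" by (simp add: \<delta>_def power_divide power_mult_distrib)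
      also have "B\<^sup>2 = 16 * real K ^ 3" by (simp add: B_def power_mult_distrib power2_eq_square power3_eq_cube)
      finally show ?thesis using N by simp
    qed
    have PT: "P - \<theta> = (\<phi> - \<mu>) / (2 * B)" by (simp add: P_def \<theta>_def diff_divide_distrib add_divide_distrib mult.commute)
    have \<delta>2: "\<delta> = (\<epsilon> / 4) / (2 * B)" by (simp add: \<delta>_def)
    show ?thesis unfolding hT pr
    proof (intro conjI impI)
      assume "\<mu> + \<epsilon> / 2 \<le> T"
      then have "\<epsilon> / 4 \<le> \<phi> - \<mu>" using \<phi> by linarith
      then have "\<delta> \<le> P - \<theta>" unfolding PT \<delta>2 using B0 by (intro divide_right_mono) auto
      then have N\<theta>: "real N * \<theta> + real N * \<delta> \<le> real N * P"
        by (simp add: distrib_left[symmetric] mult_left_mono)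
      have "binexp P N (\<lambda>j. 1 - h j) \<le> 1 / 3"
      proof (rule binexp_chebyshev[OF P \<delta> N\<delta>])
        fix j assume "\<bar>real j - real N * P\<bar> < real N * \<delta>"
        then have "real N * \<theta> \<le> real j" using N\<theta> by linarith
        then show "1 - h j \<le> 0" by (simp add: h_def)
      qed (simp add: h_def)
      then show "2 / 3 \<le> binexp P N h" unfolding binexp_complement by simp
    next
      assume "T \<le> \<mu> - \<epsilon> / 2"
      then have "\<phi> - \<mu> \<le> - (\<epsilon> / 4)" using \<phi> by linarith
      then have "P - \<theta> \<le> - (\<epsilon> / 4) / (2 * B)" unfolding PT using B0 by (intro divide_right_mono) auto
      then have "P + \<delta> \<le> \<theta>" by (simp add: \<delta>2)
      then have N\<theta>: "real N * P + real N * \<delta> \<le> real N * \<theta>"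
        by (simp add: distrib_left[symmetric] mult_left_mono)
      show "binexp P N h \<le> 1 / 3"
      proof (rule binexp_chebyshev[OF P \<delta> N\<delta>])
        fix j assume "\<bar>real j - real N * P\<bar> < real N * \<delta>"
        then have "real j < real N * \<theta>" using N\<theta> by linarith
        then show "h j \<le> 0" by (simp add: h_def)
      qed (simp add: h_def)
    qed
  qed
  then show ?thesis using alg lW lw by metis
qed

section \<open>Choice of the parameters and sample count\<close>

lemma hellinger_bounds:
  assumes "density d \<rho>" "density d \<sigma>"
  shows "0 \<le> hellinger \<rho> \<sigma>" "hellinger \<rho> \<sigma> \<le> 1"
proof -
  from assms(1) obtain U p where U: "eigen_decomp d \<rho> U p" by (rule density_eigen_decomp)
  from assms(2) obtain V q where V: "eigen_decomp d \<sigma> V q" by (rule density_eigen_decomp)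
  show "0 \<le> hellinger \<rho> \<sigma>" "hellinger \<rho> \<sigma> \<le> 1"
    using affinity_bounds[OF U V] by (auto simp: hellinger_eq_affinity[OF U V])
qed

text \<open>Since K >= 1, each block uses at most 3 K^4 copies; 2307 is 3 * 769. Substituting the
  bound on K into K^7 / eps^2 yields r^(7/2) / eps^9.\<close>

lemma sample_bound:
  fixes K N r :: nat and \<epsilon> :: real
  assumes r: "1 \<le> r" and \<epsilon>: "0 < \<epsilon>" "\<epsilon> \<le> 1"
    and K: "1 \<le> K" "real K \<le> 73 * sqrt r / \<epsilon>" and N: "real N \<le> 769 * real K ^ 3 / \<epsilon>\<^sup>2"
  shows "real (N * (1 + 2 * K ^ 4)) \<le> 2307 * 73 ^ 7 * (real r powr 3.5 / \<epsilon> ^ 9)"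
proof -
  have "(1::real) \<le> real K ^ 4" using K by (intro one_le_power) simp
  then have "1 + 2 * real K ^ 4 \<le> 3 * real K ^ 4" by simp
  from mult_left_mono[OF this, of "real N"]
  have "real (N * (1 + 2 * K ^ 4)) \<le> real N * (3 * real K ^ 4)"
    by (simp only: of_nat_mult of_nat_add of_nat_1 of_nat_power of_nat_numeral)
  also have "\<dots> \<le> (769 * real K ^ 3 / \<epsilon>\<^sup>2) * (3 * real K ^ 4)" by (intro mult_right_mono N) simp
  also have "\<dots> = 2307 / \<epsilon>\<^sup>2 * real K ^ 7" by (simp flip: power_add)
  also have "\<dots> \<le> 2307 / \<epsilon>\<^sup>2 * (73 * sqrt r / \<epsilon>) ^ 7" by (intro mult_left_mono power_mono K) auto
  also have "\<dots> = 2307 * 73 ^ 7 * (sqrt r ^ 7 / \<epsilon> ^ 9)"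
    by (simp only: power_divide power_mult_distrib) (simp add: field_simps flip: power_add)
  also have "sqrt r ^ 7 = real r powr 3.5"
  proof -
    have "sqrt r ^ 7 = (real r powr (1 / 2)) ^ 7" using r by (simp add: powr_half_sqrt)
    also have "\<dots> = real r powr 3.5" using r by (simp add: powr_powr flip: powr_realpow)
    finally show ?thesis .
  qed
  finally show ?thesis .
qed

text \<open>Accepts always and uses no samples. It serves the range in which the far case is
  impossible and the allowed sample number may fall below 1.\<close>

lemma trivial_algorithm:
  "\<exists>a \<tau> Ks m E. valid_algorithm d 0 0 a \<tau> Ks m E \<and>
    (\<forall>\<rho> \<sigma>. density d \<rho> \<longrightarrow> density d \<sigma> \<longrightarrow> prob_close 0 0 \<tau> Ks m E \<rho> \<sigma> = 1)"
proof -
  have "1\<^sub>m 1 - 1\<^sub>m 1 = (of_real 0 :: complex) \<cdot>\<^sub>m 1\<^sub>m 1" by (rule eq_matI) auto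
  then have z: "psd 1 (1\<^sub>m 1 - 1\<^sub>m 1)" using psd_smult[OF psd_one[of 1], of 0] by simp
  then obtain k l a \<tau> Ks m E where alg: "k + l = (0::nat)" "valid_algorithm d k l a \<tau> Ks m E"
    "\<And>\<rho> \<sigma>. density d \<rho> \<Longrightarrow> density d \<sigma> \<Longrightarrow> prob_close k l \<tau> Ks m E \<rho> \<sigma> = Re (mtrace (1\<^sub>m 1 * wordst \<rho> \<sigma> []))"
    using algorithm_of_effect[of d "[]" "1\<^sub>m 1"] psd_one[of 1] by auto
  have "mtrace (1\<^sub>m 1 * wordst \<rho> \<sigma> []) = 1" for \<rho> \<sigma> by (simp add: mtrace_def)
  moreover have "k = 0" "l = 0" using alg(1) by auto
  ultimately have "valid_algorithm d 0 0 a \<tau> Ks m E"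
    "\<And>\<rho> \<sigma>. density d \<rho> \<Longrightarrow> density d \<sigma> \<Longrightarrow> prob_close 0 0 \<tau> Ks m E \<rho> \<sigma> = 1"
    using alg(2,3) by auto
  then show ?thesis by blast
qed

lemma hellinger_tester:
  fixes \<epsilon>\<^sub>1 \<epsilon>\<^sub>2 :: real
  assumes r: "1 \<le> r" and e1: "0 \<le> \<epsilon>\<^sub>1" and e12: "\<epsilon>\<^sub>1 < \<epsilon>\<^sub>2"
  shows "\<exists>k l a \<tau> Ks m E. valid_algorithm d k l a \<tau> Ks m E \<and>
       real (k + l) \<le> 2307 * 73 ^ 7 * (real r powr 3.5 / (\<epsilon>\<^sub>2 - \<epsilon>\<^sub>1) ^ 20) *
                        (max 1 (ln (real r / (\<epsilon>\<^sub>2 - \<epsilon>\<^sub>1)))) ^ 4 \<and>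
       (\<forall>\<rho> \<sigma>. density d \<rho> \<longrightarrow> density d \<sigma> \<longrightarrow> mrank \<rho> \<le> r \<longrightarrow> mrank \<sigma> \<le> r \<longrightarrow>
          (hellinger \<rho> \<sigma> \<le> \<epsilon>\<^sub>1 \<longrightarrow> prob_close k l \<tau> Ks m E \<rho> \<sigma> \<ge> 2/3) \<and>
          (hellinger \<rho> \<sigma> \<ge> \<epsilon>\<^sub>2 \<longrightarrow> prob_close k l \<tau> Ks m E \<rho> \<sigma> \<le> 1/3))"
proof -
  define \<Delta> where "\<Delta> = \<epsilon>\<^sub>2 - \<epsilon>\<^sub>1"
  define L where "L = (max 1 (ln (real r / \<Delta>))) ^ 4"
  have L: "1 \<le> L" unfolding L_def by (intro one_le_power) simp
  have \<Delta>0: "\<Delta> > 0" using e12 by (simp add: \<Delta>_def)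
  show ?thesis
  proof (cases "\<epsilon>\<^sub>2 > 1")
    \<comment> \<open>The Hellinger distance is at most 1, so no pair of states is far and constant
      acceptance is correct.\<close>
    case True
    from trivial_algorithm[of d] obtain a \<tau> Ks m E where t: "valid_algorithm d 0 0 a \<tau> Ks m E"
      "\<And>\<rho> \<sigma>. density d \<rho> \<Longrightarrow> density d \<sigma> \<Longrightarrow> prob_close 0 0 \<tau> Ks m E \<rho> \<sigma> = 1" by blast
    have "real (0 + 0) \<le> 2307 * 73 ^ 7 * (real r powr 3.5 / \<Delta> ^ 20) * L"
      using \<Delta>0 L by simp
    moreover have "\<not> hellinger \<rho> \<sigma> \<ge> \<epsilon>\<^sub>2" if "density d \<rho>" "density d \<sigma>" for \<rho> \<sigma>
      using hellinger_bounds(2)[OF that] True by linarith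
    ultimately show ?thesis
      unfolding \<Delta>_def[symmetric] L_def[symmetric] using t
      by (intro exI[of _ 0] exI[of _ a] exI[of _ \<tau>] exI[of _ Ks] exI[of _ m] exI[of _ E]) auto
  next
    case False
    have \<Delta>1: "\<Delta> \<le> 1" using False e1 by (simp add: \<Delta>_def)
    \<comment> \<open>The gap of the squares is
      \<open>\<Delta>\<^sup>2 + 2 * \<epsilon>\<^sub>1 * \<Delta>\<close>; keeping only the first
      summand makes the parameters depend on the difference alone.\<close>
    define \<epsilon> where "\<epsilon> = \<Delta>\<^sup>2"
    have \<epsilon>: "0 < \<epsilon>" "\<epsilon> \<le> 1" using \<Delta>0 \<Delta>1 by (auto simp: \<epsilon>_def power_le_one)
    have sr: "sqrt r \<ge> 1" using r by simp
    define K where "K = nat \<lceil>72 * sqrt r / \<epsilon>\<rceil>"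
    have "\<epsilon> \<le> sqrt r" using sr \<epsilon> by linarith
    then have q: "1 \<le> sqrt r / \<epsilon>" using \<epsilon> by (simp add: le_divide_eq)
    have K: "72 * sqrt r / \<epsilon> \<le> K" unfolding K_def by (rule real_nat_ceiling_ge)
    \<comment> \<open>Since sqrt r / eps >= 1, the unit lost to the ceiling is absorbed by raising
      72 to 73; the passage from 768 to 769 for \<open>N\<close> is the same.\<close>
    have K': "real K \<le> 73 * sqrt r / \<epsilon>"
    proof -
      have "real K \<le> 72 * sqrt r / \<epsilon> + 1" unfolding K_def using q by linarith
      with q show ?thesis by simp
    qed
    have K2: "K \<ge> 2" using K q by simp
    define N where "N = nat \<lceil>768 * real K ^ 3 / \<epsilon>\<^sup>2\<rceil>"
    have N: "768 * real K ^ 3 / \<epsilon>\<^sup>2 \<le> N" unfolding N_def by (rule real_nat_ceiling_ge)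
    have N': "real N \<le> 769 * real K ^ 3 / \<epsilon>\<^sup>2"
    proof -
      have "1 \<le> real K ^ 3" using K2 by (intro one_le_power) simp
      moreover have "\<epsilon>\<^sup>2 \<le> 1" using \<epsilon> by (intro power_le_one) auto
      ultimately have q2: "1 \<le> real K ^ 3 / \<epsilon>\<^sup>2" using \<epsilon> by (simp add: le_divide_eq)
      have "real N \<le> 768 * real K ^ 3 / \<epsilon>\<^sup>2 + 1" unfolding N_def using q2 by linarith
      with q2 show ?thesis by simp
    qed
    \<comment> \<open>The midpoint of the two critical affinities
      \<open>1 - \<epsilon>\<^sub>1\<^sup>2\<close> and
      \<open>1 - \<epsilon>\<^sub>2\<^sup>2\<close>.\<close>
    define \<mu> where "\<mu> = 1 - (\<epsilon>\<^sub>1\<^sup>2 + \<epsilon>\<^sub>2\<^sup>2) / 2"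
    have gap: "\<epsilon> \<le> \<epsilon>\<^sub>2\<^sup>2 - \<epsilon>\<^sub>1\<^sup>2"
    proof -
      have "\<epsilon>\<^sub>1 * \<epsilon>\<^sub>1 \<le> \<epsilon>\<^sub>1 * \<epsilon>\<^sub>2" using e1 e12 by (intro mult_left_mono) auto
      then show ?thesis by (simp add: \<epsilon>_def \<Delta>_def power2_eq_square algebra_simps)
    qed
    from tester_exists[OF K2 K r \<epsilon> N, of d \<mu>] obtain k l a \<tau> Ks m E
      where t: "k + l = N * (1 + 2 * K ^ 4)" "valid_algorithm d k l a \<tau> Ks m E"
      and c: "\<And>\<rho> \<sigma>. density d \<rho> \<Longrightarrow> density d \<sigma> \<Longrightarrow> mrank \<rho> \<le> r \<Longrightarrow> mrank \<sigma> \<le> r \<Longrightarrow>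
      (1 - (hellinger \<rho> \<sigma>)\<^sup>2 \<ge> \<mu> + \<epsilon> / 2 \<longrightarrow> prob_close k l \<tau> Ks m E \<rho> \<sigma> \<ge> 2 / 3) \<and>
      (1 - (hellinger \<rho> \<sigma>)\<^sup>2 \<le> \<mu> - \<epsilon> / 2 \<longrightarrow> prob_close k l \<tau> Ks m E \<rho> \<sigma> \<le> 1 / 3)"
      by blast
    have "real (k + l) \<le> 2307 * 73 ^ 7 * (real r powr 3.5 / \<epsilon> ^ 9)"
      unfolding t(1) by (rule sample_bound[OF r \<epsilon> _ K' N']) (use K2 in simp)
    also have "\<dots> \<le> 2307 * 73 ^ 7 * (real r powr 3.5 / \<Delta> ^ 20)"
    proof -
      \<comment> \<open>eps^9 is \<open>\<Delta> ^ 18\<close>, and \<open>\<Delta>\<close> is at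
        most 1.\<close>
      have "\<Delta> ^ 20 \<le> \<epsilon> ^ 9" unfolding \<epsilon>_def power_mult[symmetric]
        using \<Delta>0 \<Delta>1 by (intro power_decreasing) auto
      then show ?thesis using \<Delta>0 by (intro mult_left_mono divide_left_mono) (auto simp: \<epsilon>)
    qed
    also have "\<dots> \<le> 2307 * 73 ^ 7 * (real r powr 3.5 / \<Delta> ^ 20) * L"
      using mult_left_mono[OF L, of "2307 * 73 ^ 7 * (real r powr 3.5 / \<Delta> ^ 20)"] \<Delta>0 by simp
    finally have bound: "real (k + l) \<le> 2307 * 73 ^ 7 * (real r powr 3.5 / \<Delta> ^ 20) * L" .
    have "(hellinger \<rho> \<sigma> \<le> \<epsilon>\<^sub>1 \<longrightarrow> prob_close k l \<tau> Ks m E \<rho> \<sigma> \<ge> 2/3) \<and>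
          (hellinger \<rho> \<sigma> \<ge> \<epsilon>\<^sub>2 \<longrightarrow> prob_close k l \<tau> Ks m E \<rho> \<sigma> \<le> 1/3)"
      if \<rho>: "density d \<rho>" "density d \<sigma>" "mrank \<rho> \<le> r" "mrank \<sigma> \<le> r" for \<rho> \<sigma>
    proof (intro conjI impI)
      assume "hellinger \<rho> \<sigma> \<le> \<epsilon>\<^sub>1"
      then have "(hellinger \<rho> \<sigma>)\<^sup>2 \<le> \<epsilon>\<^sub>1\<^sup>2" using hellinger_bounds(1)[OF \<rho>(1,2)] by (intro power_mono) auto
      then have "\<mu> + \<epsilon> / 2 \<le> 1 - (hellinger \<rho> \<sigma>)\<^sup>2" using gap unfolding \<mu>_def by argo
      then show "prob_close k l \<tau> Ks m E \<rho> \<sigma> \<ge> 2/3" using c[OF \<rho>] by blast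
    next
      assume "hellinger \<rho> \<sigma> \<ge> \<epsilon>\<^sub>2"
      then have "\<epsilon>\<^sub>2\<^sup>2 \<le> (hellinger \<rho> \<sigma>)\<^sup>2" using e1 e12 by (intro power_mono) auto
      then have "1 - (hellinger \<rho> \<sigma>)\<^sup>2 \<le> \<mu> - \<epsilon> / 2" using gap unfolding \<mu>_def by argo
      then show "prob_close k l \<tau> Ks m E \<rho> \<sigma> \<le> 1/3" using c[OF \<rho>] by blast
    qed
    with t(2) bound show ?thesis
      unfolding \<Delta>_def[symmetric] L_def[symmetric] by blast
  qed
qed

theorem mainTheorem10:
  shows "\<exists>C > 0. \<forall>(d::nat) (r::nat) (\<epsilon>\<^sub>1::real) (\<epsilon>\<^sub>2::real).
    1 \<le> r \<longrightarrow> 0 \<le> \<epsilon>\<^sub>1 \<longrightarrow> \<epsilon>\<^sub>1 < \<epsilon>\<^sub>2 \<longrightarrow>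
    (\<exists>k l a \<tau> Ks m E. valid_algorithm d k l a \<tau> Ks m E \<and>
       real (k + l) \<le> C * (real r powr 3.5 / (\<epsilon>\<^sub>2 - \<epsilon>\<^sub>1) ^ 20) *
                        (max 1 (ln (real r / (\<epsilon>\<^sub>2 - \<epsilon>\<^sub>1)))) ^ 4 \<and>
       (\<forall>\<rho> \<sigma>. density d \<rho> \<longrightarrow> density d \<sigma> \<longrightarrow> mrank \<rho> \<le> r \<longrightarrow> mrank \<sigma> \<le> r \<longrightarrow>
          (hellinger \<rho> \<sigma> \<le> \<epsilon>\<^sub>1 \<longrightarrow> prob_close k l \<tau> Ks m E \<rho> \<sigma> \<ge> 2/3) \<and>
          (hellinger \<rho> \<sigma> \<ge> \<epsilon>\<^sub>2 \<longrightarrow> prob_close k l \<tau> Ks m E \<rho> \<sigma> \<le> 1/3)))"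
  by (rule exI[of _ "2307 * 73 ^ 7"], intro conjI allI impI, simp) (rule hellinger_tester)

end
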